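(* Let $k$ be an algebraically closed field of characteristic $0$, let $A = k[x,y]/(f)$ be a quasi-homogeneous plane curve over $k$, and let $M$ be a finitely generated graded torsion free $A$-module. If $A$ is irreducible (i.e. $f$ is an irreducible polynomial) or $A$ is a simple curve singularity, then there exists a graded integrable connection $\nabla: \mathrm{Der}_k(A) \to \mathrm{End}_k(M)$ on $M$.
   Context: Quasi-homogeneous plane curve: $k[x,y]$ is graded by positive integer weights $w_x = \deg(x)$, $w_y = \deg(y)$ with $\gcd(w_x,w_y)=1$; $f \in k[x,y]$ is a nonzero homogeneous element (a quasi-homogeneous polynomial) of positive weight $w_f$; the ring $A = k[x,y]/(f)$ is assumed reduced and carries the induced grading. Simple curve singularity: by abuse of language, the graded algebra $A = k[x,y]/(f)$ where $f$ is one of the quasi-homogeneous polynomials $A_n$: $x^2+y^{n+1}$ ($n\ge 1$); $D_n$: $x^2y+y^{n-1}$ ($n\ge 4$); $E_6$: $x^3+y^4$; $E_7$: $x^3+xy^3$; $E_8$: $x^3+y^5$ (with the weights making $f$ homogeneous). Graded modules are $\mathbf{Z}$-graded. Let $Q(A) = S^{-1}A$, where $S$ is the set of homogeneous non-zero divisors of $A$. A finitely generated graded $A$-module $M$ is torsion free if the natural map $M \to M\otimes_A Q(A)$ is injective. $\mathrm{Der}_k(A)$ is the $A$-module of $k$-linear derivations $A\to A$. A connection on $M$ is an $A$-linear homomorphism $\nabla: \mathrm{Der}_k(A)\to \mathrm{End}_k(M)$ such that $\nabla_P(am) = a\nabla_P(m) + P(a)m$ for all $P \in \mathrm{Der}_k(A)$,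 $a\in A$, $m \in M$. It is integrable if it is a homomorphism of Lie algebras. A derivation $P$ is homogeneous of weight $\lambda\in\mathbf{Z}$ if $P(A_w)\subseteq A_{w+\lambda}$ for all $w$. The connection is graded if $\nabla_P(M_w)\subseteq M_{w+\lambda}$ for every homogeneous derivation $P$ of weight $\lambda$ and every $w\in\mathbf{Z}$. *)

theory Defs
  imports
    "HOL-Algebra.Algebraic_Closure_Type"
    "HOL-Algebra.QuotRing"
    "HOL-Algebra.Free_Abelian_Groups"
begin

section \<open>Quasi-homogeneous plane curves\<close>

text \<open>
  The polynomial ring \<open>k[x,y]\<close> is the type \<open>'k poly poly\<close>, read as \<open>k[x][y]\<close>: the inner
  variable is \<open>x\<close>, the outer one is \<open>y\<close>, so \<open>poly.coeff (poly.coeff p j) i\<close> is the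
  coefficient of the monomial \<open>x^i y^j\<close>.
\<close>

definition var_x :: "'k::comm_ring_1 poly poly"
  where "var_x = [:[:0, 1:]:]"

definition var_y :: "'k::comm_ring_1 poly poly"
  where "var_y = [:0, 1:]"

definition weighted_homogeneous :: "nat \<Rightarrow> nat \<Rightarrow> int \<Rightarrow> 'k::comm_ring_1 poly poly \<Rightarrow> bool"
  where "weighted_homogeneous wx wy w p \<longleftrightarrow>
    (\<forall>i j. poly.coeff (poly.coeff p j) i \<noteq> 0 \<longrightarrow> int (wx * i + wy * j) = w)"

text \<open>The coordinate ring \<open>A = k[x,y]/(f)\<close>, its structure map \<open>k \<rightarrow> A\<close>, and its induced grading.\<close>

definition curve_class :: "'k::field poly poly \<Rightarrow> 'k poly poly \<Rightarrow> 'k poly poly set"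
  where "curve_class f p = (PIdl\<^bsub>ring_of_type_algebra\<^esub> f) +>\<^bsub>ring_of_type_algebra\<^esub> p"

definition curve_ring :: "'k::field poly poly \<Rightarrow> 'k poly poly set ring"
  where "curve_ring f = ring_of_type_algebra Quot (PIdl\<^bsub>ring_of_type_algebra\<^esub> f)"

definition curve_scalar :: "'k::field poly poly \<Rightarrow> 'k \<Rightarrow> 'k poly poly set"
  where "curve_scalar f c = curve_class f [:[:c:]:]"

definition curve_grading ::
    "nat \<Rightarrow> nat \<Rightarrow> 'k::field poly poly \<Rightarrow> int \<Rightarrow> 'k poly poly set set"
  where "curve_grading wx wy f w = curve_class f ` {p. weighted_homogeneous wx wy w p}"

definition reduced_ring :: "('a, 'b) ring_scheme \<Rightarrow> bool"
  where "reduced_ring A \<longleftrightarrow>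
    (\<forall>a\<in>carrier A. \<forall>n::nat. a [^]\<^bsub>A\<^esub> n = \<zero>\<^bsub>A\<^esub> \<longrightarrow> a = \<zero>\<^bsub>A\<^esub>)"

definition quasi_homogeneous_curve :: "nat \<Rightarrow> nat \<Rightarrow> int \<Rightarrow> 'k::field poly poly \<Rightarrow> bool"
  where "quasi_homogeneous_curve wx wy d f \<longleftrightarrow>
    wx > 0 \<and> wy > 0 \<and> coprime wx wy \<and>
    f \<noteq> 0 \<and> d > 0 \<and> weighted_homogeneous wx wy d f \<and>
    reduced_ring (curve_ring f)"

definition simple_curve_singularity :: "'k::field poly poly \<Rightarrow> bool"
  where "simple_curve_singularity f \<longleftrightarrow>
    (\<exists>n::nat. n \<ge> 1 \<and> f = var_x ^ 2 + var_y ^ (n + 1)) \<or>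
    (\<exists>n::nat. n \<ge> 4 \<and> f = var_x ^ 2 * var_y + var_y ^ (n - 1)) \<or>
    f = var_x ^ 3 + var_y ^ 4 \<or>
    f = var_x ^ 3 + var_x * var_y ^ 3 \<or>
    f = var_x ^ 3 + var_y ^ 5"


section \<open>Finitely generated and graded modules\<close>

definition finitely_generated_module ::
    "('a, 'b) ring_scheme \<Rightarrow> ('a, 'm) module \<Rightarrow> bool"
  where "finitely_generated_module A M \<longleftrightarrow>
    (\<exists>S. finite S \<and> S \<subseteq> carrier M \<and>
      (\<forall>m\<in>carrier M. \<exists>c\<in>S \<rightarrow> carrier A. m = (\<Oplus>\<^bsub>M\<^esub>s\<in>S. c s \<odot>\<^bsub>M\<^esub> s)))"

text \<open>
  \<open>gA\<close> and \<open>gM\<close> are the families of homogeneous components of \<open>A\<close> and \<open>M\<close>. The last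
  condition says that \<open>M\<close> is the internal direct sum of the additive subgroups \<open>gM w\<close>.
\<close>

definition graded_module ::
    "('a, 'b) ring_scheme \<Rightarrow> (int \<Rightarrow> 'a set) \<Rightarrow> ('a, 'm) module \<Rightarrow> (int \<Rightarrow> 'm set) \<Rightarrow> bool"
  where "graded_module A gA M gM \<longleftrightarrow>
    module A M \<and>
    (\<forall>w. additive_subgroup (gM w) M) \<and>
    (\<forall>v w. \<forall>a\<in>gA v. \<forall>m\<in>gM w. a \<odot>\<^bsub>M\<^esub> m \<in> gM (v + w)) \<and>
    (\<forall>m\<in>carrier M. \<exists>!c. (\<forall>w. c w \<in> gM w) \<and> finite {w. c w \<noteq> \<zero>\<^bsub>M\<^esub>} \<and>
      m = (\<Oplus>\<^bsub>M\<^esub>w\<in>{w. c w \<noteq> \<zero>\<^bsub>M\<^esub>}. c w))"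


section \<open>Localization, tensor products and torsion free modules\<close>

definition homogeneous_nonzerodivisors ::
    "('a, 'b) ring_scheme \<Rightarrow> (int \<Rightarrow> 'a set) \<Rightarrow> 'a set"
  where "homogeneous_nonzerodivisors A gA =
    {s \<in> carrier A. (\<exists>w. s \<in> gA w) \<and> (\<forall>a\<in>carrier A. s \<otimes>\<^bsub>A\<^esub> a = \<zero>\<^bsub>A\<^esub> \<longrightarrow> a = \<zero>\<^bsub>A\<^esub>)}"

text \<open>The pair \<open>(a, s)\<close> stands for the fraction \<open>a/s\<close>.\<close>

definition fraction_rel ::
    "('a, 'b) ring_scheme \<Rightarrow> 'a set \<Rightarrow> (('a \<times> 'a) \<times> ('a \<times> 'a)) set"
  where "fraction_rel A S =
    {((a, s), (b, t)). a \<in> carrier A \<and> s \<in> S \<and> b \<in> carrier A \<and> t \<in> S \<and>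
      (\<exists>u\<in>S. u \<otimes>\<^bsub>A\<^esub> (t \<otimes>\<^bsub>A\<^esub> a) = u \<otimes>\<^bsub>A\<^esub> (s \<otimes>\<^bsub>A\<^esub> b))}"

definition localization ::
    "('a, 'b) ring_scheme \<Rightarrow> 'a set \<Rightarrow> ('a, ('a \<times> 'a) set) module"
  where "localization A S =
    \<lparr>carrier = (carrier A \<times> S) // fraction_rel A S,
     monoid.mult = (\<lambda>U V. \<Union>(a, s)\<in>U. \<Union>(b, t)\<in>V.
       fraction_rel A S `` {(a \<otimes>\<^bsub>A\<^esub> b, s \<otimes>\<^bsub>A\<^esub> t)}),
     monoid.one = fraction_rel A S `` {(\<one>\<^bsub>A\<^esub>, \<one>\<^bsub>A\<^esub>)},
     ring.zero = fraction_rel A S `` {(\<zero>\<^bsub>A\<^esub>, \<one>\<^bsub>A\<^esub>)},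
     ring.add = (\<lambda>U V. \<Union>(a, s)\<in>U. \<Union>(b, t)\<in>V.
       fraction_rel A S `` {((t \<otimes>\<^bsub>A\<^esub> a) \<oplus>\<^bsub>A\<^esub> (s \<otimes>\<^bsub>A\<^esub> b), s \<otimes>\<^bsub>A\<^esub> t)}),
     module.smult = (\<lambda>c U. \<Union>(a, s)\<in>U. fraction_rel A S `` {(c \<otimes>\<^bsub>A\<^esub> a, s)})\<rparr>"

text \<open>
  The abelian group underlying \<open>M \<otimes>\<^sub>A N\<close>: the free abelian group on the pairs \<open>(m, n)\<close>,
  written additively as finitely supported integer-valued functions, modulo the subgroup
  generated by the bilinearity relations.
\<close>

definition tensor_relations ::
    "('a, 'b) ring_scheme \<Rightarrow> ('a, 'm) module \<Rightarrow> ('a, 'n) module \<Rightarrow> ('m \<times> 'n \<Rightarrow>\<^sub>0 int) set"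
  where "tensor_relations A M N =
    {frag_of (m \<oplus>\<^bsub>M\<^esub> m', n) - frag_of (m, n) - frag_of (m', n) | m m' n.
       m \<in> carrier M \<and> m' \<in> carrier M \<and> n \<in> carrier N} \<union>
    {frag_of (m, n \<oplus>\<^bsub>N\<^esub> n') - frag_of (m, n) - frag_of (m, n') | m n n'.
       m \<in> carrier M \<and> n \<in> carrier N \<and> n' \<in> carrier N} \<union>
    {frag_of (a \<odot>\<^bsub>M\<^esub> m, n) - frag_of (m, a \<odot>\<^bsub>N\<^esub> n) | a m n.
       a \<in> carrier A \<and> m \<in> carrier M \<and> n \<in> carrier N}"

definition tensor_kernel ::
    "('a, 'b) ring_scheme \<Rightarrow> ('a, 'm) module \<Rightarrow> ('a, 'n) module \<Rightarrow> ('m \<times> 'n \<Rightarrow>\<^sub>0 int) set"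
  where "tensor_kernel A M N =
    generate (free_Abelian_group (carrier M \<times> carrier N)) (tensor_relations A M N)"

definition tensor_product ::
    "('a, 'b) ring_scheme \<Rightarrow> ('a, 'm) module \<Rightarrow> ('a, 'n) module \<Rightarrow> ('m \<times> 'n \<Rightarrow>\<^sub>0 int) set monoid"
  where "tensor_product A M N =
    free_Abelian_group (carrier M \<times> carrier N) Mod tensor_kernel A M N"

definition pure_tensor ::
    "('a, 'b) ring_scheme \<Rightarrow> ('a, 'm) module \<Rightarrow> ('a, 'n) module \<Rightarrow> 'm \<Rightarrow> 'n \<Rightarrow> ('m \<times> 'n \<Rightarrow>\<^sub>0 int) set"
  where "pure_tensor A M N m n =
    tensor_kernel A M N #>\<^bsub>free_Abelian_group (carrier M \<times> carrier N)\<^esub> frag_of (m, n)"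

definition torsion_free_module ::
    "('a, 'b) ring_scheme \<Rightarrow> (int \<Rightarrow> 'a set) \<Rightarrow> ('a, 'm) module \<Rightarrow> bool"
  where "torsion_free_module A gA M \<longleftrightarrow>
    (let Q = localization A (homogeneous_nonzerodivisors A gA)
     in inj_on (\<lambda>m. pure_tensor A M Q m \<one>\<^bsub>Q\<^esub>) (carrier M))"


section \<open>Derivations and connections\<close>

text \<open>
  Below, \<open>\<iota>\<close> is the structure map from \<open>k\<close> to the \<open>k\<close>-algebra \<open>A\<close>. Derivations of \<open>A\<close> and
  \<open>k\<close>-linear endomorphisms of \<open>M\<close> are extensional functions, so that equality in \<open>Der\<^sub>k(A)\<close> and
  \<open>End\<^sub>k(M)\<close> is equality of functions on the respective carriers.
\<close>

definition Der :: "('k \<Rightarrow> 'a) \<Rightarrow> ('a, 'b) ring_scheme \<Rightarrow> ('a \<Rightarrow> 'a) set"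
  where "Der \<iota> A =
    {P \<in> carrier A \<rightarrow>\<^sub>E carrier A.
      (\<forall>a\<in>carrier A. \<forall>b\<in>carrier A. P (a \<oplus>\<^bsub>A\<^esub> b) = P a \<oplus>\<^bsub>A\<^esub> P b) \<and>
      (\<forall>c. \<forall>a\<in>carrier A. P (\<iota> c \<otimes>\<^bsub>A\<^esub> a) = \<iota> c \<otimes>\<^bsub>A\<^esub> P a) \<and>
      (\<forall>a\<in>carrier A. \<forall>b\<in>carrier A. P (a \<otimes>\<^bsub>A\<^esub> b) = (a \<otimes>\<^bsub>A\<^esub> P b) \<oplus>\<^bsub>A\<^esub> (P a \<otimes>\<^bsub>A\<^esub> b))}"

definition der_add :: "('a, 'b) ring_scheme \<Rightarrow> ('a \<Rightarrow> 'a) \<Rightarrow> ('a \<Rightarrow> 'a) \<Rightarrow> 'a \<Rightarrow> 'a"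
  where "der_add A P Q = (\<lambda>b\<in>carrier A. P b \<oplus>\<^bsub>A\<^esub> Q b)"

definition der_smult :: "('a, 'b) ring_scheme \<Rightarrow> 'a \<Rightarrow> ('a \<Rightarrow> 'a) \<Rightarrow> 'a \<Rightarrow> 'a"
  where "der_smult A a P = (\<lambda>b\<in>carrier A. a \<otimes>\<^bsub>A\<^esub> P b)"

definition der_bracket :: "('a, 'b) ring_scheme \<Rightarrow> ('a \<Rightarrow> 'a) \<Rightarrow> ('a \<Rightarrow> 'a) \<Rightarrow> 'a \<Rightarrow> 'a"
  where "der_bracket A P Q = (\<lambda>b\<in>carrier A. P (Q b) \<ominus>\<^bsub>A\<^esub> Q (P b))"

definition End_k :: "('k \<Rightarrow> 'a) \<Rightarrow> ('a, 'm) module \<Rightarrow> ('m \<Rightarrow> 'm) set"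
  where "End_k \<iota> M =
    {\<phi> \<in> carrier M \<rightarrow>\<^sub>E carrier M.
      (\<forall>m\<in>carrier M. \<forall>n\<in>carrier M. \<phi> (m \<oplus>\<^bsub>M\<^esub> n) = \<phi> m \<oplus>\<^bsub>M\<^esub> \<phi> n) \<and>
      (\<forall>c. \<forall>m\<in>carrier M. \<phi> (\<iota> c \<odot>\<^bsub>M\<^esub> m) = \<iota> c \<odot>\<^bsub>M\<^esub> \<phi> m)}"

definition connection ::
    "('k \<Rightarrow> 'a) \<Rightarrow> ('a, 'b) ring_scheme \<Rightarrow> ('a, 'm) module \<Rightarrow> (('a \<Rightarrow> 'a) \<Rightarrow> 'm \<Rightarrow> 'm) \<Rightarrow> bool"
  where "connection \<iota> A M D \<longleftrightarrow>
    D \<in> Der \<iota> A \<rightarrow> End_k \<iota> M \<and>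
    (\<forall>P\<in>Der \<iota> A. \<forall>Q\<in>Der \<iota> A. \<forall>m\<in>carrier M.
      D (der_add A P Q) m = D P m \<oplus>\<^bsub>M\<^esub> D Q m) \<and>
    (\<forall>a\<in>carrier A. \<forall>P\<in>Der \<iota> A. \<forall>m\<in>carrier M.
      D (der_smult A a P) m = a \<odot>\<^bsub>M\<^esub> D P m) \<and>
    (\<forall>P\<in>Der \<iota> A. \<forall>a\<in>carrier A. \<forall>m\<in>carrier M.
      D P (a \<odot>\<^bsub>M\<^esub> m) = (a \<odot>\<^bsub>M\<^esub> D P m) \<oplus>\<^bsub>M\<^esub> (P a \<odot>\<^bsub>M\<^esub> m))"

text \<open>A connection is additive and \<open>k\<close>-linear, so only compatibility with brackets is required.\<close>

definition integrable_connection ::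
    "('k \<Rightarrow> 'a) \<Rightarrow> ('a, 'b) ring_scheme \<Rightarrow> ('a, 'm) module \<Rightarrow> (('a \<Rightarrow> 'a) \<Rightarrow> 'm \<Rightarrow> 'm) \<Rightarrow> bool"
  where "integrable_connection \<iota> A M D \<longleftrightarrow>
    connection \<iota> A M D \<and>
    (\<forall>P\<in>Der \<iota> A. \<forall>Q\<in>Der \<iota> A. \<forall>m\<in>carrier M.
      D (der_bracket A P Q) m = D P (D Q m) \<ominus>\<^bsub>M\<^esub> D Q (D P m))"

definition homogeneous_derivation ::
    "('k \<Rightarrow> 'a) \<Rightarrow> ('a, 'b) ring_scheme \<Rightarrow> (int \<Rightarrow> 'a set) \<Rightarrow> int \<Rightarrow> ('a \<Rightarrow> 'a) \<Rightarrow> bool"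
  where "homogeneous_derivation \<iota> A gA l P \<longleftrightarrow>
    P \<in> Der \<iota> A \<and> (\<forall>w. P ` gA w \<subseteq> gA (w + l))"

definition graded_connection ::
    "('k \<Rightarrow> 'a) \<Rightarrow> ('a, 'b) ring_scheme \<Rightarrow> (int \<Rightarrow> 'a set) \<Rightarrow> ('a, 'm) module \<Rightarrow> (int \<Rightarrow> 'm set) \<Rightarrow>
     (('a \<Rightarrow> 'a) \<Rightarrow> 'm \<Rightarrow> 'm) \<Rightarrow> bool"
  where "graded_connection \<iota> A gA M gM D \<longleftrightarrow>
    connection \<iota> A M D \<and>
    (\<forall>P l. homogeneous_derivation \<iota> A gA l P \<longrightarrow> (\<forall>w. D P ` gM w \<subseteq> gM (w + l)))"

end

theory Submission
  imports Defs "HOL-Library.Function_Algebras"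
begin

text \<open>
  Let \<open>E\<close> be the Euler derivation, which multiplies the component of weight \<open>w\<close> of a graded object by
  \<open>w\<close>. Every derivation \<open>P\<close> of a reduced quasi-homogeneous curve is proportional to \<open>E\<close> over the ring of
  fractions (\<open>derivation_parallel_euler\<close>): \<open>P = h E\<close>, where \<open>h = P(x) / (wx x)\<close> if \<open>x\<close> is a nonzerodivisor,
  and otherwise \<open>h = P(y) / (wy y)\<close> for the curves considered here. So a connection amounts to
  an operator \<open>T\<close> on \<open>M\<close> of degree 0 with \<open>T(a m) = a T(m) + E(a) m\<close> such that \<open>h T\<close> preserves \<open>M\<close> for all
  these \<open>h\<close>; then \<open>P \<mapsto> h T\<close> is a graded connection. It is integrable because all of its operators are
  multiples of the single operator \<open>T\<close> (\<open>integrable_graded_connection_of_operator\<close>).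

  The proportionality says also that \<open>h\<close> maps the maximal ideal \<open>(x, y)\<close> into \<open>A\<close>. As \<open>A\<close> is Gorenstein, a
  torsion free module without free summands is stable under such \<open>h\<close>, so there the weight operator can be
  taken for \<open>T\<close>. On a free module one takes \<open>E\<close> on the coordinates: its values lie in \<open>(x, y)\<close>. In general
  one splits off a free summand of maximal rank and combines the two operators
  (\<open>exists_good_euler_operator\<close>).

  The Gorenstein property enters in explicit form. An irreducible \<open>f\<close> and the equation of a simple
  singularity contain a pure power of one of the variables (\<open>exists_pure_power\<close>), say \<open>y^(N+1)\<close>. Then \<open>A\<close>
  is free over \<open>k[x]\<close> with basis \<open>1, y, \<dots>, y^N\<close>; the condition on \<open>h = q/x\<close> becomes that \<open>q\<close> is a multiple
  of \<open>y^N\<close> modulo \<open>x\<close>; and the dual basis turns \<open>k[x]\<close>-linear functionals on \<open>M\<close> into \<open>A\<close>-linear maps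
  \<open>M \<rightarrow> A\<close>. For homogeneous \<open>n\<close> with \<open>y^N n\<close> not in \<open>x M\<close> this yields a map that sends \<open>n\<close> to 1
  (\<open>exists_splitting_form\<close>), so \<open>n\<close> generates a free summand.
\<close>

section \<open>Polynomials in two variables\<close>

abbreviation coeff2 :: "'k::zero poly poly \<Rightarrow> nat \<Rightarrow> nat \<Rightarrow> 'k"
  where "coeff2 p i j \<equiv> poly.coeff (poly.coeff p j) i"

abbreviation const2 :: "'k::zero \<Rightarrow> 'k poly poly"
  where "const2 c \<equiv> [:[:c:]:]"

lemma poly2_eqI: "(\<And>i j. coeff2 p i j = coeff2 q i j) \<Longrightarrow> p = q"
  by (intro poly_eqI) auto

lemma pCons_eq_var_x: "[:pCons a p:] = const2 a + var_x * [:p:]"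
  by (simp add: var_x_def)

lemma pCons_eq_var_y: "pCons (a :: 'k::comm_ring_1 poly) p = [:a:] + var_y * p"
  by (simp add: var_y_def)

lemma bivariate_induct [case_names const var_x var_y add mult]:
  fixes p :: "'k::comm_ring_1 poly poly"
  assumes c: "\<And>c. P (const2 c)" and x: "P var_x" and y: "P var_y"
    and add: "\<And>p q. P p \<Longrightarrow> P q \<Longrightarrow> P (p + q)" and mult: "\<And>p q. P p \<Longrightarrow> P q \<Longrightarrow> P (p * q)"
  shows "P p"
proof (induction p)
  case 0
  show ?case using c[of 0] by simp
next
  case (pCons a p)
  have "P [:a:]"
  proof (induction a)
    case 0
    show ?case using c[of 0] by simp
  next
    case (pCons a q)
    show ?case by (subst pCons_eq_var_x) (intro add mult c x pCons)
  qed
  with add mult[OF y pCons(2)] show ?case by (subst pCons_eq_var_y) simp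
qed

lemma coeff2_const [simp]: "coeff2 (const2 c) i j = (if i = 0 \<and> j = 0 then c else 0)"
  by (auto simp: coeff_pCons split: nat.split)

lemma coeff2_const_mult [simp]: "coeff2 (const2 c * p) i j = c * coeff2 p i j"
  by simp

lemma coeff2_var_x: "coeff2 (var_x :: 'k::comm_ring_1 poly poly) i j = (if i = 1 \<and> j = 0 then 1 else 0)"
  by (auto simp: var_x_def coeff_pCons split: nat.split)

lemma coeff2_var_y: "coeff2 (var_y :: 'k::comm_ring_1 poly poly) i j = (if i = 0 \<and> j = 1 then 1 else 0)"
  by (auto simp: var_y_def coeff_pCons split: nat.split)

lemma coeff2_var_x_mult: "coeff2 (var_x * p) i j = (case i of 0 \<Rightarrow> 0 | Suc i' \<Rightarrow> coeff2 p i' j)"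
  by (simp add: var_x_def coeff_pCons)

lemma coeff2_var_y_mult: "coeff2 (var_y * p) i j = (case j of 0 \<Rightarrow> 0 | Suc j' \<Rightarrow> coeff2 p i j')"
  by (simp add: var_y_def coeff_pCons split: nat.split)

lemma coeff2_mult: "coeff2 (p * q) i j = (\<Sum>l\<le>j. \<Sum>h\<le>i. coeff2 p h l * coeff2 q (i - h) (j - l))"
  by (simp add: coeff_mult coeff_sum)

lemma coeff2_var_y_power_mult:
  "coeff2 (var_y ^ n * p) i j = (if j < n then 0 else coeff2 p i (j - n))"
  by (induction n arbitrary: j) (auto simp: mult.assoc coeff2_var_y_mult split: nat.split)

lemma coeff2_var_x_power_mult:
  "coeff2 (var_x ^ n * p) i j = (if i < n then 0 else coeff2 p (i - n) j)"
  by (induction n arbitrary: i) (auto simp: mult.assoc coeff2_var_x_mult split: nat.split)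

lemma var_x_nonzero [simp]: "var_x \<noteq> (0 :: 'k::comm_ring_1 poly poly)"
  and var_y_nonzero [simp]: "var_y \<noteq> (0 :: 'k::comm_ring_1 poly poly)"
  by (simp_all add: var_x_def var_y_def)

subsection \<open>Restriction to the line \<open>x = 0\<close>\<close>

definition at_x0 :: "'k::comm_ring_1 poly poly \<Rightarrow> 'k poly"
  where "at_x0 = map_poly (\<lambda>c. poly.coeff c 0)"

lemma coeff_at_x0 [simp]: "poly.coeff (at_x0 p) j = coeff2 p 0 j"
  by (simp add: at_x0_def coeff_map_poly)

lemma at_x0_add [simp]: "at_x0 (p + q) = at_x0 p + at_x0 q"
  and at_x0_diff [simp]: "at_x0 (p - q) = at_x0 p - at_x0 q"
  and at_x0_mult [simp]: "at_x0 (p * q) = at_x0 p * at_x0 q"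
  and at_x0_var_x [simp]: "at_x0 var_x = 0"
  by (auto intro!: poly_eqI simp: coeff_mult coeff2_var_x coeff_sum)

lemma at_x0_var_y [simp]: "at_x0 var_y = [:0, 1:]"
  by (rule poly_eqI) (simp add: coeff2_var_y coeff_pCons split: nat.split)

lemma at_x0_eq_0_imp_dvd:
  assumes "at_x0 p = 0"
  shows "var_x dvd p"
proof
  let ?q = "map_poly (\<lambda>c. poly_shift 1 c) p"
  show "p = var_x * ?q"
  proof (rule poly2_eqI)
    fix i j
    have "coeff2 p 0 j = 0"
      using arg_cong[OF assms, of "\<lambda>q. poly.coeff q j"] by simp
    then show "coeff2 p i j = coeff2 (var_x * ?q) i j"
      by (simp add: coeff2_var_x_mult coeff_map_poly coeff_poly_shift split: nat.split)
  qed
qed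

subsection \<open>Partial derivatives\<close>

definition deriv_x :: "'k::idom poly poly \<Rightarrow> 'k poly poly"
  where "deriv_x = map_poly pderiv"

abbreviation deriv_y :: "'k::idom poly poly \<Rightarrow> 'k poly poly"
  where "deriv_y \<equiv> pderiv"

lemma coeff_deriv_x: "poly.coeff (deriv_x p) j = pderiv (poly.coeff p j)"
  by (simp add: deriv_x_def coeff_map_poly)

lemma deriv_x_add: "deriv_x (p + q) = deriv_x p + deriv_x q"
  by (rule poly_eqI) (simp add: coeff_deriv_x pderiv_add)

lemma pderiv_sum: "pderiv (sum p I) = (\<Sum>i\<in>I. pderiv (p i))"
  by (induction I rule: infinite_finite_induct) (simp_all add: pderiv_add)

lemma deriv_x_mult: "deriv_x (p * q) = p * deriv_x q + q * deriv_x p"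
proof (rule poly_eqI)
  fix n
  have "poly.coeff (deriv_x (p * q)) n =
      (\<Sum>i\<le>n. poly.coeff p i * pderiv (poly.coeff q (n - i)))
      + (\<Sum>i\<le>n. poly.coeff q (n - i) * pderiv (poly.coeff p i))"
    by (simp add: coeff_deriv_x coeff_mult pderiv_sum pderiv_mult sum.distrib)
  also have "(\<Sum>i\<le>n. poly.coeff q (n - i) * pderiv (poly.coeff p i))
      = (\<Sum>i\<le>n. poly.coeff q i * pderiv (poly.coeff p (n - i)))"
    by (rule sum.reindex_bij_witness[of _ "\<lambda>i. n - i" "\<lambda>i. n - i"]) auto
  finally show "poly.coeff (deriv_x (p * q)) n = poly.coeff (p * deriv_x q + q * deriv_x p) n"
    by (simp add: coeff_mult coeff_deriv_x)
qed

lemma deriv_const2 [simp]: "deriv_x (const2 c) = 0"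
  by (rule poly_eqI) (simp add: coeff_deriv_x coeff_pCons split: nat.split)

lemma deriv_x_var_x [simp]: "deriv_x var_x = 1"
  and deriv_x_var_y [simp]: "deriv_x var_y = 0"
  and deriv_y_var_x [simp]: "deriv_y var_x = 0"
  and deriv_y_var_y [simp]: "deriv_y var_y = 1"
  by (auto intro!: poly_eqI simp: coeff_deriv_x var_x_def var_y_def coeff_pCons pderiv_pCons one_pCons split: nat.split)

text \<open>
  In characteristic 0 differentiation lowers the degree of a non-constant polynomial by exactly one,
  so differentiating first in \<open>y\<close> and then in \<open>x\<close> ends in a nonzero constant.
\<close>

lemma deriv_closed_contains_const:
  fixes g :: "'k::field_char_0 poly poly"
  assumes "J g" "g \<noteq> 0" and x: "\<And>p. J p \<Longrightarrow> J (deriv_x p)" and y: "\<And>p. J p \<Longrightarrow> J (deriv_y p)"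
  shows "\<exists>c. c \<noteq> 0 \<and> J (const2 c)"
  using assms(1,2)
proof (induction "degree g" arbitrary: g)
  case 0
  then obtain h where g: "g = [:h:]" by (metis degree_0_id)
  have "J [:h:] \<Longrightarrow> h \<noteq> 0 \<Longrightarrow> \<exists>c. c \<noteq> 0 \<and> J (const2 c)" for h :: "'k poly"
  proof (induction "degree h" arbitrary: h)
    case 0
    then obtain c where "h = [:c:]" by (metis degree_0_id)
    with 0 show ?case by auto
  next
    case (Suc n)
    have "deriv_x [:h:] = [:pderiv h:]"
      by (rule poly_eqI) (simp add: coeff_deriv_x coeff_pCons split: nat.split)
    with x[OF Suc.prems(1)] have "J [:pderiv h:]" by simp
    moreover have "degree (pderiv h) = n" "pderiv h \<noteq> 0"
      using Suc.hyps(2) by (auto simp: degree_pderiv pderiv_eq_0_iff)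
    ultimately show ?case using Suc.hyps(1) by blast
  qed
  with 0 g show ?case by auto
next
  case (Suc n)
  have "degree (pderiv g) = n" "pderiv g \<noteq> 0"
    using Suc.hyps(2) by (auto simp: degree_pderiv pderiv_eq_0_iff)
  with Suc y[of g] show ?case by blast
qed

text \<open>
  Multiplying by \<open>u\<close> once more lets one differentiate \<open>g u\<close> without differentiating \<open>u\<close>; reducedness
  removes the extra factor. So the ideal of all \<open>g\<close> with \<open>g u \<in> (f)\<close> is stable under \<open>\<partial>/\<partial>x\<close> and \<open>\<partial>/\<partial>y\<close>,
  and repeated differentiation of \<open>f\<close> leads to a nonzero constant in it.
\<close>

lemma jacobian_torsion_free:
  fixes f :: "'k::field_char_0 poly poly"
  assumes red: "\<And>p. f dvd p ^ 2 \<Longrightarrow> f dvd p" and "f \<noteq> 0"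
    and fx: "f dvd u * deriv_x f" and fy: "f dvd u * deriv_y f"
  shows "f dvd u"
proof -
  have step: "f dvd \<delta> g * u"
    if "f dvd u * \<delta> f" and "f dvd g * u" and "\<And>p q. \<delta> (p * q) = p * \<delta> q + q * \<delta> p"
    for \<delta> :: "'k poly poly \<Rightarrow> 'k poly poly" and g
  proof -
    from that(2) obtain s where s: "g * u = f * s" by blast
    have "u * u * \<delta> g = u * \<delta> (g * u) - g * u * \<delta> u"
      using that(3)[of g u] by (simp add: algebra_simps)
    also have "\<dots> = u * \<delta> (f * s) - f * s * \<delta> u"
      by (simp add: s)
    also have "\<dots> = f * (u * \<delta> s) + s * (u * \<delta> f) - f * s * \<delta> u"
      using that(3)[of f s] by (simp add: algebra_simps)
    also have "f dvd \<dots>"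
      using that(1) by (intro dvd_diff dvd_add) auto
    finally have "f dvd u * u * \<delta> g * \<delta> g" by simp
    then have "f dvd (\<delta> g * u) ^ 2" by (simp add: power2_eq_square algebra_simps)
    then show ?thesis by (rule red)
  qed
  have "\<exists>c. c \<noteq> 0 \<and> f dvd const2 c * u"
  proof (rule deriv_closed_contains_const)
    show "f dvd f * u" by simp
  next
    fix p assume p: "f dvd p * u"
    show "f dvd deriv_x p * u" by (rule step[OF fx p deriv_x_mult])
    show "f dvd deriv_y p * u" by (rule step[OF fy p pderiv_mult])
  qed (fact \<open>f \<noteq> 0\<close>)
  then obtain c where c: "c \<noteq> 0" "f dvd const2 c * u" by blast
  then have "f dvd const2 (inverse c) * (const2 c * u)" by (metis dvd_mult)
  also have "const2 (inverse c) * (const2 c * u) = u"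
    using c by (simp flip: one_pCons)
  finally show ?thesis .
qed

subsection \<open>The Euler derivation\<close>

definition euler :: "nat \<Rightarrow> nat \<Rightarrow> 'k::idom poly poly \<Rightarrow> 'k poly poly"
  where "euler wx wy p = of_nat wx * (var_x * deriv_x p) + of_nat wy * (var_y * deriv_y p)"

lemma of_nat_poly2: "of_nat n = const2 (of_nat n)"
  by (simp add: of_nat_poly)

lemma of_int_poly2: "of_int n = const2 (of_int n :: 'k::comm_ring_1)"
  by (simp add: of_int_poly)

lemma coeff2_euler: "coeff2 (euler wx wy p) i j = of_nat (wx * i + wy * j) * coeff2 p i j"
  unfolding euler_def of_nat_poly2
  by (simp add: coeff2_var_x_mult coeff2_var_y_mult coeff_deriv_x coeff_pderiv algebra_simps
      of_nat_poly coeff2_const_mult split: nat.split)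

lemma euler_add: "euler wx wy (p + q) = euler wx wy p + euler wx wy q"
  by (simp add: euler_def deriv_x_add pderiv_add algebra_simps)

lemma euler_mult: "euler wx wy (p * q) = p * euler wx wy q + euler wx wy p * q"
  by (simp add: euler_def deriv_x_mult pderiv_mult algebra_simps)

lemma euler_const [simp]: "euler wx wy (const2 c) = 0"
  by (simp add: euler_def)

lemma euler_var_x [simp]: "euler wx wy var_x = of_nat wx * var_x"
  and euler_var_y [simp]: "euler wx wy var_y = of_nat wy * var_y"
  by (simp_all add: euler_def)

lemma euler_homogeneous:
  assumes "weighted_homogeneous wx wy w p"
  shows "euler wx wy p = of_int w * p"
proof (rule poly2_eqI)
  fix i j
  have "of_nat (wx * i + wy * j) * coeff2 p i j = of_int w * coeff2 p i j"
  proof (cases "coeff2 p i j = 0")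
    case False
    with assms have "w = int (wx * i + wy * j)" unfolding weighted_homogeneous_def by metis
    then show ?thesis by simp
  qed simp
  then show "coeff2 (euler wx wy p) i j = coeff2 (of_int w * p) i j"
    unfolding coeff2_euler of_int_poly2 coeff2_const_mult .
qed

subsection \<open>Weighted homogeneous polynomials\<close>

lemma weighted_homogeneous_0 [simp]: "weighted_homogeneous wx wy w 0"
  and weighted_homogeneous_const [simp]: "weighted_homogeneous wx wy 0 (const2 c)"
  and weighted_homogeneous_var_x [simp]: "weighted_homogeneous wx wy (int wx) var_x"
  and weighted_homogeneous_var_y [simp]: "weighted_homogeneous wx wy (int wy) var_y"
  by (auto simp: weighted_homogeneous_def coeff2_var_x coeff2_var_y split: if_splits)

lemma weighted_homogeneous_add:
  "weighted_homogeneous wx wy w p \<Longrightarrow> weighted_homogeneous wx wy w q \<Longrightarrow>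
   weighted_homogeneous wx wy w (p + q)"
  unfolding weighted_homogeneous_def by (metis add.right_neutral add_0 coeff_add)

lemma weighted_homogeneous_sum:
  "(\<And>i. i \<in> I \<Longrightarrow> weighted_homogeneous wx wy w (p i)) \<Longrightarrow> weighted_homogeneous wx wy w (sum p I)"
  by (induction I rule: infinite_finite_induct) (auto intro: weighted_homogeneous_add)

lemma weighted_homogeneous_mult:
  assumes "weighted_homogeneous wx wy v p" "weighted_homogeneous wx wy w q"
  shows "weighted_homogeneous wx wy (v + w) (p * q)"
  unfolding weighted_homogeneous_def
proof (intro allI impI)
  fix i j assume "coeff2 (p * q) i j \<noteq> 0"
  then obtain l where l: "l \<le> j" "(\<Sum>h\<le>i. coeff2 p h l * coeff2 q (i - h) (j - l)) \<noteq> 0"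
    unfolding coeff2_mult using sum.not_neutral_contains_not_neutral by (metis (no_types, lifting) atMost_iff)
  then obtain h where h: "h \<le> i" "coeff2 p h l * coeff2 q (i - h) (j - l) \<noteq> 0"
    using sum.not_neutral_contains_not_neutral by (metis (no_types, lifting) atMost_iff)
  then have "int (wx * h + wy * l) = v" "int (wx * (i - h) + wy * (j - l)) = w"
    using assms unfolding weighted_homogeneous_def by (metis mult_zero_left, metis mult_zero_right)
  moreover have "wx * i + wy * j = (wx * h + wy * l) + (wx * (i - h) + wy * (j - l))"
    using l(1) h(1) by (metis add.assoc add.left_commute distrib_left le_add_diff_inverse)
  ultimately show "int (wx * i + wy * j) = v + w" by linarith
qed

lemma weighted_homogeneous_power:
  "weighted_homogeneous wx wy w p \<Longrightarrow> weighted_homogeneous wx wy (int n * w) (p ^ n)"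
proof (induction n)
  case 0
  then show ?case using weighted_homogeneous_const[of wx wy 1] by (simp add: one_pCons)
next
  case (Suc n)
  then show ?case using weighted_homogeneous_mult[of wx wy w p "int n * w" "p ^ n"]
    by (simp add: algebra_simps)
qed

text \<open>
  Both weights are positive, so \<open>1\<close> is the only monomial of weight 0.
\<close>

lemma weighted_homogeneous_weight_0:
  assumes "weighted_homogeneous wx wy 0 p" "wx > 0" "wy > 0"
  shows "p = const2 (coeff2 p 0 0)"
proof (rule poly2_eqI)
  fix i j
  show "coeff2 p i j = coeff2 (const2 (coeff2 p 0 0)) i j"
  proof (cases "coeff2 p i j = 0")
    case False
    with assms(1) have "int (wx * i + wy * j) = 0" unfolding weighted_homogeneous_def by blast
    then have "wx * i + wy * j = 0" by linarith
    with assms(2,3) show ?thesis by simp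
  qed auto
qed

subsection \<open>Exchanging the two variables\<close>

text \<open>
  The exchange of variables reduces curves with a pure power of \<open>x\<close> in their equation to curves with
  a pure power of \<open>y\<close>.
\<close>

definition swap_vars :: "'k::comm_ring_1 poly poly \<Rightarrow> 'k poly poly"
  where "swap_vars p = (\<Sum>j\<le>degree p. map_poly (\<lambda>c. monom c j) (poly.coeff p j))"

lemma coeff2_swap_vars [simp]: "coeff2 (swap_vars p) i j = coeff2 p j i"
proof -
  have "coeff2 (swap_vars p) i j = (\<Sum>l\<le>degree p. if l = i then coeff2 p j l else 0)"
    by (simp add: swap_vars_def coeff_sum coeff_map_poly)
  also have "\<dots> = coeff2 p j i"
    by (simp add: coeff_eq_0)
  finally show ?thesis .
qed

lemma swap_vars_add: "swap_vars (p + q) = swap_vars p + swap_vars q"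
  and swap_vars_swap_vars [simp]: "swap_vars (swap_vars p) = p"
  and swap_vars_var_x [simp]: "swap_vars var_x = (var_y :: 'k::comm_ring_1 poly poly)"
  and swap_vars_var_y [simp]: "swap_vars var_y = (var_x :: 'k::comm_ring_1 poly poly)"
  and swap_vars_const [simp]: "swap_vars (const2 c) = const2 c"
  by (rule poly2_eqI; simp add: coeff2_var_x coeff2_var_y)+

lemma swap_vars_mult: "swap_vars (p * q) = swap_vars p * swap_vars q"
proof (rule poly2_eqI)
  fix i j
  show "coeff2 (swap_vars (p * q)) i j = coeff2 (swap_vars p * swap_vars q) i j"
    unfolding coeff2_swap_vars coeff2_mult by (rule sum.swap)
qed

lemma swap_vars_dvd: "f dvd p \<Longrightarrow> swap_vars f dvd swap_vars p"
  by (auto simp: dvd_def swap_vars_mult)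

lemma weighted_homogeneous_swap [simp]:
  "weighted_homogeneous wx wy w (swap_vars p) \<longleftrightarrow> weighted_homogeneous wy wx w p"
  unfolding weighted_homogeneous_def coeff2_swap_vars by (subst all_comm) (simp add: add.commute)

lemma euler_swap: "swap_vars (euler wy wx p) = euler wx wy (swap_vars p)"
  by (rule poly2_eqI) (simp only: coeff2_swap_vars coeff2_euler add.commute)

section \<open>Graded modules over \<open>k[x,y]\<close>\<close>

text \<open>
  A graded module over the curve is treated as a graded \<open>k[x,y]\<close>-module; this makes polynomial
  arithmetic available and turns equalities in \<open>A\<close> into congruences modulo \<open>f\<close>.
\<close>

locale graded_poly_module = abelian_group M for M :: "('m, 'b) ring_scheme" (structure) +
  fixes act :: "'k::field_char_0 poly poly \<Rightarrow> 'm \<Rightarrow> 'm" (infixr "\<cdot>" 75)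
    and wx wy :: nat and gM :: "int \<Rightarrow> 'm set"
  assumes act_closed [simp]: "m \<in> carrier M \<Longrightarrow> p \<cdot> m \<in> carrier M"
    and act_distrib: "m \<in> carrier M \<Longrightarrow> n \<in> carrier M \<Longrightarrow> p \<cdot> (m \<oplus> n) = p \<cdot> m \<oplus> p \<cdot> n"
    and act_add: "m \<in> carrier M \<Longrightarrow> (p + q) \<cdot> m = p \<cdot> m \<oplus> q \<cdot> m"
    and act_mult: "m \<in> carrier M \<Longrightarrow> (p * q) \<cdot> m = p \<cdot> q \<cdot> m"
    and act_one [simp]: "m \<in> carrier M \<Longrightarrow> 1 \<cdot> m = m"
    and gM_subgroup: "additive_subgroup (gM w) M"
    and act_homogeneous:
      "weighted_homogeneous wx wy v p \<Longrightarrow> m \<in> gM w \<Longrightarrow> p \<cdot> m \<in> gM (v + w)"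
    and decomposition: "m \<in> carrier M \<Longrightarrow> \<exists>!c. (\<forall>w. c w \<in> gM w) \<and> finite {w. c w \<noteq> \<zero>} \<and>
      m = (\<Oplus>w\<in>{w. c w \<noteq> \<zero>}. c w)"
    and wx_pos: "wx > 0" and wy_pos: "wy > 0"
begin

lemma act_zero [simp]: "p \<cdot> \<zero> = \<zero>"
proof -
  have "p \<cdot> \<zero> \<oplus> p \<cdot> \<zero> = p \<cdot> \<zero> \<oplus> \<zero>" using act_distrib[of \<zero> \<zero> p] by simp
  then show ?thesis by (simp only: add.l_cancel act_closed zero_closed)
qed

lemma zero_act [simp]: "m \<in> carrier M \<Longrightarrow> 0 \<cdot> m = \<zero>"
proof -
  assume m: "m \<in> carrier M"
  have "0 \<cdot> m \<oplus> 0 \<cdot> m = 0 \<cdot> m \<oplus> \<zero>" using act_add[OF m, of 0 0] m by simp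
  then show ?thesis using m by (simp only: add.l_cancel act_closed zero_closed)
qed

lemma act_minus: "m \<in> carrier M \<Longrightarrow> p \<cdot> (\<ominus> m) = \<ominus> (p \<cdot> m)"
  by (rule sym, rule minus_equality) (simp_all add: act_distrib[symmetric] l_neg)

lemma act_diff: "m \<in> carrier M \<Longrightarrow> n \<in> carrier M \<Longrightarrow> p \<cdot> (m \<ominus> n) = p \<cdot> m \<ominus> p \<cdot> n"
  by (simp add: a_minus_def act_distrib act_minus)

lemma act_left_commute: "m \<in> carrier M \<Longrightarrow> p \<cdot> q \<cdot> m = q \<cdot> p \<cdot> m"
  by (metis act_mult mult.commute)

lemma act_finsum:
  "finite I \<Longrightarrow> g \<in> I \<rightarrow> carrier M \<Longrightarrow> p \<cdot> (\<Oplus>i\<in>I. g i) = (\<Oplus>i\<in>I. p \<cdot> g i)"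
proof (induction I rule: finite_induct)
  case (insert i I)
  then have "g i \<in> carrier M" "g \<in> I \<rightarrow> carrier M" by auto
  then show ?case using insert.IH insert.hyps
    by (simp add: act_distrib finsum_closed Pi_iff)
qed simp

lemma sum_act:
  "finite I \<Longrightarrow> m \<in> carrier M \<Longrightarrow> sum p I \<cdot> m = (\<Oplus>i\<in>I. p i \<cdot> m)"
  by (induction I rule: finite_induct) (auto simp: act_add Pi_def)

subsection \<open>Homogeneous components\<close>

lemma gM_closed: "m \<in> gM w \<Longrightarrow> m \<in> carrier M"
  and gM_zero [simp]: "\<zero> \<in> gM w"
  and gM_add: "m \<in> gM w \<Longrightarrow> n \<in> gM w \<Longrightarrow> m \<oplus> n \<in> gM w"
  and gM_minus: "m \<in> gM w \<Longrightarrow> \<ominus> m \<in> gM w"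
proof -
  interpret additive_subgroup "gM w" M by (rule gM_subgroup)
  show "m \<in> gM w \<Longrightarrow> m \<in> carrier M" "\<zero> \<in> gM w"
    "m \<in> gM w \<Longrightarrow> n \<in> gM w \<Longrightarrow> m \<oplus> n \<in> gM w" "m \<in> gM w \<Longrightarrow> \<ominus> m \<in> gM w"
    using a_subset by auto
qed

lemma gM_diff: "m \<in> gM w \<Longrightarrow> n \<in> gM w \<Longrightarrow> m \<ominus> n \<in> gM w"
  by (simp add: a_minus_def gM_add gM_minus)

lemma gM_finsum: "finite I \<Longrightarrow> (\<And>i. i \<in> I \<Longrightarrow> g i \<in> gM w) \<Longrightarrow> (\<Oplus>i\<in>I. g i) \<in> gM w"
proof (induction I rule: finite_induct)
  case (insert i I)
  then have "g \<in> I \<rightarrow> carrier M" "g i \<in> carrier M" by (auto intro: gM_closed)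
  with insert show ?case by (simp add: gM_add)
qed simp

definition comp :: "int \<Rightarrow> 'm \<Rightarrow> 'm"
  where "comp w m = (THE c. (\<forall>w. c w \<in> gM w) \<and> finite {w. c w \<noteq> \<zero>} \<and>
      m = (\<Oplus>w\<in>{w. c w \<noteq> \<zero>}. c w)) w"

lemma comp_properties:
  assumes "m \<in> carrier M"
  shows comp_in_gM: "comp w m \<in> gM w" and finite_comp: "finite {w. comp w m \<noteq> \<zero>}"
    and finsum_comp: "m = (\<Oplus>w\<in>{w. comp w m \<noteq> \<zero>}. comp w m)"
  using theI'[OF decomposition[OF assms]] by (simp_all add: comp_def)

lemma comp_closed [simp]: "m \<in> carrier M \<Longrightarrow> comp w m \<in> carrier M"
  using comp_in_gM gM_closed by blast

lemma comp_unique: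
  assumes "\<And>w. c w \<in> gM w" "finite F" "\<And>w. w \<notin> F \<Longrightarrow> c w = \<zero>" "m = (\<Oplus>w\<in>F. c w)"
  shows "comp w m = c w"
proof -
  have F: "{w. c w \<noteq> \<zero>} \<subseteq> F" using assms(3) by blast
  have cc: "c \<in> A \<rightarrow> carrier M" for A using assms(1) gM_closed by auto
  have m: "m \<in> carrier M" using assms(4) cc by (simp add: finsum_closed)
  have "m = (\<Oplus>w\<in>{w. c w \<noteq> \<zero>}. c w)"
    unfolding assms(4) by (rule add.finprod_mono_neutral_cong_right) (use F assms(2) cc in auto)
  with assms(1) finite_subset[OF F assms(2)]
  have "(\<forall>w. c w \<in> gM w) \<and> finite {w. c w \<noteq> \<zero>} \<and> m = (\<Oplus>w\<in>{w. c w \<noteq> \<zero>}. c w)" by simp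
  from the1_equality[OF decomposition[OF m]] this show ?thesis by (simp add: comp_def)
qed

lemma homogeneous_induct [consumes 1, case_names zero homogeneous add]:
  assumes m: "m \<in> carrier M" and zero: "P \<zero>" and hom: "\<And>w m. m \<in> gM w \<Longrightarrow> P m"
    and add: "\<And>m n. m \<in> carrier M \<Longrightarrow> n \<in> carrier M \<Longrightarrow> P m \<Longrightarrow> P n \<Longrightarrow> P (m \<oplus> n)"
  shows "P m"
proof -
  have "P (\<Oplus>w\<in>F. comp w m)" if "finite F" for F
    using that
  proof (induction F rule: finite_induct)
    case (insert w F)
    have "(\<lambda>w. comp w m) \<in> F \<rightarrow> carrier M" using m by simp
    with insert m show ?case
      by (simp add: add[OF _ _ hom[OF comp_in_gM]] finsum_closed)
  qed (simp add: zero)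
  from this[OF finite_comp[OF m]] show ?thesis using finsum_comp[OF m] by simp
qed

lemma comp_homogeneous: "m \<in> gM w \<Longrightarrow> comp v m = (if v = w then m else \<zero>)"
  by (rule comp_unique[of "\<lambda>v. if v = w then m else \<zero>" "{w}"]) (auto simp: gM_closed)

lemma comp_zero [simp]: "comp w \<zero> = \<zero>"
  using comp_homogeneous[OF gM_zero] by simp

lemma comp_add:
  assumes "m \<in> carrier M" "n \<in> carrier M"
  shows "comp w (m \<oplus> n) = comp w m \<oplus> comp w n"
proof (rule comp_unique)
  let ?F = "{w. comp w m \<noteq> \<zero>} \<union> {w. comp w n \<noteq> \<zero>}"
  show "finite ?F" using finite_comp assms by simp
  have "m = (\<Oplus>w\<in>?F. comp w m)" "n = (\<Oplus>w\<in>?F. comp w n)"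
    by (subst finsum_comp, fact, rule add.finprod_mono_neutral_cong_left;
        use finite_comp assms in auto)+
  then show "m \<oplus> n = (\<Oplus>w\<in>?F. comp w m \<oplus> comp w n)"
    using finsum_addf[of "\<lambda>w. comp w m" ?F "\<lambda>w. comp w n"] assms by simp
qed (use assms in \<open>auto simp: gM_add comp_in_gM\<close>)

lemma comp_minus: "m \<in> carrier M \<Longrightarrow> comp w (\<ominus> m) = \<ominus> comp w m"
  by (rule sym, rule minus_equality) (simp_all add: comp_add[symmetric] l_neg)

lemma comp_diff:
  "m \<in> carrier M \<Longrightarrow> n \<in> carrier M \<Longrightarrow> comp w (m \<ominus> n) = comp w m \<ominus> comp w n"
  by (simp add: a_minus_def comp_add comp_minus)

lemma comp_eqI:
  assumes "m \<in> carrier M" "n \<in> carrier M" "\<And>w. comp w m = comp w n"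
  shows "m = n"
  using finsum_comp[OF assms(1)] finsum_comp[OF assms(2)] assms(3) by simp

lemma comp_assemble:
  assumes "\<And>w. c w \<in> gM w" "finite {w. c w \<noteq> \<zero>}"
  shows "\<exists>m\<in>carrier M. \<forall>w. comp w m = c w"
proof (intro bexI allI)
  show "comp w (\<Oplus>w\<in>{w. c w \<noteq> \<zero>}. c w) = c w" for w
    by (rule comp_unique[OF _ assms(2)]) (use assms in auto)
  show "(\<Oplus>w\<in>{w. c w \<noteq> \<zero>}. c w) \<in> carrier M"
    using assms(1) gM_closed by (intro finsum_closed) auto
qed

lemma comp_act:
  assumes "m \<in> carrier M" "weighted_homogeneous wx wy v p"
  shows "comp (v + w) (p \<cdot> m) = p \<cdot> comp w m"
  using assms(1)
proof (induction m rule: homogeneous_induct)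
  case (homogeneous u m)
  have "p \<cdot> m \<in> gM (v + u)" by (rule act_homogeneous[OF assms(2) homogeneous])
  then show ?case by (simp add: comp_homogeneous[OF homogeneous] comp_homogeneous)
next
  case (add m n)
  then show ?case by (simp add: act_distrib comp_add)
qed simp

text \<open>
  Only the action is twisted: the components keep their weights when \<open>x\<close> and \<open>y\<close> trade both their
  roles and their weights.
\<close>

lemma swapped: "graded_poly_module M (\<lambda>p. act (swap_vars p)) wy wx gM"
proof (rule graded_poly_module.intro[OF abelian_group_axioms graded_poly_module_axioms.intro])
  have "swap_vars 1 = (1 :: 'k poly poly)" using swap_vars_const[of 1] by (simp add: one_pCons)
  then show "swap_vars 1 \<cdot> m = m" if "m \<in> carrier M" for m using that by simp
  show "swap_vars p \<cdot> m \<in> gM (v + w)" if "weighted_homogeneous wy wx v p" "m \<in> gM w" for v w p m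
    using that by (intro act_homogeneous) simp_all
  show "\<exists>!c. (\<forall>w. c w \<in> gM w) \<and> finite {w. c w \<noteq> \<zero>} \<and> m = (\<Oplus>w\<in>{w. c w \<noteq> \<zero>}. c w)"
    if "m \<in> carrier M" for m
    using that by (rule decomposition)
qed (simp_all add: act_distrib act_add act_mult swap_vars_add swap_vars_mult gM_subgroup wx_pos wy_pos)

lemma gM_iff: "m \<in> carrier M \<Longrightarrow> m \<in> gM w \<longleftrightarrow> (\<forall>v. v \<noteq> w \<longrightarrow> comp v m = \<zero>)"
proof (intro iffI allI impI)
  assume m: "m \<in> carrier M" and "\<forall>v. v \<noteq> w \<longrightarrow> comp v m = \<zero>"
  then have "m = comp w m"
    by - (rule comp_eqI, use m in \<open>auto simp: comp_homogeneous[OF comp_in_gM[OF m]]\<close>)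
  then show "m \<in> gM w" using comp_in_gM[OF m] by metis
qed (simp add: comp_homogeneous)

subsection \<open>The weight operator\<close>

text \<open>
  The Euler derivation of \<open>k[x,y]\<close> carried over to \<open>M\<close>. The choice is unambiguous, since an element is
  determined by its components.
\<close>

definition weight_op :: "'m \<Rightarrow> 'm"
  where "weight_op m = (SOME n. n \<in> carrier M \<and> (\<forall>w. comp w n = of_int w \<cdot> comp w m))"

lemma weighted_homogeneous_of_int [simp]: "weighted_homogeneous wx wy 0 (of_int n)"
  by (simp add: of_int_poly2 del: of_int_poly)

lemma of_int_act_in_gM: "m \<in> gM w \<Longrightarrow> of_int n \<cdot> m \<in> gM w"
  using act_homogeneous[OF weighted_homogeneous_of_int, of m w n] by simp

lemma weight_op:
  assumes "m \<in> carrier M"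
  shows weight_op_closed: "weight_op m \<in> carrier M"
    and comp_weight_op: "comp w (weight_op m) = of_int w \<cdot> comp w m"
proof -
  have "\<exists>n\<in>carrier M. \<forall>w. comp w n = of_int w \<cdot> comp w m"
  proof (rule comp_assemble)
    show "of_int w \<cdot> comp w m \<in> gM w" for w
      by (rule of_int_act_in_gM[OF comp_in_gM[OF assms]])
    show "finite {w. of_int w \<cdot> comp w m \<noteq> \<zero>}"
      by (rule finite_subset[OF _ finite_comp[OF assms]]) auto
  qed
  then have "\<exists>n. n \<in> carrier M \<and> (\<forall>w. comp w n = of_int w \<cdot> comp w m)" by blast
  from someI_ex[OF this] show "weight_op m \<in> carrier M"
    "comp w (weight_op m) = of_int w \<cdot> comp w m" by (simp_all add: weight_op_def)
qed

lemma weight_op_add: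
  "m \<in> carrier M \<Longrightarrow> n \<in> carrier M \<Longrightarrow> weight_op (m \<oplus> n) = weight_op m \<oplus> weight_op n"
  by (rule comp_eqI) (simp_all add: weight_op comp_add act_distrib)

lemma weight_op_homogeneous: "m \<in> gM w \<Longrightarrow> weight_op m = of_int w \<cdot> m"
  by (rule comp_eqI)
    (simp_all add: weight_op gM_closed comp_homogeneous comp_homogeneous[OF of_int_act_in_gM])

text \<open>
  For homogeneous \<open>p\<close> of weight \<open>v\<close> this is \<open>(v + u) p m = p (u m) + (v p) m\<close> on the component of
  weight \<open>u\<close>; every polynomial is built from homogeneous ones by sums and products.
\<close>

lemma weight_op_act:
  assumes "m \<in> carrier M"
  shows "weight_op (p \<cdot> m) = p \<cdot> weight_op m \<oplus> euler wx wy p \<cdot> m"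
proof -
  have hom: "weight_op (p \<cdot> m) = p \<cdot> weight_op m \<oplus> euler wx wy p \<cdot> m"
    if p: "weighted_homogeneous wx wy v p" and m: "m \<in> carrier M" for v p m
  proof (rule comp_eqI)
    fix w
    define u where "u = w - v"
    have w: "w = v + u" by (simp add: u_def)
    have e: "weighted_homogeneous wx wy v (euler wx wy p)"
      using weighted_homogeneous_mult[OF weighted_homogeneous_of_int p, of v]
      by (simp add: euler_homogeneous[OF p])
    have c: "comp w (p \<cdot> n) = p \<cdot> comp u n" if "n \<in> carrier M" for n
      unfolding w by (rule comp_act[OF that p])
    have "comp w (weight_op (p \<cdot> m)) = (of_int v * p + of_int u * p) \<cdot> comp u m"
      using m by (simp add: weight_op c[OF m] act_mult[symmetric] algebra_simps) (simp add: w algebra_simps)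
    also have "\<dots> = p \<cdot> of_int u \<cdot> comp u m \<oplus> (of_int v * p) \<cdot> comp u m"
      using m by (simp add: act_add a_comm act_mult act_left_commute[of _ p])
    also have "\<dots> = comp w (p \<cdot> weight_op m \<oplus> euler wx wy p \<cdot> m)"
      using m comp_act[OF m e, of u]
      by (simp add: comp_add weight_op c euler_homogeneous[OF p] w[symmetric])
    finally show "comp w (weight_op (p \<cdot> m)) = comp w (p \<cdot> weight_op m \<oplus> euler wx wy p \<cdot> m)" .
  qed (use m in \<open>simp_all add: weight_op\<close>)
  show ?thesis using assms
  proof (induction p arbitrary: m rule: bivariate_induct)
    case (add p q)
    then show ?case
      by (simp add: act_add weight_op weight_op_add euler_add add.m_ac)
  next
    case (mult p q)
    then show ?case
      by (simp add: act_add act_mult act_distrib weight_op weight_op_add euler_mult add.m_ac)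
  qed (rule hom[of 0], simp, assumption, rule hom, rule weighted_homogeneous_var_x, assumption,
      rule hom, rule weighted_homogeneous_var_y, assumption)
qed

text \<open>
  The operators that can serve as the covariant derivative along the Euler derivation.
\<close>

definition euler_operator :: "('m \<Rightarrow> 'm) \<Rightarrow> bool"
  where "euler_operator T \<longleftrightarrow>
    (\<forall>m\<in>carrier M. T m \<in> carrier M) \<and>
    (\<forall>m\<in>carrier M. \<forall>n\<in>carrier M. T (m \<oplus> n) = T m \<oplus> T n) \<and>
    (\<forall>p. \<forall>m\<in>carrier M. T (p \<cdot> m) = p \<cdot> T m \<oplus> euler wx wy p \<cdot> m) \<and>
    (\<forall>u. \<forall>m\<in>gM u. T m \<in> gM u)"

lemma euler_operatorD:
  assumes "euler_operator T"
  shows "m \<in> carrier M \<Longrightarrow> T m \<in> carrier M"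
    and "m \<in> carrier M \<Longrightarrow> n \<in> carrier M \<Longrightarrow> T (m \<oplus> n) = T m \<oplus> T n"
    and "m \<in> carrier M \<Longrightarrow> T (p \<cdot> m) = p \<cdot> T m \<oplus> euler wx wy p \<cdot> m"
    and "m \<in> gM u \<Longrightarrow> T m \<in> gM u"
  using assms by (simp_all add: euler_operator_def)

subsection \<open>Linear functionals\<close>

text \<open>
  A subspace that is maximal among those avoiding \<open>z\<close> is a hyperplane complementary to \<open>z\<close>.
\<close>

lemma separating_functional:
  assumes U: "U \<subseteq> carrier M" "\<zero> \<in> U" "\<And>m n. m \<in> U \<Longrightarrow> n \<in> U \<Longrightarrow> m \<oplus> n \<in> U"
      "\<And>c m. m \<in> U \<Longrightarrow> const2 c \<cdot> m \<in> U"
    and z: "z \<in> carrier M" "z \<notin> U"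
  shows "\<exists>g :: 'm \<Rightarrow> 'k. g z = 1 \<and> (\<forall>u\<in>U. g u = 0) \<and>
    (\<forall>m\<in>carrier M. \<forall>n\<in>carrier M. g (m \<oplus> n) = g m + g n) \<and>
    (\<forall>c. \<forall>m\<in>carrier M. g (const2 c \<cdot> m) = c * g m)"
proof -
  define subsp where "subsp V \<longleftrightarrow> V \<subseteq> carrier M \<and> \<zero> \<in> V \<and> (\<forall>m\<in>V. \<forall>n\<in>V. m \<oplus> n \<in> V) \<and>
    (\<forall>c. \<forall>m\<in>V. const2 c \<cdot> m \<in> V)" for V
  let ?A = "{V. subsp V \<and> U \<subseteq> V \<and> z \<notin> V}"
  have "\<exists>W\<in>?A. \<forall>V\<in>?A. W \<subseteq> V \<longrightarrow> V = W"
  proof (rule subset_Zorn_nonempty)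
    have "subsp U" using U by (auto simp: subsp_def)
    then show "?A \<noteq> {}" using z by blast
  next
    fix \<C> assume ne: "\<C> \<noteq> {}" and ch: "subset.chain ?A \<C>"
    then have mem: "subsp V \<and> U \<subseteq> V \<and> z \<notin> V" if "V \<in> \<C>" for V
      using that by (auto simp: subset.chain_def)
    have "m \<oplus> n \<in> \<Union>\<C>" if "m \<in> V" "V \<in> \<C>" "n \<in> W" "W \<in> \<C>" for m n V W
    proof -
      have "V \<subseteq> W \<or> W \<subseteq> V" using ch that(2,4) by (auto simp: subset.chain_def)
      then show ?thesis using that mem[of V] mem[of W] unfolding subsp_def by blast
    qed
    then have "\<forall>m\<in>\<Union>\<C>. \<forall>n\<in>\<Union>\<C>. m \<oplus> n \<in> \<Union>\<C>" by blast
    moreover have "\<Union>\<C> \<subseteq> carrier M" "\<zero> \<in> \<Union>\<C>" "\<forall>c. \<forall>m\<in>\<Union>\<C>. const2 c \<cdot> m \<in> \<Union>\<C>"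
      using ne mem unfolding subsp_def by blast+
    ultimately have "subsp (\<Union>\<C>)" by (simp add: subsp_def)
    then show "\<Union>\<C> \<in> ?A" using ne mem by blast
  qed
  then obtain H where HA: "H \<in> ?A" and H_max: "\<forall>V\<in>?A. H \<subseteq> V \<longrightarrow> V = H" ..
  have H: "subsp H" "U \<subseteq> H" "z \<notin> H" using HA by simp_all
  have max: "V = H" if "subsp V" "U \<subseteq> V" "z \<notin> V" "H \<subseteq> V" for V
    using H_max that by simp
  have Hc: "H \<subseteq> carrier M" "\<zero> \<in> H" "\<And>m n. m \<in> H \<Longrightarrow> n \<in> H \<Longrightarrow> m \<oplus> n \<in> H"
    "\<And>c m. m \<in> H \<Longrightarrow> const2 c \<cdot> m \<in> H" using H(1) by (auto simp: subsp_def)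
  have cc_act: "const2 a \<cdot> const2 b \<cdot> m = const2 (a * b) \<cdot> m" if "m \<in> carrier M" for a b m
    using that by (simp add: act_mult[symmetric])
  have c_add: "const2 (a + b) \<cdot> m = const2 a \<cdot> m \<oplus> const2 b \<cdot> m" if "m \<in> carrier M" for a b m
    using act_add[OF that, of "const2 a" "const2 b"] by simp
  have c_one: "const2 1 \<cdot> m = m" if "m \<in> carrier M" for m
    using that by (simp flip: one_pCons)
  have zero_mem: "c = 0" if "const2 c \<cdot> z \<in> H" for c
  proof (rule ccontr)
    assume "c \<noteq> 0"
    with Hc(4)[OF that, of "inverse c"] z have "z \<in> H" by (simp add: cc_act c_one)
    with H(3) show False by blast
  qed
  have ex: "\<exists>a h. h \<in> H \<and> m = h \<oplus> const2 a \<cdot> z" if m: "m \<in> carrier M" for m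
  proof -
    define Y where "Y = {h \<oplus> const2 a \<cdot> m | h a. h \<in> H}"
    show ?thesis
    proof (cases "z \<in> Y")
      case True
      then obtain h a where z_eq: "h \<in> H" "z = h \<oplus> const2 a \<cdot> m" by (auto simp: Y_def)
      have a: "a \<noteq> 0"
      proof
        assume "a = 0" with z_eq m Hc(1) have "z = h" by auto
        with z_eq H(3) show False by simp
      qed
      have "const2 (inverse a) \<cdot> z = const2 (inverse a) \<cdot> h \<oplus> m"
        using a m z_eq(1) Hc(1) unfolding z_eq(2) by (auto simp: act_distrib cc_act c_one subsetD)
      then have "const2 (- inverse a) \<cdot> h \<oplus> const2 (inverse a) \<cdot> z
          = const2 (- inverse a) \<cdot> h \<oplus> (const2 (inverse a) \<cdot> h \<oplus> m)" by simp
      also have "\<dots> = const2 (- inverse a + inverse a) \<cdot> h \<oplus> m"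
        using m z_eq(1) Hc(1) by (subst c_add) (auto simp: a_assoc subsetD)
      also have "\<dots> = m" using m z_eq(1) Hc(1) by (auto simp: subsetD)
      finally show ?thesis using Hc(4)[OF z_eq(1)] by metis
    next
      case False
      have "subsp Y"
        unfolding subsp_def
      proof (intro conjI ballI allI)
        show "Y \<subseteq> carrier M" using Hc(1) m by (auto simp: Y_def)
        show "\<zero> \<in> Y" unfolding Y_def using Hc(2) m by (auto intro!: exI[of _ \<zero>] exI[of _ 0])
      next
        fix p q assume "p \<in> Y" "q \<in> Y"
        then obtain h a h' a' where e: "p = h \<oplus> const2 a \<cdot> m" "q = h' \<oplus> const2 a' \<cdot> m" "h \<in> H" "h' \<in> H"
          by (auto simp: Y_def)
        then have "h \<in> carrier M" "h' \<in> carrier M" using Hc(1) by auto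
        then have "p \<oplus> q = (h \<oplus> h') \<oplus> const2 (a + a') \<cdot> m"
          using m unfolding e c_add[OF m] by (simp add: add.m_ac)
        then show "p \<oplus> q \<in> Y" using Hc(3)[OF e(3,4)] unfolding Y_def by blast
      next
        fix c p assume "p \<in> Y"
        then obtain h a where e: "p = h \<oplus> const2 a \<cdot> m" "h \<in> H" by (auto simp: Y_def)
        then have "const2 c \<cdot> p = const2 c \<cdot> h \<oplus> const2 (c * a) \<cdot> m"
          using m Hc(1) by (auto simp: act_distrib cc_act subsetD)
        then show "const2 c \<cdot> p \<in> Y" using Hc(4)[OF e(2)] unfolding Y_def by blast
      qed
      moreover have "H \<subseteq> Y"
      proof
        fix h assume "h \<in> H"
        then have "h = h \<oplus> const2 0 \<cdot> m" using m Hc(1) by auto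
        then show "h \<in> Y" using \<open>h \<in> H\<close> unfolding Y_def by blast
      qed
      ultimately have "Y = H" using max H(2) False by blast
      moreover have "m \<in> Y"
      proof -
        have "m = \<zero> \<oplus> const2 1 \<cdot> m" using m by (simp add: c_one)
        then show ?thesis using Hc(2) unfolding Y_def by blast
      qed
      ultimately have "m \<in> H" by simp
      moreover have "m = m \<oplus> const2 0 \<cdot> z" using m z by simp
      ultimately show ?thesis by blast
    qed
  qed
  have uniq: "a = b" if "h \<in> H" "h' \<in> H" "h \<oplus> const2 a \<cdot> z = h' \<oplus> const2 b \<cdot> z" for a b h h'
  proof -
    have c: "h \<in> carrier M" "h' \<in> carrier M" using that Hc(1) by auto
    have m1: "const2 (-1) \<cdot> h' \<oplus> h' = \<zero>"
      using c c_add[of h' "-1" 1] by (simp add: c_one)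
    have "const2 (a - b) \<cdot> z \<oplus> (h \<oplus> const2 (-1) \<cdot> h')
        = (h \<oplus> const2 a \<cdot> z) \<oplus> const2 (-b) \<cdot> z \<oplus> const2 (-1) \<cdot> h'"
      using c z c_add[of z a "-b"] by (simp add: add.m_ac)
    also have "\<dots> = (const2 (-1) \<cdot> h' \<oplus> h') \<oplus> (const2 b \<cdot> z \<oplus> const2 (-b) \<cdot> z)"
      unfolding that(3) using c z by (simp add: add.m_ac)
    also have "\<dots> = \<zero>" using z c_add[of z b "-b"] by (simp add: m1)
    finally have s: "const2 (a - b) \<cdot> z \<oplus> (h \<oplus> const2 (-1) \<cdot> h') = \<zero>" .
    have "h \<oplus> const2 (-1) \<cdot> h' \<in> H" using that Hc by simp
    then have "const2 (-1) \<cdot> (h \<oplus> const2 (-1) \<cdot> h') \<in> H" by (rule Hc(4))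
    moreover have "const2 (-1) \<cdot> (h \<oplus> const2 (-1) \<cdot> h') = \<ominus> (h \<oplus> const2 (-1) \<cdot> h')"
      using c c_add[of "h \<oplus> const2 (-1) \<cdot> h'" "-1" 1]
      by (intro minus_equality[symmetric]) (simp_all add: c_one)
    moreover have "\<dots> = const2 (a - b) \<cdot> z"
      using s c z by (intro minus_equality) simp_all
    ultimately show ?thesis using zero_mem[of "a - b"] by simp
  qed
  define g where "g m = (THE a. \<exists>h\<in>H. m = h \<oplus> const2 a \<cdot> z)" for m
  have g: "g m = a" if "h \<in> H" "m = h \<oplus> const2 a \<cdot> z" for m a h
    unfolding g_def using that uniq by (intro the_equality) blast+
  show ?thesis
  proof (intro exI[of _ g] conjI ballI allI)
    show "g z = 1" using z c_one[of z] Hc(2) by (intro g[of \<zero>]) auto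
    show "g u = 0" if "u \<in> U" for u
      using that H(2) U(1) z by (intro g[of u]) auto
  next
    fix m n assume mn: "m \<in> carrier M" "n \<in> carrier M"
    then obtain a h a' h' where e: "h \<in> H" "m = h \<oplus> const2 a \<cdot> z" "h' \<in> H" "n = h' \<oplus> const2 a' \<cdot> z"
      using ex by metis
    have "h \<in> carrier M" "h' \<in> carrier M" using e Hc(1) by auto
    then have "m \<oplus> n = (h \<oplus> h') \<oplus> const2 (a + a') \<cdot> z"
      using z unfolding e c_add[OF z(1)] by (simp add: add.m_ac)
    then show "g (m \<oplus> n) = g m + g n"
      using g[OF e(1,2)] g[OF e(3,4)] g[OF Hc(3)[OF e(1,3)]] by simp
  next
    fix c m assume m: "m \<in> carrier M"
    then obtain a h where e: "h \<in> H" "m = h \<oplus> const2 a \<cdot> z" using ex by metis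
    have "h \<in> carrier M" using e Hc(1) by auto
    then have "const2 c \<cdot> m = const2 c \<cdot> h \<oplus> const2 (c * a) \<cdot> z"
      using z unfolding e by (simp add: act_distrib cc_act)
    then show "g (const2 c \<cdot> m) = c * g m"
      using g[OF e] g[OF Hc(4)[OF e(1)]] by simp
  qed
qed

end

section \<open>Splitting off free summands\<close>

text \<open>
  The vectors \<open>b j\<close> of \<open>k^S\<close> are linearly independent, because the functionals given by the \<open>a i\<close>
  separate them.
\<close>

lemma dual_families_bound:
  fixes a b :: "nat \<Rightarrow> 's \<Rightarrow> 'k::field"
  assumes S: "finite S"
    and dual: "\<And>i j. i < r \<Longrightarrow> j < r \<Longrightarrow> (\<Sum>s\<in>S. b j s * a i s) = (if i = j then 1 else 0)"
  shows "r \<le> card S"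
proof -
  interpret V: vector_space "\<lambda>(c::'k) (v::'s \<Rightarrow> 'k) s. c * v s"
    by unfold_locales (auto simp: fun_eq_iff algebra_simps)
  define v where "v j = (\<lambda>s. if s \<in> S then b j s else 0)" for j
  define \<phi> where "\<phi> i u = (\<Sum>s\<in>S. u s * a i s)" for i u
  define B where "B = (\<lambda>s t. if t = s then 1 else 0 :: 'k) ` S"
  have \<phi>_v: "\<phi> i (v j) = (if i = j then 1 else 0)" if "i < r" "j < r" for i j
    using dual[OF that] by (simp add: \<phi>_def v_def)
  have inj: "inj_on v {..<r}"
    by (rule inj_onI) (metis \<phi>_v lessThan_iff zero_neq_one)
  have sum_app: "sum g I s = (\<Sum>i\<in>I. g i s)" for g :: "('s \<Rightarrow> 'k) \<Rightarrow> 's \<Rightarrow> 'k" and I s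
    by (induction I rule: infinite_finite_induct) auto
  have sum_app': "sum g I s = (\<Sum>i\<in>I. g i s)" for g :: "'s \<Rightarrow> 's \<Rightarrow> 'k" and I s
    by (induction I rule: infinite_finite_induct) auto
  have "V.independent (v ` {..<r})"
  proof
    assume "V.dependent (v ` {..<r})"
    then obtain u where u: "\<exists>w\<in>v ` {..<r}. u w \<noteq> 0"
      "(\<Sum>w\<in>v ` {..<r}. (\<lambda>s. u w * w s)) = 0"
      unfolding V.dependent_finite[OF finite_imageI[OF finite_lessThan]] by blast
    then obtain i where i: "i < r" "u (v i) \<noteq> 0" by auto
    have "0 = \<phi> i (\<Sum>w\<in>v ` {..<r}. (\<lambda>s. u w * w s))"
      unfolding u(2) by (simp add: \<phi>_def)
    also have "\<dots> = (\<Sum>w\<in>v ` {..<r}. u w * \<phi> i w)"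
      by (simp add: \<phi>_def sum_app sum_distrib_left sum_distrib_right mult.assoc)
        (rule sum.swap)
    also have "\<dots> = (\<Sum>j<r. u (v j) * \<phi> i (v j))"
      by (simp add: sum.reindex[OF inj])
    also have "\<dots> = (\<Sum>j<r. if j = i then u (v j) else 0)"
      by (rule sum.cong) (auto simp: \<phi>_v i(1))
    also have "\<dots> = u (v i)" using i(1) by simp
    finally show False using i(2) by simp
  qed
  moreover have "v ` {..<r} \<subseteq> V.span B"
  proof (rule image_subsetI)
    fix j assume "j \<in> {..<r}"
    have "v j = (\<Sum>s\<in>S. (\<lambda>t. b j s * (if t = s then 1 else 0)))"
      by (rule ext) (simp add: sum_app' v_def S if_distrib[of "\<lambda>x. _ * x"] cong: if_cong)
    also have "\<dots> \<in> V.span B"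
      by (intro V.span_sum V.span_scale V.span_base) (auto simp: B_def)
    finally show "v j \<in> V.span B" .
  qed
  moreover have "finite B" using S by (simp add: B_def)
  ultimately have "card (v ` {..<r}) \<le> card B" using V.independent_span_bound by blast
  also have "card B \<le> card S" unfolding B_def by (rule card_image_le[OF S])
  finally show ?thesis by (simp add: card_image[OF inj])
qed

text \<open>
  The polynomials in \<open>y\<close> alone, as a section of the restriction to \<open>x = 0\<close>.
\<close>

definition lift_y :: "'k::comm_ring_1 poly \<Rightarrow> 'k poly poly"
  where "lift_y = map_poly (\<lambda>a. [:a:])"

lemma at_x0_lift_y [simp]: "at_x0 (lift_y r) = r"
  by (rule poly_eqI) (simp add: lift_y_def coeff_map_poly)

lemma at_x0_power [simp]: "at_x0 (p ^ n) = at_x0 p ^ n"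
proof (induction n)
  case 0
  show ?case by (rule poly_eqI) (simp add: one_pCons coeff_pCons split: nat.split)
qed simp

text \<open>
  The modules over a curve whose equation contains the pure power \<open>y^(N+1)\<close>. Homogeneity makes all
  other terms divisible by \<open>x\<close> and of lower degree in \<open>y\<close>. So \<open>A\<close> is free over \<open>k[x]\<close> on
  \<open>1, y, \<dots>, y^N\<close>, and \<open>A/(x)\<close> is \<open>k[y]/(y^(N+1))\<close>, with socle spanned by \<open>y^N\<close>.
\<close>

locale graded_curve_module = graded_poly_module M act wx wy gM
  for M :: "('m, 'b) ring_scheme" (structure)
    and act :: "'k::field_char_0 poly poly \<Rightarrow> 'm \<Rightarrow> 'm" (infixr "\<cdot>" 75)
    and wx wy :: nat and gM :: "int \<Rightarrow> 'm set" +
  fixes f :: "'k poly poly" and d :: int and N :: nat and S :: "'m set"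
  assumes f_homogeneous: "weighted_homogeneous wx wy d f"
    and f_lead: "coeff2 f 0 (Suc N) \<noteq> 0"
    and f_act: "m \<in> carrier M \<Longrightarrow> f \<cdot> m = \<zero>"
    and x_injective: "m \<in> carrier M \<Longrightarrow> var_x \<cdot> m = \<zero> \<Longrightarrow> m = \<zero>"
    and S: "finite S" "S \<subseteq> carrier M"
    and S_generates: "m \<in> carrier M \<Longrightarrow> \<exists>c. m = (\<Oplus>s\<in>S. c s \<cdot> s)"
begin

abbreviation "lc \<equiv> coeff2 f 0 (Suc N)"

lemma d_eq: "d = int wy * (1 + int N)"
  using f_homogeneous f_lead unfolding weighted_homogeneous_def by fastforce

lemma coeff2_f_weight:
  fixes i j :: nat
  assumes "coeff2 f i j \<noteq> 0"
  shows "wx * i + wy * j = wy * Suc N"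
proof -
  have "int (wx * i + wy * j) = d"
    using f_homogeneous assms unfolding weighted_homogeneous_def by blast
  also have "d = int (wy * Suc N)" by (simp add: d_eq algebra_simps)
  finally show ?thesis by linarith
qed

lemma coeff2_f_0: "j \<noteq> Suc N \<Longrightarrow> coeff2 f 0 j = 0"
proof (rule ccontr)
  assume "j \<noteq> Suc N" "coeff2 f 0 j \<noteq> 0"
  then have "wy * j = wy * Suc N" using coeff2_f_weight[of j 0] by simp
  with \<open>j \<noteq> Suc N\<close> wy_pos show False by (simp only: mult_cancel1) simp
qed

lemma coeff_f_above: "j > Suc N \<Longrightarrow> poly.coeff f j = 0"
proof (rule poly_eqI)
  fix i assume "j > Suc N"
  then have "wy * Suc N < wy * j" using wy_pos by (simp only: mult_less_mono2)
  then have "wy * Suc N < wx * i + wy * j" by linarith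
  then show "coeff2 f i j = poly.coeff 0 i" using coeff2_f_weight[of j i] by force
qed

lemma f_expand: "f = (\<Sum>i\<le>Suc N. [:poly.coeff f i:] * var_y ^ i)"
proof (rule poly_eqI)
  fix n
  have "poly.coeff (\<Sum>i\<le>Suc N. [:poly.coeff f i:] * var_y ^ i) n
      = (\<Sum>i\<le>Suc N. if i = n then poly.coeff f i else 0)"
    unfolding coeff_sum var_y_def
    by (rule sum.cong) (simp_all add: monom_altdef[of 1, simplified, symmetric])
  also have "\<dots> = poly.coeff f n"
    by (cases "n \<le> Suc N") (auto simp: coeff_f_above simp del: sum.atMost_Suc)
  finally show "poly.coeff f n = poly.coeff (\<Sum>i\<le>Suc N. [:poly.coeff f i:] * var_y ^ i) n" ..
qed

lemma act_cong: "f dvd p - q \<Longrightarrow> m \<in> carrier M \<Longrightarrow> p \<cdot> m = q \<cdot> m"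
proof -
  assume "f dvd p - q" and m: "m \<in> carrier M"
  then obtain e where "p = q + e * f" by (metis diff_add_cancel add.commute dvdE mult.commute)
  then show ?thesis using m by (simp add: act_add act_mult f_act)
qed

lemma neg_zero [simp]: "\<ominus> \<zero> = \<zero>"
  by (rule minus_equality) simp_all

lemma diff_eq_zero_iff:
  assumes "m \<in> carrier M" "n \<in> carrier M"
  shows "m \<ominus> n = \<zero> \<longleftrightarrow> m = n"
proof
  assume "m \<ominus> n = \<zero>"
  moreover have "m = (m \<ominus> n) \<oplus> n" using assms by (simp add: minus_eq a_assoc l_neg)
  ultimately show "m = n" using assms by simp
qed (use assms in \<open>simp add: minus_eq r_neg\<close>)

subsection \<open>The submodule \<open>x M\<close>\<close>

definition xM :: "'m set" where "xM = (\<lambda>m. var_x \<cdot> m) ` carrier M"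

lemma xM_I: "m \<in> carrier M \<Longrightarrow> var_x \<cdot> m \<in> xM"
  by (auto simp: xM_def)

lemma xM_closed: "m \<in> xM \<Longrightarrow> m \<in> carrier M"
  by (auto simp: xM_def)

lemma xM_zero [simp]: "\<zero> \<in> xM"
  using xM_I[of \<zero>] by simp

lemma xM_add: "m \<in> xM \<Longrightarrow> n \<in> xM \<Longrightarrow> m \<oplus> n \<in> xM"
  by (auto simp: xM_def act_distrib[symmetric])

lemma xM_act: "m \<in> xM \<Longrightarrow> p \<cdot> m \<in> xM"
  by (auto simp: xM_def act_left_commute[of _ p])

lemma xM_finsum: "finite I \<Longrightarrow> (\<And>i. i \<in> I \<Longrightarrow> g i \<in> xM) \<Longrightarrow> (\<Oplus>i\<in>I. g i) \<in> xM"
proof (induction I rule: finite_induct)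
  case (insert i I)
  then have "g \<in> I \<rightarrow> carrier M" "g i \<in> carrier M" by (auto intro: xM_closed)
  with insert show ?case by (simp add: xM_add)
qed simp

lemma at_x0_f: "at_x0 f = [:0, 1:] ^ Suc N * [:lc:]"
proof -
  have "at_x0 f = monom lc (Suc N)" by (rule poly_eqI) (auto simp: coeff2_f_0)
  also have "\<dots> = smult lc ([:0, 1:] ^ Suc N)" by (rule monom_altdef)
  also have "\<dots> = [:0, 1:] ^ Suc N * [:lc:]" by (simp del: power_Suc)
  finally show ?thesis .
qed

text \<open>
  Modulo \<open>x\<close>, the polynomial \<open>f\<close> is \<open>y^(N+1)\<close> up to a unit, and \<open>f\<close> acts as zero.
\<close>

lemma act_in_xM:
  assumes "[:0, 1:] ^ Suc N dvd at_x0 p" "m \<in> carrier M"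
  shows "p \<cdot> m \<in> xM"
proof -
  obtain r where r: "at_x0 p = [:0, 1:] ^ Suc N * r" using assms(1) by blast
  define b where "b = lift_y ([:inverse lc:] * r)"
  have "[:lc:] * ([:inverse lc:] * r) = r" using f_lead by simp
  then have "at_x0 (p - f * b) = 0"
    unfolding at_x0_diff at_x0_mult at_x0_f b_def at_x0_lift_y r by (simp only: mult.assoc diff_self)
  then obtain q where "p - f * b = var_x * q" using at_x0_eq_0_imp_dvd by blast
  then have "p = var_x * q + b * f" by (simp add: algebra_simps)
  then have "p \<cdot> m = var_x \<cdot> q \<cdot> m" using assms(2) by (simp add: act_add act_mult f_act)
  then show ?thesis using assms(2) by (simp add: xM_I)
qed

lemma act_in_xM_of_const_0:
  assumes "coeff2 p 0 0 = 0" "m \<in> carrier M"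
  shows "(var_y ^ N * p) \<cdot> m \<in> xM"
proof (rule act_in_xM[OF _ assms(2)])
  have "[:0, 1:] dvd at_x0 p"
    using assms(1) by (simp add: dvd_iff_poly_eq_0 poly_0_coeff_0)
  then show "[:0, 1:] ^ Suc N dvd at_x0 (var_y ^ N * p)"
    unfolding at_x0_mult at_x0_power at_x0_var_y power_Suc2 by (intro mult_dvd_mono dvd_refl)
qed

text \<open>
  The hypothesis says that \<open>q\<close> is annihilated by \<open>y\<close> in \<open>A/(x)\<close>, so \<open>q\<close> is there a multiple of
  \<open>y^N\<close>.
\<close>

lemma act_in_xM_of_socle:
  assumes "var_y * q = var_x * a + f * b" "m \<in> carrier M" "var_y ^ N \<cdot> m \<in> xM"
  shows "q \<cdot> m \<in> xM"
proof -
  have "[:0, 1:] * at_x0 q = [:0, 1:] * ([:0, 1:] ^ N * [:lc:] * at_x0 b)"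
    using arg_cong[OF assms(1), of at_x0] by (simp add: at_x0_f mult.assoc del: mult_pCons_right mult_pCons_left)
  then have q: "at_x0 q = [:0, 1:] ^ N * ([:lc:] * at_x0 b)"
    by (simp only: mult_cancel_left mult.assoc) simp
  define e where "e = lift_y ([:lc:] * at_x0 b)"
  have "at_x0 (q - var_y ^ N * e) = 0"
    unfolding e_def by (simp only: at_x0_diff at_x0_mult at_x0_power at_x0_var_y at_x0_lift_y q) simp
  then obtain h where "q - var_y ^ N * e = var_x * h" using at_x0_eq_0_imp_dvd by blast
  then have "q = var_x * h + e * var_y ^ N" by (simp add: algebra_simps)
  then have "q \<cdot> m = var_x \<cdot> h \<cdot> m \<oplus> e \<cdot> var_y ^ N \<cdot> m"
    using assms(2) by (simp add: act_add act_mult)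
  then show ?thesis using assms(2,3) by (simp add: xM_add xM_I xM_act)
qed

subsection \<open>\<open>k[x]\<close>-linear functionals\<close>

text \<open>
  A homogeneous \<open>k[x]\<close>-linear map \<open>lam\<close> of degree \<open>-v\<close> is the same as a single \<open>k\<close>-linear functional
  \<open>g\<close>: on the component of weight \<open>v + j wx\<close> put \<open>lam m = g(m) x^j\<close>. Linearity requires that \<open>g\<close> is
  invariant under multiplication by \<open>x\<close> from these weights on, and that it kills \<open>x m\<close> for \<open>m\<close> of
  weight \<open>v - wx\<close>. Such a \<open>g\<close> with \<open>g z = 1\<close> exists unless \<open>z\<close> lies in the span \<open>U\<close> of these
  relations, which for a torsion free module forces \<open>z\<close> to be divisible by \<open>x\<close>.
\<close>

lemma exists_graded_functional:
  assumes z: "z \<in> gM v" "z \<notin> xM"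
  shows "\<exists>lam :: 'm \<Rightarrow> 'k poly.
    (\<forall>m\<in>carrier M. \<forall>n\<in>carrier M. lam (m \<oplus> n) = lam m + lam n) \<and>
    (\<forall>q. \<forall>m\<in>carrier M. lam ([:q:] \<cdot> m) = q * lam m) \<and>
    (\<forall>u. \<forall>m\<in>gM u. weighted_homogeneous wx wy (u - v) [:lam m:]) \<and>
    poly.coeff (lam z) 0 = 1"
proof -
  define lvl where "lvl j = v + int j * int wx" for j :: nat
  have lvl_0: "lvl 0 = v" and lvl_Suc: "lvl (Suc j) = int wx + lvl j" for j
    by (simp_all add: lvl_def algebra_simps)
  have lvl_inj: "lvl i = lvl j \<longleftrightarrow> i = j" for i j using wx_pos by (simp add: lvl_def)
  have comp_x: "comp w (var_x \<cdot> m) = var_x \<cdot> comp (w - int wx) m" if "m \<in> carrier M" for w m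
    using comp_act[OF that weighted_homogeneous_var_x, of "w - int wx"] by simp
  have comp_c: "comp w (const2 c \<cdot> m) = const2 c \<cdot> comp w m" if "m \<in> carrier M" for w c m
    using comp_act[OF that weighted_homogeneous_const, of w c] by simp
  \<comment> \<open>Up to components of other weights, \<open>U\<close> consists of the elements \<open>x b - b'\<close>, where \<open>b'\<close> is the part
    of \<open>b\<close> in the weights \<open>v + j wx\<close>.\<close>
  define U where "U = {u \<in> carrier M. \<exists>b\<in>carrier M. \<forall>j.
    comp (lvl j) u = var_x \<cdot> comp (lvl j - int wx) b \<ominus> comp (lvl j) b}"
  have zc: "z \<in> carrier M" using z(1) gM_closed by blast
  have "z \<notin> U"
  proof
    assume "z \<in> U"
    then obtain b where b: "b \<in> carrier M" and
      rel: "\<And>j. comp (lvl j) z = var_x \<cdot> comp (lvl j - int wx) b \<ominus> comp (lvl j) b"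
      by (auto simp: U_def)
    \<comment> \<open>So the components of \<open>b\<close> are \<open>x^j b\<^sub>0\<close>; as almost all vanish and \<open>x\<close> is injective, \<open>b\<^sub>0 = 0\<close>.\<close>
    have step: "var_x \<cdot> comp (lvl j) b = comp (lvl (Suc j)) b" for j
    proof -
      have "lvl (Suc j) \<noteq> v" using lvl_inj[of "Suc j" 0] lvl_0 by simp
      then have "\<zero> = var_x \<cdot> comp (lvl j) b \<ominus> comp (lvl (Suc j)) b"
        using rel[of "Suc j"] by (simp add: comp_homogeneous[OF z(1)] lvl_Suc)
      then show ?thesis using b diff_eq_zero_iff by (metis act_closed comp_closed)
    qed
    have "finite {j. comp (lvl j) b \<noteq> \<zero>}"
      by (rule inj_on_finite[of lvl _ "{w. comp w b \<noteq> \<zero>}"])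
        (use finite_comp[OF b] lvl_inj in \<open>auto simp: inj_on_def\<close>)
    then obtain J where "comp (lvl J) b = \<zero>"
      using infinite_UNIV_nat by (metis (mono_tags, lifting) ex_new_if_finite mem_Collect_eq)
    then have "comp (lvl 0) b = \<zero>"
    proof (induction J)
      case (Suc J)
      then show ?case using step[of J] x_injective[of "comp (lvl J) b"] b by simp
    qed
    then have "z = var_x \<cdot> comp (v - int wx) b"
      using rel[of 0] b by (simp add: lvl_0 comp_homogeneous[OF z(1)] a_minus_def)
    with z(2) b show False by (simp add: xM_I)
  qed
  moreover have "\<zero> \<in> U"
    unfolding U_def by (auto intro!: bexI[of _ \<zero>] simp: a_minus_def)
  moreover have "m \<oplus> n \<in> U" if mn: "m \<in> U" "n \<in> U" for m n
  proof -
    obtain b b' where bb: "b \<in> carrier M" "b' \<in> carrier M" "m \<in> carrier M" "n \<in> carrier M"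
      "\<And>j. comp (lvl j) m = var_x \<cdot> comp (lvl j - int wx) b \<ominus> comp (lvl j) b"
      "\<And>j. comp (lvl j) n = var_x \<cdot> comp (lvl j - int wx) b' \<ominus> comp (lvl j) b'"
      using mn by (auto simp: U_def)
    then have "comp (lvl j) (m \<oplus> n)
        = var_x \<cdot> comp (lvl j - int wx) (b \<oplus> b') \<ominus> comp (lvl j) (b \<oplus> b')" for j
      by (simp add: comp_add act_distrib a_minus_def minus_add add.m_ac)
    then show ?thesis using bb unfolding U_def by blast
  qed
  moreover have "const2 c \<cdot> m \<in> U" if m: "m \<in> U" for c m
  proof -
    obtain b where bb: "b \<in> carrier M" "m \<in> carrier M"
      "\<And>j. comp (lvl j) m = var_x \<cdot> comp (lvl j - int wx) b \<ominus> comp (lvl j) b"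
      using m by (auto simp: U_def)
    then have "comp (lvl j) (const2 c \<cdot> m)
        = var_x \<cdot> comp (lvl j - int wx) (const2 c \<cdot> b) \<ominus> comp (lvl j) (const2 c \<cdot> b)" for j
      by (simp add: comp_c act_diff act_left_commute[of _ var_x])
    then show ?thesis using bb act_closed[OF bb(1)] act_closed[OF bb(2)] unfolding U_def by blast
  qed
  ultimately obtain g :: "'m \<Rightarrow> 'k" where g: "g z = 1" "\<And>u. u \<in> U \<Longrightarrow> g u = 0"
    "\<And>m n. m \<in> carrier M \<Longrightarrow> n \<in> carrier M \<Longrightarrow> g (m \<oplus> n) = g m + g n"
    "\<And>c m. m \<in> carrier M \<Longrightarrow> g (const2 c \<cdot> m) = c * g m"
    using separating_functional[of U z] zc unfolding U_def by (auto 4 4)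
  have g0: "g \<zero> = 0" using g(3)[of \<zero> \<zero>] by simp
  have g_shift: "g (var_x \<cdot> m) = g m" if m: "m \<in> gM (lvl j)" for j m
  proof -
    have mc: "m \<in> carrier M" using m gM_closed by blast
    have "var_x \<cdot> m \<ominus> m \<in> U"
      unfolding U_def using mc by (auto intro!: bexI[of _ m] simp: comp_diff comp_x)
    then have "g (var_x \<cdot> m \<ominus> m) = 0" by (rule g(2))
    moreover have "g (var_x \<cdot> m) = g (var_x \<cdot> m \<ominus> m) + g m"
      using g(3)[of "var_x \<cdot> m \<ominus> m" m] mc by (simp add: a_minus_def a_assoc l_neg)
    ultimately show ?thesis by simp
  qed
  have g_low: "g (var_x \<cdot> m) = 0" if m: "m \<in> gM (v - int wx)" for m
  proof (rule g(2))
    have mc: "m \<in> carrier M" using m gM_closed by blast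
    have "lvl j \<noteq> v - int wx" for j
      using wx_pos zero_le_mult_iff[of "int j" "int wx"] unfolding lvl_def by linarith
    then show "var_x \<cdot> m \<in> U"
      unfolding U_def using mc
      by (auto intro!: bexI[of _ m] simp: comp_x a_minus_def comp_homogeneous[OF m])
  qed
  define lam where "lam m = Abs_poly (\<lambda>j. g (comp (lvl j) m))" for m
  have coeff_lam: "poly.coeff (lam m) j = g (comp (lvl j) m)" if m: "m \<in> carrier M" for m j
  proof -
    have "finite {j. comp (lvl j) m \<noteq> \<zero>}"
      by (rule inj_on_finite[of lvl _ "{w. comp w m \<noteq> \<zero>}"])
        (use finite_comp[OF m] lvl_inj in \<open>auto simp: inj_on_def\<close>)
    then obtain J where "\<And>j. comp (lvl j) m \<noteq> \<zero> \<Longrightarrow> j \<le> J"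
      unfolding finite_nat_set_iff_bounded_le by auto
    then have "g (comp (lvl j) m) = 0" if "j > J" for j
      using that g0 by (metis not_less)
    then show ?thesis unfolding lam_def by (subst coeff_Abs_poly) auto
  qed
  have lam_add: "lam (m \<oplus> n) = lam m + lam n" if "m \<in> carrier M" "n \<in> carrier M" for m n
    using that by (intro poly_eqI) (simp add: coeff_lam comp_add g(3))
  have lam_c: "lam (const2 c \<cdot> m) = [:c:] * lam m" if "m \<in> carrier M" for c m
    using that by (intro poly_eqI) (simp add: coeff_lam comp_c g(4))
  have lam_x: "lam (var_x \<cdot> m) = pCons 0 (lam m)" if m: "m \<in> carrier M" for m
  proof (rule poly_eqI)
    fix j show "poly.coeff (lam (var_x \<cdot> m)) j = poly.coeff (pCons 0 (lam m)) j"
    proof (cases j)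
      case 0
      then show ?thesis using m g_low[OF comp_in_gM[OF m]] by (simp add: coeff_lam comp_x lvl_0)
    next
      case (Suc i)
      then show ?thesis using m g_shift[OF comp_in_gM[OF m]]
        by (simp add: coeff_lam comp_x lvl_Suc)
    qed
  qed
  have lam_q: "lam ([:q:] \<cdot> m) = q * lam m" if "m \<in> carrier M" for q m
  proof (induction q)
    case 0
    show ?case using that lam_c[OF that, of 0] by simp
  next
    case (pCons a q)
    have "lam ([:pCons a q:] \<cdot> m) = lam (const2 a \<cdot> m \<oplus> var_x \<cdot> [:q:] \<cdot> m)"
      using that by (subst pCons_eq_var_x) (simp only: act_add act_mult)
    also have "\<dots> = pCons a q * lam m"
      using that by (simp add: lam_add lam_c lam_x pCons)
    finally show ?case .
  qed
  have hom: "weighted_homogeneous wx wy (u - v) [:lam m:]" if m: "m \<in> gM u" for u m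
    unfolding weighted_homogeneous_def
  proof (intro allI impI)
    fix i j assume ne: "coeff2 [:lam m:] i j \<noteq> 0"
    then have j: "j = 0" by (cases j) auto
    with ne have "g (comp (lvl i) m) \<noteq> 0" using coeff_lam m gM_closed by simp
    then have "lvl i = u" using g0 by (auto simp: comp_homogeneous[OF m] split: if_splits)
    then show "int (wx * i + wy * j) = u - v" by (auto simp: lvl_def j algebra_simps)
  qed
  have "poly.coeff (lam z) 0 = 1"
    using zc by (simp add: coeff_lam lvl_0 comp_homogeneous[OF z(1)] g(1))
  with lam_add lam_q hom show ?thesis by blast
qed

subsection \<open>Homogeneous maps from \<open>M\<close> to \<open>A\<close>\<close>

text \<open>
  An \<open>A\<close>-linear map \<open>M \<rightarrow> A\<close> of degree \<open>-w\<close>, given by polynomial representatives of its values. These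
  are linear over \<open>k[x,y]\<close> only modulo \<open>f\<close>.
\<close>

definition graded_form :: "int \<Rightarrow> ('m \<Rightarrow> 'k poly poly) \<Rightarrow> bool"
  where "graded_form w \<theta> \<longleftrightarrow>
    (\<forall>m\<in>carrier M. \<forall>n\<in>carrier M. \<theta> (m \<oplus> n) = \<theta> m + \<theta> n) \<and>
    (\<forall>p. \<forall>m\<in>carrier M. f dvd \<theta> (p \<cdot> m) - p * \<theta> m) \<and>
    (\<forall>v. \<forall>m\<in>gM v. weighted_homogeneous wx wy (v - w) (\<theta> m))"

lemma graded_formD:
  assumes "graded_form w \<theta>"
  shows "m \<in> carrier M \<Longrightarrow> n \<in> carrier M \<Longrightarrow> \<theta> (m \<oplus> n) = \<theta> m + \<theta> n"
    and "m \<in> carrier M \<Longrightarrow> f dvd \<theta> (p \<cdot> m) - p * \<theta> m"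
    and "m \<in> gM v \<Longrightarrow> weighted_homogeneous wx wy (v - w) (\<theta> m)"
  using assms by (auto simp: graded_form_def)

lemma graded_form_zero: "graded_form w \<theta> \<Longrightarrow> \<theta> \<zero> = 0"
  using graded_formD(1)[of w \<theta> \<zero> \<zero>] by simp

lemma graded_form_finsum:
  assumes "graded_form w \<theta>" "finite I" "g \<in> I \<rightarrow> carrier M"
  shows "\<theta> (\<Oplus>i\<in>I. g i) = (\<Sum>i\<in>I. \<theta> (g i))"
  using assms(2,3)
  by (induction I rule: finite_induct)
    (simp_all add: graded_form_zero[OF assms(1)] graded_formD(1)[OF assms(1)] finsum_closed Pi_iff)

text \<open>
  This uses that \<open>A\<close> is Gorenstein, in explicit form. The quotients \<open>B (i+1)\<close> of \<open>f\<close> by \<open>y^(i+1)\<close>, for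
  \<open>i \<le> N\<close>, form the basis of \<open>A\<close> over \<open>k[x]\<close> dual to \<open>1, y, \<dots>, y^N\<close> with respect to the coefficient
  of \<open>y^N\<close>. So a \<open>k[x]\<close>-linear map \<open>lam\<close> from \<open>M\<close> to \<open>k[x]\<close> comes from the \<open>A\<close>-linear map
  \<open>m \<mapsto> \<Sum> lam(y^i m) B(i+1)\<close>. If \<open>lam(y^N n)\<close> has constant term 1, then the value of this map at \<open>n\<close>
  has weight 0 and is the leading coefficient of \<open>f\<close>.
\<close>

lemma exists_splitting_form:
  assumes n: "n \<in> gM w" and "var_y ^ N \<cdot> n \<notin> xM"
  shows "\<exists>\<theta>. graded_form w \<theta> \<and> \<theta> n = 1"
proof -
  define v where "v = int N * int wy + w"
  have "var_y ^ N \<cdot> n \<in> gM v"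
    unfolding v_def by (rule act_homogeneous[OF weighted_homogeneous_power[OF weighted_homogeneous_var_y] n])
  then obtain lam :: "'m \<Rightarrow> 'k poly" where
    "\<forall>m\<in>carrier M. \<forall>n\<in>carrier M. lam (m \<oplus> n) = lam m + lam n"
    "\<forall>q. \<forall>m\<in>carrier M. lam ([:q:] \<cdot> m) = q * lam m"
    "\<forall>u. \<forall>m\<in>gM u. weighted_homogeneous wx wy (u - v) [:lam m:]" and
    lam_z: "poly.coeff (lam (var_y ^ N \<cdot> n)) 0 = 1"
    using exists_graded_functional[OF _ assms(2)] by metis
  then have
    lam_add: "\<And>m n. m \<in> carrier M \<Longrightarrow> n \<in> carrier M \<Longrightarrow> lam (m \<oplus> n) = lam m + lam n" and
    lam_q: "\<And>q m. m \<in> carrier M \<Longrightarrow> lam ([:q:] \<cdot> m) = q * lam m" and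
    lam_hom: "\<And>u m. m \<in> gM u \<Longrightarrow> weighted_homogeneous wx wy (u - v) [:lam m:]"
    by simp_all
  define B where "B i = poly_shift i f" for i
  define a where "a m i = [:lam (var_y ^ i \<cdot> m):]" for m i
  define \<theta>0 where "\<theta>0 m = (\<Sum>i\<le>N. a m i * B (Suc i))" for m
  define \<theta> where "\<theta> m = const2 (inverse lc) * \<theta>0 m" for m
  have B_rec: "var_y * B (Suc i) = B i - [:poly.coeff f i:]" for i
    by (rule poly_eqI) (auto simp: B_def var_y_def coeff_poly_shift coeff_pCons split: nat.split)
  have B_top: "B (Suc N) = [:poly.coeff f (Suc N):]"
    by (rule poly_eqI) (auto simp: B_def coeff_poly_shift coeff_pCons coeff_f_above split: nat.split)
  have B_0: "B 0 = f" by (rule poly_eqI) (simp add: B_def coeff_poly_shift)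
  have B_hom: "weighted_homogeneous wx wy (d - int (Suc i) * int wy) (B (Suc i))" for i
    unfolding weighted_homogeneous_def
  proof (intro allI impI)
    fix h j assume "coeff2 (B (Suc i)) h j \<noteq> 0"
    then have "coeff2 f h (j + Suc i) \<noteq> 0" by (simp add: B_def coeff_poly_shift)
    then have "int (wx * h + wy * (j + Suc i)) = d"
      using f_homogeneous unfolding weighted_homogeneous_def by blast
    then show "int (wx * h + wy * j) = d - int (Suc i) * int wy" by (simp add: algebra_simps)
  qed
  have a_add: "a (m \<oplus> m') i = a m i + a m' i" if "m \<in> carrier M" "m' \<in> carrier M" for m m' i
    using that by (simp add: a_def act_distrib lam_add)
  have a_q: "a ([:q:] \<cdot> m) i = [:q:] * a m i" if "m \<in> carrier M" for m q i
    using that by (simp add: a_def lam_q act_left_commute[of m "var_y ^ i"])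
  have a_y: "a (var_y \<cdot> m) i = a m (Suc i)" if "m \<in> carrier M" for m i
    using that by (simp add: a_def act_mult act_left_commute[of m "var_y ^ i"])
  have lam_sum: "lam (\<Oplus>i\<in>I. g i) = (\<Sum>i\<in>I. lam (g i))"
    if "finite I" "g \<in> I \<rightarrow> carrier M" for I and g :: "nat \<Rightarrow> 'm"
    using that
  proof (induction I rule: finite_induct)
    case empty
    show ?case using lam_add[of \<zero> \<zero>] by simp
  qed (simp add: lam_add finsum_closed Pi_iff)
  have a_f: "(\<Sum>i\<le>Suc N. [:poly.coeff f i:] * a m i) = 0" if m: "m \<in> carrier M" for m
  proof -
    have "0 = lam (f \<cdot> m)" using m lam_add[of \<zero> \<zero>] by (simp add: f_act)
    also have "f \<cdot> m = (\<Sum>i\<le>Suc N. [:poly.coeff f i:] * var_y ^ i) \<cdot> m"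
      by (simp only: f_expand[symmetric])
    also have "\<dots> = (\<Oplus>i\<in>{..Suc N}. ([:poly.coeff f i:] * var_y ^ i) \<cdot> m)"
      by (rule sum_act) (use m in simp_all)
    also have "\<dots> = (\<Oplus>i\<in>{..Suc N}. [:poly.coeff f i:] \<cdot> var_y ^ i \<cdot> m)"
      by (simp only: act_mult[OF m])
    also have "lam \<dots> = (\<Sum>i\<le>Suc N. poly.coeff f i * lam (var_y ^ i \<cdot> m))"
      using m by (subst lam_sum) (auto simp: lam_q simp del: sum.atMost_Suc intro!: sum.cong)
    finally have z: "(\<Sum>i\<le>Suc N. poly.coeff f i * lam (var_y ^ i \<cdot> m)) = 0" ..
    have "(\<Sum>i\<le>Suc N. [:poly.coeff f i:] * a m i) = [:\<Sum>i\<le>Suc N. poly.coeff f i * lam (var_y ^ i \<cdot> m):]"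
      by (rule poly_eqI)
        (simp add: coeff_sum a_def coeff_pCons mult.commute split: nat.split del: sum.atMost_Suc)
    then show ?thesis by (simp only: z) simp
  qed
  \<comment> \<open>The telescoping sum behind \<open>\<theta> (y m) = y \<theta> m\<close>.\<close>
  have \<theta>0_y: "\<theta>0 (var_y \<cdot> m) - var_y * \<theta>0 m = - (a m 0 * f)" if m: "m \<in> carrier M" for m
  proof -
    have "var_y * \<theta>0 m = (\<Sum>i\<le>N. a m i * (var_y * B (Suc i)))"
      by (simp add: \<theta>0_def sum_distrib_left mult.left_commute)
    also have "\<dots> = (\<Sum>i\<le>N. a m i * B i) - (\<Sum>i\<le>N. [:poly.coeff f i:] * a m i)"
      unfolding B_rec right_diff_distrib sum_subtractf by (simp only: mult.commute)
    also have "(\<Sum>i\<le>N. [:poly.coeff f i:] * a m i) = - (a m (Suc N) * B (Suc N))"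
      using a_f[OF m] unfolding B_top by (simp only: sum.atMost_Suc mult.commute) (rule eq_neg_iff_add_eq_0[THEN iffD2])
    also have "(\<Sum>i\<le>N. a m i * B i) - - (a m (Suc N) * B (Suc N)) = (\<Sum>i\<le>Suc N. a m i * B i)"
      by simp
    also have "\<dots> = a m 0 * B 0 + (\<Sum>i\<le>N. a m (Suc i) * B (Suc i))"
      by (rule sum.atMost_Suc_shift)
    also have "(\<Sum>i\<le>N. a m (Suc i) * B (Suc i)) = \<theta>0 (var_y \<cdot> m)"
      using m by (simp add: \<theta>0_def a_y)
    finally show ?thesis by (simp add: B_0)
  qed
  have \<theta>0_q: "\<theta>0 ([:q:] \<cdot> m) = [:q:] * \<theta>0 m" if "m \<in> carrier M" for q m
    using that by (simp only: \<theta>0_def a_q sum_distrib_left mult.assoc)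
  have \<theta>0_add: "\<theta>0 (m \<oplus> m') = \<theta>0 m + \<theta>0 m'" if "m \<in> carrier M" "m' \<in> carrier M" for m m'
    using that by (simp add: \<theta>0_def a_add distrib_right sum.distrib)
  have \<theta>0_lin: "f dvd \<theta>0 (p \<cdot> m) - p * \<theta>0 m" if "m \<in> carrier M" for p m
    using that
  proof (induction p arbitrary: m rule: bivariate_induct)
    case (const c)
    then show ?case by (simp only: \<theta>0_q) simp
  next
    case var_x
    then show ?case by (simp only: \<theta>0_q Defs.var_x_def) simp
  next
    case var_y
    then show ?case by (simp add: \<theta>0_y)
  next
    case (add p q)
    have "\<theta>0 ((p + q) \<cdot> m) - (p + q) * \<theta>0 m
        = (\<theta>0 (p \<cdot> m) - p * \<theta>0 m) + (\<theta>0 (q \<cdot> m) - q * \<theta>0 m)"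
      using add(3) by (simp add: act_add \<theta>0_add algebra_simps)
    then show ?case using add by simp
  next
    case (mult p q)
    have "\<theta>0 ((p * q) \<cdot> m) - p * q * \<theta>0 m
        = (\<theta>0 (p \<cdot> q \<cdot> m) - p * \<theta>0 (q \<cdot> m)) + p * (\<theta>0 (q \<cdot> m) - q * \<theta>0 m)"
      using mult(3) by (simp add: act_mult algebra_simps)
    then show ?case using mult by simp
  qed
  have \<theta>0_hom: "weighted_homogeneous wx wy (u - w) (\<theta>0 m)" if m: "m \<in> gM u" for u m
    unfolding \<theta>0_def
  proof (rule weighted_homogeneous_sum)
    fix i
    have "weighted_homogeneous wx wy (int i * int wy + u - v) (a m i)"
      unfolding a_def
      by (rule lam_hom[OF act_homogeneous[OF weighted_homogeneous_power[OF weighted_homogeneous_var_y] m]])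
    from weighted_homogeneous_mult[OF this B_hom[of i]]
    show "weighted_homogeneous wx wy (u - w) (a m i * B (Suc i))"
      by (simp add: d_eq v_def algebra_simps)
  qed
  have form: "graded_form w \<theta>"
    unfolding graded_form_def
  proof (intro conjI ballI allI)
    fix m m' assume "m \<in> carrier M" "m' \<in> carrier M"
    then show "\<theta> (m \<oplus> m') = \<theta> m + \<theta> m'" by (simp only: \<theta>_def \<theta>0_add distrib_left)
  next
    fix p m assume "m \<in> carrier M"
    then have "f dvd const2 (inverse lc) * (\<theta>0 (p \<cdot> m) - p * \<theta>0 m)"
      by (rule dvd_mult[OF \<theta>0_lin])
    then show "f dvd \<theta> (p \<cdot> m) - p * \<theta> m"
      by (simp only: \<theta>_def right_diff_distrib mult.left_commute)
  next
    fix u m assume "m \<in> gM u"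
    from weighted_homogeneous_mult[OF weighted_homogeneous_const \<theta>0_hom[OF this]]
    show "weighted_homogeneous wx wy (u - w) (\<theta> m)" by (simp only: \<theta>_def add_0)
  qed
  have "coeff2 (\<theta>0 n) 0 0 = (\<Sum>i\<le>N. poly.coeff (lam (var_y ^ i \<cdot> n)) 0 * coeff2 f 0 (Suc i))"
    by (simp add: \<theta>0_def coeff_sum a_def B_def coeff_poly_shift coeff_mult_0)
  also have "\<dots> = (\<Sum>i\<le>N. if i = N then lc else 0)"
    by (rule sum.cong[OF refl]) (auto simp: coeff2_f_0 lam_z)
  finally have "coeff2 (\<theta>0 n) 0 0 = lc" by simp
  moreover have "\<theta>0 n = const2 (coeff2 (\<theta>0 n) 0 0)"
    using \<theta>0_hom[OF n] weighted_homogeneous_weight_0 wx_pos wy_pos by simp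
  ultimately have "\<theta> n = 1"
    using f_lead by (simp add: \<theta>_def one_pCons)
  with form show ?thesis by blast
qed


subsection \<open>A maximal free summand\<close>

text \<open>
  A dual family splits off a free summand of \<open>M\<close> with basis \<open>e i\<close>: the projection is
  \<open>m \<mapsto> \<Sum> \<theta> i m \<cdot> e i\<close>.
\<close>

definition dual_family ::
    "nat \<Rightarrow> (nat \<Rightarrow> int) \<Rightarrow> (nat \<Rightarrow> 'm) \<Rightarrow> (nat \<Rightarrow> 'm \<Rightarrow> 'k poly poly) \<Rightarrow> bool"
  where "dual_family r w e \<theta> \<longleftrightarrow>
    (\<forall>i<r. e i \<in> gM (w i) \<and> graded_form (w i) (\<theta> i)) \<and>
    (\<forall>i<r. \<forall>j<r. f dvd \<theta> i (e j) - (if i = j then 1 else 0))"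

text \<open>
  The rank of a free summand is at most the number of generators: evaluate everything at the origin.
\<close>

lemma dual_family_bound:
  assumes "dual_family r w e \<theta>"
  shows "r \<le> card S"
proof -
  have e: "e j \<in> carrier M" if "j < r" for j
    using assms that gM_closed by (auto simp: dual_family_def)
  then have "\<forall>j. \<exists>c. j < r \<longrightarrow> e j = (\<Oplus>s\<in>S. c s \<cdot> s)" using S_generates by blast
  from choice[OF this] obtain c where c: "\<And>j. j < r \<Longrightarrow> e j = (\<Oplus>s\<in>S. c j s \<cdot> s)" by blast
  have origin_add: "coeff2 (p + q) 0 0 = coeff2 p 0 0 + coeff2 q 0 0"
    and origin_mult: "coeff2 (p * q) 0 0 = coeff2 p 0 0 * coeff2 q 0 0" for p q :: "'k poly poly"
    by (simp_all add: coeff_mult_0)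
  have f0: "coeff2 f 0 0 = 0" by (rule coeff2_f_0) simp
  have origin_dvd: "coeff2 p 0 0 = coeff2 q 0 0" if "f dvd p - q" for p q
  proof -
    obtain b where "p = f * b + q" using \<open>f dvd p - q\<close> by (metis dvdE diff_add_cancel)
    then show ?thesis by (simp only: origin_add origin_mult f0) simp
  qed
  show ?thesis
  proof (rule dual_families_bound[OF S(1)])
    fix i j assume ij: "i < r" "j < r"
    then have \<theta>: "graded_form (w i) (\<theta> i)" using assms by (simp add: dual_family_def)
    have "\<theta> i (e j) = (\<Sum>s\<in>S. \<theta> i (c j s \<cdot> s))"
      using S by (simp add: c[OF ij(2)] graded_form_finsum[OF \<theta>] Pi_iff subsetD)
    also have "coeff2 \<dots> 0 0 = (\<Sum>s\<in>S. coeff2 (\<theta> i (c j s \<cdot> s)) 0 0)"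
      by (simp add: coeff_sum)
    also have "\<dots> = (\<Sum>s\<in>S. coeff2 (c j s) 0 0 * coeff2 (\<theta> i s) 0 0)"
      using S(2) origin_dvd[OF graded_formD(2)[OF \<theta>]] by (intro sum.cong) (auto simp: origin_mult)
    finally have "(\<Sum>s\<in>S. coeff2 (c j s) 0 0 * coeff2 (\<theta> i s) 0 0) = coeff2 (\<theta> i (e j)) 0 0" ..
    also have "\<dots> = coeff2 (if i = j then 1 else 0) 0 0"
      using assms ij by (intro origin_dvd) (simp add: dual_family_def)
    finally show "(\<Sum>s\<in>S. coeff2 (c j s) 0 0 * coeff2 (\<theta> i s) 0 0) = (if i = j then 1 else 0)"
      by simp
  qed
qed

text \<open>
  The new form is made to vanish on the old basis by subtracting multiples of the old forms. Since these
  vanish at \<open>n\<close>, its value at \<open>n\<close> stays 1.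
\<close>

lemma dual_family_extend:
  assumes fam: "dual_family r w e \<theta>" and n: "n \<in> gM u" "\<And>i. i < r \<Longrightarrow> f dvd \<theta> i n"
    and form: "graded_form u \<psi>" "\<psi> n = 1"
  shows "\<exists>w e \<theta>. dual_family (Suc r) w e \<theta>"
proof -
  have e: "e i \<in> gM (w i)" and \<theta>: "graded_form (w i) (\<theta> i)" if "i < r" for i
    using fam that by (simp_all add: dual_family_def)
  have dual: "f dvd \<theta> i (e j) - (if i = j then 1 else 0)" if "i < r" "j < r" for i j
    using fam that by (simp add: dual_family_def)
  define \<psi>' where "\<psi>' m = \<psi> m - (\<Sum>i<r. \<psi> (e i) * \<theta> i m)" for m
  have \<psi>'_form: "graded_form u \<psi>'"
    unfolding graded_form_def
  proof (intro conjI ballI allI)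
    fix m m' assume "m \<in> carrier M" "m' \<in> carrier M"
    then show "\<psi>' (m \<oplus> m') = \<psi>' m + \<psi>' m'"
      using graded_formD(1)[OF \<theta>]
      by (simp add: \<psi>'_def graded_formD(1)[OF form(1)] distrib_left sum.distrib)
  next
    fix p m assume m: "m \<in> carrier M"
    have "\<psi>' (p \<cdot> m) - p * \<psi>' m = (\<psi> (p \<cdot> m) - p * \<psi> m)
        - (\<Sum>i<r. \<psi> (e i) * (\<theta> i (p \<cdot> m) - p * \<theta> i m))"
      by (simp add: \<psi>'_def algebra_simps sum_subtractf sum_distrib_left)
    also have "f dvd \<dots>"
      using m by (auto intro!: dvd_diff[OF graded_formD(2)[OF form(1)]] dvd_sum dvd_mult graded_formD(2)[OF \<theta>])
    finally show "f dvd \<psi>' (p \<cdot> m) - p * \<psi>' m" .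
  next
    fix v m assume m: "m \<in> gM v"
    have "weighted_homogeneous wx wy (v - u) (\<psi> (e i) * \<theta> i m)" if i: "i < r" for i
      using weighted_homogeneous_mult[OF graded_formD(3)[OF form(1) e[OF i]] graded_formD(3)[OF \<theta>[OF i] m]]
      by simp
    then have "weighted_homogeneous wx wy (v - u) (\<Sum>i<r. \<psi> (e i) * \<theta> i m)"
      by (intro weighted_homogeneous_sum) simp
    then have "weighted_homogeneous wx wy (v - u) (\<psi> m + const2 (-1) * (\<Sum>i<r. \<psi> (e i) * \<theta> i m))"
      using weighted_homogeneous_mult[OF weighted_homogeneous_const[of wx wy "-1"]]
      by (intro weighted_homogeneous_add graded_formD(3)[OF form(1) m]) fastforce
    moreover have "const2 (-1) * q = - q" for q :: "'k poly poly"
      by (rule poly2_eqI) simp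
    ultimately show "weighted_homogeneous wx wy (v - u) (\<psi>' m)"
      by (simp only: \<psi>'_def diff_conv_add_uminus)
  qed
  have \<psi>'_n: "f dvd \<psi>' n - 1"
    using n(2) by (auto simp: \<psi>'_def form(2) intro!: dvd_sum dvd_mult)
  have \<psi>'_e: "f dvd \<psi>' (e j)" if j: "j < r" for j
  proof -
    have "\<psi>' (e j) = \<psi> (e j) - (\<Sum>i<r. \<psi> (e i) * (if i = j then 1 else 0))
        - (\<Sum>i<r. \<psi> (e i) * (\<theta> i (e j) - (if i = j then 1 else 0)))"
      by (simp add: \<psi>'_def right_diff_distrib sum_subtractf)
    also have "(\<Sum>i<r. \<psi> (e i) * (if i = j then 1 else 0)) = (\<Sum>i<r. if i = j then \<psi> (e i) else 0)"
      by (rule sum.cong) auto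
    also have "\<dots> = \<psi> (e j)" using j by simp
    finally have "\<psi>' (e j) = - (\<Sum>i<r. \<psi> (e i) * (\<theta> i (e j) - (if i = j then 1 else 0)))" by simp
    moreover have "f dvd (\<Sum>i<r. \<psi> (e i) * (\<theta> i (e j) - (if i = j then 1 else 0)))"
      by (rule dvd_sum, rule dvd_mult, rule dual[OF _ j]) simp
    ultimately show ?thesis by simp
  qed
  have "dual_family (Suc r) (w(r := u)) (e(r := n)) (\<theta>(r := \<psi>'))"
    unfolding dual_family_def
    using e \<theta> dual n \<psi>'_form \<psi>'_n \<psi>'_e by (auto simp: less_Suc_eq)
  then show ?thesis by blast
qed

text \<open>
  On the free summand the operator is the weight operator shifted by the weights of the generators,
  so that it kills the generators; on the complement it is the weight operator itself.
\<close>

definition split_weight_op ::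
    "nat \<Rightarrow> (nat \<Rightarrow> int) \<Rightarrow> (nat \<Rightarrow> 'm) \<Rightarrow> (nat \<Rightarrow> 'm \<Rightarrow> 'k poly poly) \<Rightarrow> 'm \<Rightarrow> 'm"
  where "split_weight_op r w e \<theta> m =
    weight_op m \<ominus> (\<Oplus>i\<in>{..<r}. (of_int (w i) * \<theta> i m) \<cdot> e i)"

lemma split_weight_op:
  assumes "dual_family r w e \<theta>"
  shows split_weight_op_closed: "m \<in> carrier M \<Longrightarrow> split_weight_op r w e \<theta> m \<in> carrier M"
    and split_weight_op_add: "m \<in> carrier M \<Longrightarrow> n \<in> carrier M \<Longrightarrow>
      split_weight_op r w e \<theta> (m \<oplus> n) = split_weight_op r w e \<theta> m \<oplus> split_weight_op r w e \<theta> n"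
    and split_weight_op_act: "m \<in> carrier M \<Longrightarrow>
      split_weight_op r w e \<theta> (p \<cdot> m) = p \<cdot> split_weight_op r w e \<theta> m \<oplus> euler wx wy p \<cdot> m"
    and split_weight_op_gM: "m \<in> gM u \<Longrightarrow> split_weight_op r w e \<theta> m \<in> gM u"
proof -
  have e: "e i \<in> gM (w i)" "e i \<in> carrier M" and \<theta>: "graded_form (w i) (\<theta> i)" if "i < r" for i
    using assms that gM_closed by (auto simp: dual_family_def)
  let ?\<Sigma> = "\<lambda>m. \<Oplus>i\<in>{..<r}. (of_int (w i) * \<theta> i m) \<cdot> e i"
  have \<Sigma>_closed: "?\<Sigma> m \<in> carrier M" for m by (rule finsum_closed) (auto simp: e)
  show "split_weight_op r w e \<theta> m \<in> carrier M" if "m \<in> carrier M"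
    using that \<Sigma>_closed by (simp add: split_weight_op_def weight_op)
  show "split_weight_op r w e \<theta> (m \<oplus> n) = split_weight_op r w e \<theta> m \<oplus> split_weight_op r w e \<theta> n"
    if mn: "m \<in> carrier M" "n \<in> carrier M"
  proof -
    have "?\<Sigma> (m \<oplus> n) = (\<Oplus>i\<in>{..<r}. (of_int (w i) * \<theta> i m) \<cdot> e i \<oplus> (of_int (w i) * \<theta> i n) \<cdot> e i)"
      using e mn by (intro add.finprod_cong') (auto simp: graded_formD(1)[OF \<theta>] distrib_left act_add)
    also have "\<dots> = ?\<Sigma> m \<oplus> ?\<Sigma> n" by (rule finsum_addf) (auto simp: e)
    finally show ?thesis
      using mn \<Sigma>_closed by (simp add: split_weight_op_def weight_op weight_op_add minus_eq minus_add add.m_ac)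
  qed
  show "split_weight_op r w e \<theta> (p \<cdot> m) = p \<cdot> split_weight_op r w e \<theta> m \<oplus> euler wx wy p \<cdot> m"
    if m: "m \<in> carrier M"
  proof -
    have "?\<Sigma> (p \<cdot> m) = (\<Oplus>i\<in>{..<r}. p \<cdot> (of_int (w i) * \<theta> i m) \<cdot> e i)"
    proof (intro add.finprod_cong' refl)
      fix i assume i: "i \<in> {..<r}"
      have "f dvd of_int (w i) * (\<theta> i (p \<cdot> m) - p * \<theta> i m)"
        using i m by (intro dvd_mult graded_formD(2)[OF \<theta>]) auto
      then have "f dvd of_int (w i) * \<theta> i (p \<cdot> m) - p * (of_int (w i) * \<theta> i m)"
        by (simp add: right_diff_distrib mult.left_commute)
      from act_cong[OF this e(2)] show "(of_int (w i) * \<theta> i (p \<cdot> m)) \<cdot> e i = p \<cdot> (of_int (w i) * \<theta> i m) \<cdot> e i"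
        using i e(2) by (simp add: act_mult)
    qed (auto simp: e)
    also have "\<dots> = p \<cdot> ?\<Sigma> m" by (rule act_finsum[symmetric]) (auto simp: e)
    finally show ?thesis
      using m \<Sigma>_closed
      by (simp add: split_weight_op_def weight_op weight_op_act minus_eq act_distrib act_minus add.m_ac)
  qed
  show "split_weight_op r w e \<theta> m \<in> gM u" if m: "m \<in> gM u"
  proof -
    have "(of_int (w i) * \<theta> i m) \<cdot> e i \<in> gM u" if i: "i < r" for i
      using act_homogeneous[OF weighted_homogeneous_mult[OF weighted_homogeneous_of_int graded_formD(3)[OF \<theta>[OF i] m]] e(1)[OF i]]
      by simp
    then show ?thesis
      unfolding split_weight_op_def weight_op_homogeneous[OF m]
      by (intro gM_diff of_int_act_in_gM m gM_finsum) auto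
  qed
qed

text \<open>
  Take a free summand of maximal rank. On it the operator is the Euler derivation applied to the
  coordinates, and Euler derivatives lie in the ideal \<open>(x, y)\<close>, which \<open>y^N\<close> maps into \<open>x A\<close>. A homogeneous
  element \<open>n\<close> of the complement with \<open>y^N n\<close> outside \<open>x M\<close> would split off a further free summand.
\<close>

theorem exists_good_euler_operator:
  "\<exists>T. euler_operator T \<and> (\<forall>m\<in>carrier M. var_y ^ N \<cdot> T m \<in> xM)"
proof -
  let ?P = "\<lambda>r. \<exists>w e \<theta>. dual_family r w e \<theta>"
  have "?P 0" by (simp add: dual_family_def)
  moreover have "\<forall>r. ?P r \<longrightarrow> r \<le> card S" using dual_family_bound by blast
  ultimately have "?P (Greatest ?P)" and max: "\<And>r. ?P r \<Longrightarrow> r \<le> Greatest ?P"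
    using GreatestI_nat[of ?P 0 "card S"] Greatest_le_nat[of ?P _ "card S"] by blast+
  then obtain r w e \<theta> where fam: "dual_family r w e \<theta>" and max: "\<And>r'. ?P r' \<Longrightarrow> r' \<le> r" by blast
  have e: "e i \<in> gM (w i)" "e i \<in> carrier M" and \<theta>: "graded_form (w i) (\<theta> i)" if "i < r" for i
    using fam that gM_closed by (auto simp: dual_family_def)
  define T where "T = split_weight_op r w e \<theta>"
  have T_closed: "T m \<in> carrier M" if "m \<in> carrier M" for m
    unfolding T_def by (rule split_weight_op_closed[OF fam that])
  have T_add: "T (m \<oplus> n) = T m \<oplus> T n" if "m \<in> carrier M" "n \<in> carrier M" for m n
    unfolding T_def by (rule split_weight_op_add[OF fam that])
  have main: "var_y ^ N \<cdot> T m \<in> xM" if m: "m \<in> gM u" for m u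
  proof (rule ccontr)
    assume notin: "var_y ^ N \<cdot> T m \<notin> xM"
    have mc: "m \<in> carrier M" using m gM_closed by blast
    let ?\<Sigma> = "\<Oplus>i\<in>{..<r}. \<theta> i m \<cdot> e i"
    let ?\<Sigma>' = "\<Oplus>i\<in>{..<r}. (of_int u * \<theta> i m - of_int (w i) * \<theta> i m) \<cdot> e i"
    \<comment> \<open>The component of \<open>m\<close> in the complement of the free summand.\<close>
    define n where "n = m \<ominus> ?\<Sigma>"
    have \<Sigma>: "?\<Sigma> \<in> gM u"
    proof (rule gM_finsum)
      fix i assume "i \<in> {..<r}"
      then show "\<theta> i m \<cdot> e i \<in> gM u"
        using act_homogeneous[OF graded_formD(3)[OF \<theta> m] e(1), of i i] by simp
    qed simp
    then have n: "n \<in> gM u" unfolding n_def by (rule gM_diff[OF m])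
    have nc: "n \<in> carrier M" using n gM_closed by blast
    have \<Sigma>'_closed: "?\<Sigma>' \<in> carrier M" by (rule finsum_closed) (auto simp: e)
    have T_m: "T m = of_int u \<cdot> n \<oplus> ?\<Sigma>'"
    proof -
      let ?A = "\<Oplus>i\<in>{..<r}. (of_int (w i) * \<theta> i m) \<cdot> e i"
      have A: "?A \<in> carrier M" by (rule finsum_closed) (auto simp: e)
      have "of_int u \<cdot> ?\<Sigma> = (\<Oplus>i\<in>{..<r}. (of_int u * \<theta> i m) \<cdot> e i)"
        by (subst act_finsum) (auto simp: e act_mult intro!: add.finprod_cong')
      also have "\<dots> = (\<Oplus>i\<in>{..<r}. (of_int u * \<theta> i m - of_int (w i) * \<theta> i m) \<cdot> e i
          \<oplus> (of_int (w i) * \<theta> i m) \<cdot> e i)"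
        by (intro add.finprod_cong') (auto simp: e act_add[symmetric])
      also have "\<dots> = ?\<Sigma>' \<oplus> ?A" by (rule finsum_addf) (auto simp: e)
      finally have "of_int u \<cdot> ?\<Sigma> = ?\<Sigma>' \<oplus> ?A" .
      then have "of_int u \<cdot> n \<oplus> ?\<Sigma>' = of_int u \<cdot> m \<ominus> (?\<Sigma>' \<oplus> ?A) \<oplus> ?\<Sigma>'"
        using mc gM_closed[OF \<Sigma>] by (simp add: n_def act_diff)
      also have "\<dots> = of_int u \<cdot> m \<ominus> ?A \<oplus> (\<ominus> ?\<Sigma>' \<oplus> ?\<Sigma>')"
        using mc A \<Sigma>'_closed by (simp add: minus_eq minus_add add.m_ac)
      also have "\<dots> = T m"
        using mc A \<Sigma>'_closed by (simp add: T_def split_weight_op_def weight_op_homogeneous[OF m] l_neg)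
      finally show ?thesis ..
    qed
    \<comment> \<open>Either \<open>\<theta> i m\<close> has weight 0, and then its multiple in \<open>?\<Sigma>'\<close> vanishes, or it has no constant term.\<close>
    have "var_y ^ N \<cdot> ?\<Sigma>' \<in> xM"
    proof -
      have "var_y ^ N \<cdot> (of_int u * \<theta> i m - of_int (w i) * \<theta> i m) \<cdot> e i \<in> xM" if i: "i < r" for i
      proof -
        have "coeff2 (of_int (u - w i) * \<theta> i m) 0 0 = 0"
        proof (cases "u = w i")
          case False
          then have "coeff2 (\<theta> i m) 0 0 = 0"
            using graded_formD(3)[OF \<theta>[OF i] m] unfolding weighted_homogeneous_def by fastforce
          then show ?thesis by (simp add: coeff_mult_0)
        qed simp
        then have "(var_y ^ N * (of_int (u - w i) * \<theta> i m)) \<cdot> e i \<in> xM"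
          using e(2)[OF i] by (rule act_in_xM_of_const_0)
        then show ?thesis using e(2)[OF i] by (simp add: act_mult left_diff_distrib)
      qed
      then show ?thesis
        by (subst act_finsum) (auto simp: e intro!: xM_finsum)
    qed
    then have "var_y ^ N \<cdot> n \<notin> xM"
      using notin nc \<Sigma>'_closed xM_act[of "var_y ^ N \<cdot> n" "of_int u"]
      unfolding T_m by (auto simp: act_distrib act_left_commute[of n] xM_add)
    then obtain \<psi> where \<psi>: "graded_form u \<psi>" "\<psi> n = 1" using exists_splitting_form[OF n] by blast
    have "f dvd \<theta> i n" if i: "i < r" for i
    proof -
      have \<Sigma>c: "\<theta> i ?\<Sigma> = (\<Sum>j<r. \<theta> i (\<theta> j m \<cdot> e j))"
        by (rule graded_form_finsum[OF \<theta>[OF i]]) (auto simp: e)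
      have "\<theta> i m = \<theta> i (n \<oplus> ?\<Sigma>)"
        using mc gM_closed[OF \<Sigma>] by (simp add: n_def minus_eq a_assoc l_neg)
      also have "\<dots> = \<theta> i n + (\<Sum>j<r. \<theta> i (\<theta> j m \<cdot> e j))"
        using graded_formD(1)[OF \<theta>[OF i] nc gM_closed[OF \<Sigma>]] by (simp add: \<Sigma>c)
      finally have "\<theta> i n = \<theta> i m - (\<Sum>j<r. \<theta> i (\<theta> j m \<cdot> e j))" by simp
      also have "\<dots> = (\<theta> i m - (\<Sum>j<r. \<theta> j m * (if i = j then 1 else 0)))
          - (\<Sum>j<r. (\<theta> i (\<theta> j m \<cdot> e j) - \<theta> j m * \<theta> i (e j)))
          - (\<Sum>j<r. \<theta> j m * (\<theta> i (e j) - (if i = j then 1 else 0)))"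
        by (simp only: right_diff_distrib sum_subtractf) (simp only: algebra_simps)
      also have "(\<Sum>j<r. \<theta> j m * (if i = j then 1 else 0)) = (\<Sum>j<r. if j = i then \<theta> j m else 0)"
        by (rule sum.cong) auto
      also have "\<dots> = \<theta> i m" using i by simp
      finally have eq: "\<theta> i n = \<theta> i m - \<theta> i m - (\<Sum>j<r. (\<theta> i (\<theta> j m \<cdot> e j) - \<theta> j m * \<theta> i (e j)))
          - (\<Sum>j<r. \<theta> j m * (\<theta> i (e j) - (if i = j then 1 else 0)))" .
      have "f dvd (\<Sum>j<r. (\<theta> i (\<theta> j m \<cdot> e j) - \<theta> j m * \<theta> i (e j)))"
        using e by (intro dvd_sum graded_formD(2)[OF \<theta>[OF i]]) auto
      moreover have "f dvd (\<Sum>j<r. \<theta> j m * (\<theta> i (e j) - (if i = j then 1 else 0)))"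
        using fam i by (intro dvd_sum dvd_mult) (simp add: dual_family_def)
      ultimately show ?thesis unfolding eq diff_self by (intro dvd_diff dvd_0_right)
    qed
    from dual_family_extend[OF fam n this \<psi>] max[of "Suc r"] show False by auto
  qed
  have "var_y ^ N \<cdot> T m \<in> xM" if "m \<in> carrier M" for m
    using that
  proof (induction m rule: homogeneous_induct)
    case zero
    show ?case by (rule main[OF gM_zero])
  next
    case (homogeneous w m)
    then show ?case by (rule main)
  next
    case (add m n)
    then show ?case by (simp add: T_add T_closed act_distrib xM_add)
  qed
  moreover have "euler_operator T"
    unfolding euler_operator_def T_def using split_weight_op[OF fam] by simp
  ultimately show ?thesis by blast
qed

text \<open>
  The elements \<open>q\<close> with \<open>y q \<in> (x, f)\<close> are those for which \<open>(q/x) (x, y)\<close> lies in \<open>A\<close>. The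
  fractions \<open>P x / x\<close> of derivations \<open>P\<close> are of this kind.
\<close>

corollary exists_divisible_euler_operator:
  "\<exists>T. euler_operator T \<and> (\<forall>q a b. var_y * q = var_x * a + f * b \<longrightarrow>
    (\<forall>m\<in>carrier M. \<exists>n\<in>carrier M. q \<cdot> T m = var_x \<cdot> n))"
proof -
  obtain T where T: "euler_operator T" "\<And>m. m \<in> carrier M \<Longrightarrow> var_y ^ N \<cdot> T m \<in> xM"
    using exists_good_euler_operator by blast
  have "\<exists>n\<in>carrier M. q \<cdot> T m = var_x \<cdot> n"
    if "var_y * q = var_x * a + f * b" "m \<in> carrier M" for q a b m
  proof -
    have "q \<cdot> T m \<in> xM"
      by (rule act_in_xM_of_socle[OF that(1) euler_operatorD(1)[OF T(1) that(2)] T(2)[OF that(2)]])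
    then show ?thesis by (auto simp: xM_def)
  qed
  with T(1) show ?thesis by blast
qed

end

section \<open>Connections from a weight operator\<close>

text \<open>
  Here \<open>e\<close> plays the Euler derivation and \<open>T\<close> its covariant derivative. A derivation \<open>P\<close> is the multiple
  \<open>h e\<close> of \<open>e\<close> by the fraction \<open>h = P Z / W\<close>, with \<open>W = e Z\<close>, so the connection has to be \<open>h T\<close>; by
  hypothesis this preserves \<open>M\<close>. It is integrable because \<open>[h T, h' T] = (h e(h') - h' e(h)) T\<close>, and
  \<open>h e(h') - h' e(h)\<close> is the fraction belonging to the bracket.
\<close>

lemma integrable_graded_connection_of_operator:
  fixes R :: "('a, 'b) ring_scheme" (structure) and M :: "('a, 'c) module" and \<iota> :: "'k \<Rightarrow> 'a" and e :: "'a \<Rightarrow> 'a" and Z W :: 'a and T :: "'c \<Rightarrow> 'c"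
    and gA :: "int \<Rightarrow> 'a set" and gM :: "int \<Rightarrow> 'c set" and wZ :: int
  assumes module: "module R M" and \<iota>: "\<And>c. \<iota> c \<in> carrier R" and Z: "Z \<in> carrier R"
    and W: "W = \<iota> c0 \<otimes> Z" "e Z = W"
    and W_inj: "\<And>m. m \<in> carrier M \<Longrightarrow> W \<odot>\<^bsub>M\<^esub> m = \<zero>\<^bsub>M\<^esub> \<Longrightarrow> m = \<zero>\<^bsub>M\<^esub>"
    and e: "\<And>a. a \<in> carrier R \<Longrightarrow> e a \<in> carrier R" "\<And>c. e (\<iota> c) = \<zero>"
    and T_closed: "\<And>m. m \<in> carrier M \<Longrightarrow> T m \<in> carrier M"
    and T_add: "\<And>m n. m \<in> carrier M \<Longrightarrow> n \<in> carrier M \<Longrightarrow> T (m \<oplus>\<^bsub>M\<^esub> n) = T m \<oplus>\<^bsub>M\<^esub> T n"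
    and T_smult: "\<And>a m. a \<in> carrier R \<Longrightarrow> m \<in> carrier M \<Longrightarrow>
      T (a \<odot>\<^bsub>M\<^esub> m) = a \<odot>\<^bsub>M\<^esub> T m \<oplus>\<^bsub>M\<^esub> e a \<odot>\<^bsub>M\<^esub> m"
    and parallel: "\<And>P a. P \<in> Der \<iota> R \<Longrightarrow> a \<in> carrier R \<Longrightarrow> W \<otimes> P a = P Z \<otimes> e a"
    and divisible: "\<And>P m. P \<in> Der \<iota> R \<Longrightarrow> m \<in> carrier M \<Longrightarrow>
      \<exists>n\<in>carrier M. W \<odot>\<^bsub>M\<^esub> n = P Z \<odot>\<^bsub>M\<^esub> T m"
    and gM: "\<And>w. gM w \<subseteq> carrier M" "\<And>v w a m. a \<in> gA v \<Longrightarrow> m \<in> gM w \<Longrightarrow> a \<odot>\<^bsub>M\<^esub> m \<in> gM (v + w)"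
    and Z_weight: "Z \<in> gA wZ" and T_graded: "\<And>w m. m \<in> gM w \<Longrightarrow> T m \<in> gM w"
    and W_graded: "\<And>w m. m \<in> carrier M \<Longrightarrow> W \<odot>\<^bsub>M\<^esub> m \<in> gM (wZ + w) \<Longrightarrow> m \<in> gM w"
  shows "\<exists>D. integrable_connection \<iota> R M D \<and> graded_connection \<iota> R gA M gM D"
proof -
  interpret module R M by (rule module)
  define D where "D P = (\<lambda>m\<in>carrier M. THE n. n \<in> carrier M \<and> W \<odot>\<^bsub>M\<^esub> n = P Z \<odot>\<^bsub>M\<^esub> T m)" for P
  have Wc: "W \<in> carrier R" using \<iota> Z W by simp
  have W_cancel: "m = n" if "m \<in> carrier M" "n \<in> carrier M" "W \<odot>\<^bsub>M\<^esub> m = W \<odot>\<^bsub>M\<^esub> n" for m n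
  proof -
    have "W \<odot>\<^bsub>M\<^esub> (m \<ominus>\<^bsub>M\<^esub> n) = \<zero>\<^bsub>M\<^esub>"
      using that Wc by (simp add: M.minus_eq smult_r_distr smult_r_minus M.r_neg)
    then have "m \<ominus>\<^bsub>M\<^esub> n = \<zero>\<^bsub>M\<^esub>" using W_inj that by simp
    moreover have "m = (m \<ominus>\<^bsub>M\<^esub> n) \<oplus>\<^bsub>M\<^esub> n" using that by (simp add: M.minus_eq M.a_assoc M.l_neg)
    ultimately show ?thesis using that by simp
  qed
  have D_eqI: "D P m = n" if "m \<in> carrier M" "n \<in> carrier M" "W \<odot>\<^bsub>M\<^esub> n = P Z \<odot>\<^bsub>M\<^esub> T m" for P m n
    unfolding D_def using that W_cancel by (auto intro!: the_equality)
  have D_closed: "D P m \<in> carrier M" and D: "W \<odot>\<^bsub>M\<^esub> D P m = P Z \<odot>\<^bsub>M\<^esub> T m"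
    if "P \<in> Der \<iota> R" "m \<in> carrier M" for P m
    using divisible[OF that] D_eqI that(2) by metis+
  have P_closed: "P a \<in> carrier R" if "P \<in> Der \<iota> R" "a \<in> carrier R" for P a
    using that by (auto simp: Der_def)
  have leibniz: "D P (a \<odot>\<^bsub>M\<^esub> m) = a \<odot>\<^bsub>M\<^esub> D P m \<oplus>\<^bsub>M\<^esub> P a \<odot>\<^bsub>M\<^esub> m"
    if P: "P \<in> Der \<iota> R" and a: "a \<in> carrier R" and m: "m \<in> carrier M" for P a m
  proof (rule D_eqI)
    have "W \<odot>\<^bsub>M\<^esub> (a \<odot>\<^bsub>M\<^esub> D P m \<oplus>\<^bsub>M\<^esub> P a \<odot>\<^bsub>M\<^esub> m)
        = a \<odot>\<^bsub>M\<^esub> (W \<odot>\<^bsub>M\<^esub> D P m) \<oplus>\<^bsub>M\<^esub> (W \<otimes> P a) \<odot>\<^bsub>M\<^esub> m"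
      using that Wc P_closed D_closed
      by (simp add: smult_r_distr smult_assoc1[symmetric] R.m_comm)
    also have "\<dots> = P Z \<odot>\<^bsub>M\<^esub> T (a \<odot>\<^bsub>M\<^esub> m)"
      using that Z e(1) P_closed[OF P] T_closed
      by (simp add: D parallel T_smult smult_r_distr smult_assoc1[symmetric] R.m_comm)
    finally show "W \<odot>\<^bsub>M\<^esub> (a \<odot>\<^bsub>M\<^esub> D P m \<oplus>\<^bsub>M\<^esub> P a \<odot>\<^bsub>M\<^esub> m) = P Z \<odot>\<^bsub>M\<^esub> T (a \<odot>\<^bsub>M\<^esub> m)" .
  qed (use that P_closed D_closed in auto)
  have D_add: "D P (m \<oplus>\<^bsub>M\<^esub> n) = D P m \<oplus>\<^bsub>M\<^esub> D P n"
    if "P \<in> Der \<iota> R" "m \<in> carrier M" "n \<in> carrier M" for P m n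
    using that Wc Z P_closed T_closed D_closed
    by (intro D_eqI) (simp_all add: smult_r_distr D T_add)
  have D_const: "D P (\<iota> c \<odot>\<^bsub>M\<^esub> m) = \<iota> c \<odot>\<^bsub>M\<^esub> D P m" if "P \<in> Der \<iota> R" "m \<in> carrier M" for P c m
  proof (rule D_eqI)
    have "W \<odot>\<^bsub>M\<^esub> (\<iota> c \<odot>\<^bsub>M\<^esub> D P m) = \<iota> c \<odot>\<^bsub>M\<^esub> (W \<odot>\<^bsub>M\<^esub> D P m)"
      using that Wc \<iota> D_closed by (simp add: smult_assoc1[symmetric] R.m_comm)
    also have "\<dots> = P Z \<odot>\<^bsub>M\<^esub> T (\<iota> c \<odot>\<^bsub>M\<^esub> m)"
      using that Z \<iota> T_closed P_closed
      by (simp add: D T_smult e(2) smult_assoc1[symmetric] R.m_comm)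
    finally show "W \<odot>\<^bsub>M\<^esub> (\<iota> c \<odot>\<^bsub>M\<^esub> D P m) = P Z \<odot>\<^bsub>M\<^esub> T (\<iota> c \<odot>\<^bsub>M\<^esub> m)" .
  qed (use that \<iota> D_closed in auto)
  have conn: "connection \<iota> R M D"
    unfolding connection_def
  proof (intro conjI ballI)
    show "D \<in> Der \<iota> R \<rightarrow> End_k \<iota> M"
      unfolding End_k_def using D_closed D_add D_const by (auto simp: D_def)
    show "D (der_add R P Q) m = D P m \<oplus>\<^bsub>M\<^esub> D Q m"
      if "P \<in> Der \<iota> R" "Q \<in> Der \<iota> R" "m \<in> carrier M" for P Q m
      using that Wc Z P_closed T_closed D_closed
      by (intro D_eqI) (simp_all add: der_add_def smult_r_distr smult_l_distr D)
    show "D (der_smult R a P) m = a \<odot>\<^bsub>M\<^esub> D P m"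
      if "a \<in> carrier R" "P \<in> Der \<iota> R" "m \<in> carrier M" for a P m
    proof (rule D_eqI)
      have "W \<odot>\<^bsub>M\<^esub> (a \<odot>\<^bsub>M\<^esub> D P m) = a \<odot>\<^bsub>M\<^esub> (W \<odot>\<^bsub>M\<^esub> D P m)"
        using that Wc D_closed by (simp add: smult_assoc1[symmetric] R.m_comm)
      then show "W \<odot>\<^bsub>M\<^esub> (a \<odot>\<^bsub>M\<^esub> D P m) = der_smult R a P Z \<odot>\<^bsub>M\<^esub> T m"
        using that Z P_closed T_closed by (simp add: der_smult_def D smult_assoc1)
    qed (use that D_closed in auto)
  qed (rule leibniz)
  \<comment> \<open>Multiplying by \<open>W\<close> twice clears the denominators of both connections in the composition.\<close>
  have square: "W \<odot>\<^bsub>M\<^esub> (W \<odot>\<^bsub>M\<^esub> D P (D Q m)) =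
      (W \<otimes> P (Q Z)) \<odot>\<^bsub>M\<^esub> T m \<oplus>\<^bsub>M\<^esub> ((P Z \<otimes> Q Z) \<odot>\<^bsub>M\<^esub> T (T m) \<ominus>\<^bsub>M\<^esub> (\<iota> c0 \<otimes> (P Z \<otimes> Q Z)) \<odot>\<^bsub>M\<^esub> T m)"
    if P: "P \<in> Der \<iota> R" and Q: "Q \<in> Der \<iota> R" and m: "m \<in> carrier M" for P Q m
  proof -
    have c: "P Z \<in> carrier R" "Q Z \<in> carrier R" "P (Q Z) \<in> carrier R" "\<iota> c0 \<in> carrier R"
        "P W \<in> carrier R" "D Q m \<in> carrier M" "D P (D Q m) \<in> carrier M" "T m \<in> carrier M"
        "T (T m) \<in> carrier M" "D P (T m) \<in> carrier M"
      using that Z Wc P_closed \<iota> T_closed D_closed by simp_all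
    have PW: "P W = \<iota> c0 \<otimes> P Z" using P Z unfolding W(1) by (simp add: Der_def)
    have "W \<odot>\<^bsub>M\<^esub> D P (D Q m) \<oplus>\<^bsub>M\<^esub> P W \<odot>\<^bsub>M\<^esub> D Q m = D P (W \<odot>\<^bsub>M\<^esub> D Q m)"
      using leibniz[OF P Wc c(6)] by simp
    also have "\<dots> = Q Z \<odot>\<^bsub>M\<^esub> D P (T m) \<oplus>\<^bsub>M\<^esub> P (Q Z) \<odot>\<^bsub>M\<^esub> T m"
      by (simp add: D[OF Q m] leibniz[OF P c(2) c(8)])
    finally have "W \<odot>\<^bsub>M\<^esub> (W \<odot>\<^bsub>M\<^esub> D P (D Q m) \<oplus>\<^bsub>M\<^esub> P W \<odot>\<^bsub>M\<^esub> D Q m)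
        = W \<odot>\<^bsub>M\<^esub> (Q Z \<odot>\<^bsub>M\<^esub> D P (T m) \<oplus>\<^bsub>M\<^esub> P (Q Z) \<odot>\<^bsub>M\<^esub> T m)" by simp
    then have "W \<odot>\<^bsub>M\<^esub> (W \<odot>\<^bsub>M\<^esub> D P (D Q m)) \<oplus>\<^bsub>M\<^esub> P W \<odot>\<^bsub>M\<^esub> (W \<odot>\<^bsub>M\<^esub> D Q m)
        = Q Z \<odot>\<^bsub>M\<^esub> (W \<odot>\<^bsub>M\<^esub> D P (T m)) \<oplus>\<^bsub>M\<^esub> (W \<otimes> P (Q Z)) \<odot>\<^bsub>M\<^esub> T m"
      using c Wc by (simp add: smult_r_distr smult_assoc1[symmetric] R.m_comm)
    moreover have "P W \<odot>\<^bsub>M\<^esub> (W \<odot>\<^bsub>M\<^esub> D Q m) = (\<iota> c0 \<otimes> (P Z \<otimes> Q Z)) \<odot>\<^bsub>M\<^esub> T m"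
      using c by (simp add: D[OF Q m] PW smult_assoc1[symmetric] R.m_assoc)
    moreover have "Q Z \<odot>\<^bsub>M\<^esub> (W \<odot>\<^bsub>M\<^esub> D P (T m)) = (P Z \<otimes> Q Z) \<odot>\<^bsub>M\<^esub> T (T m)"
      using c by (simp add: D[OF P] smult_assoc1[symmetric] R.m_comm)
    ultimately have eq: "W \<odot>\<^bsub>M\<^esub> (W \<odot>\<^bsub>M\<^esub> D P (D Q m)) \<oplus>\<^bsub>M\<^esub> (\<iota> c0 \<otimes> (P Z \<otimes> Q Z)) \<odot>\<^bsub>M\<^esub> T m
        = (P Z \<otimes> Q Z) \<odot>\<^bsub>M\<^esub> T (T m) \<oplus>\<^bsub>M\<^esub> (W \<otimes> P (Q Z)) \<odot>\<^bsub>M\<^esub> T m" by simp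
    have "W \<odot>\<^bsub>M\<^esub> (W \<odot>\<^bsub>M\<^esub> D P (D Q m))
        = (W \<odot>\<^bsub>M\<^esub> (W \<odot>\<^bsub>M\<^esub> D P (D Q m)) \<oplus>\<^bsub>M\<^esub> (\<iota> c0 \<otimes> (P Z \<otimes> Q Z)) \<odot>\<^bsub>M\<^esub> T m)
          \<ominus>\<^bsub>M\<^esub> (\<iota> c0 \<otimes> (P Z \<otimes> Q Z)) \<odot>\<^bsub>M\<^esub> T m"
      using c Wc by (simp add: M.minus_eq M.a_assoc M.r_neg)
    also have "\<dots> = (W \<otimes> P (Q Z)) \<odot>\<^bsub>M\<^esub> T m \<oplus>\<^bsub>M\<^esub>
        ((P Z \<otimes> Q Z) \<odot>\<^bsub>M\<^esub> T (T m) \<ominus>\<^bsub>M\<^esub> (\<iota> c0 \<otimes> (P Z \<otimes> Q Z)) \<odot>\<^bsub>M\<^esub> T m)"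
      unfolding eq using c Wc by (simp add: M.minus_eq M.a_ac)
    finally show ?thesis .
  qed
  have bracket: "D (der_bracket R P Q) m = D P (D Q m) \<ominus>\<^bsub>M\<^esub> D Q (D P m)"
    if P: "P \<in> Der \<iota> R" and Q: "Q \<in> Der \<iota> R" and m: "m \<in> carrier M" for P Q m
  proof (rule D_eqI)
    have c: "P Z \<in> carrier R" "Q Z \<in> carrier R" "P (Q Z) \<in> carrier R" "Q (P Z) \<in> carrier R"
        "\<iota> c0 \<in> carrier R" "T m \<in> carrier M" "T (T m) \<in> carrier M"
        "D P (D Q m) \<in> carrier M" "D Q (D P m) \<in> carrier M"
      using that Z P_closed \<iota> T_closed D_closed by simp_all
    define B where "B = (P Z \<otimes> Q Z) \<odot>\<^bsub>M\<^esub> T (T m) \<ominus>\<^bsub>M\<^esub> (\<iota> c0 \<otimes> (P Z \<otimes> Q Z)) \<odot>\<^bsub>M\<^esub> T m"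
    have Bc: "B \<in> carrier M" using c by (simp add: B_def)
    have "W \<odot>\<^bsub>M\<^esub> (W \<odot>\<^bsub>M\<^esub> (D P (D Q m) \<ominus>\<^bsub>M\<^esub> D Q (D P m)))
        = W \<odot>\<^bsub>M\<^esub> (W \<odot>\<^bsub>M\<^esub> D P (D Q m)) \<ominus>\<^bsub>M\<^esub> W \<odot>\<^bsub>M\<^esub> (W \<odot>\<^bsub>M\<^esub> D Q (D P m))"
      using c Wc by (simp add: M.minus_eq smult_r_distr smult_r_minus)
    also have "\<dots> = ((W \<otimes> P (Q Z)) \<odot>\<^bsub>M\<^esub> T m \<oplus>\<^bsub>M\<^esub> B) \<ominus>\<^bsub>M\<^esub> ((W \<otimes> Q (P Z)) \<odot>\<^bsub>M\<^esub> T m \<oplus>\<^bsub>M\<^esub> B)"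
      unfolding square[OF P Q m] square[OF Q P m] B_def R.m_comm[OF c(1,2)] ..
    also have "\<dots> = (W \<otimes> P (Q Z)) \<odot>\<^bsub>M\<^esub> T m \<ominus>\<^bsub>M\<^esub> (W \<otimes> Q (P Z)) \<odot>\<^bsub>M\<^esub> T m \<oplus>\<^bsub>M\<^esub> (B \<ominus>\<^bsub>M\<^esub> B)"
      using c Wc Bc by (simp add: M.minus_eq M.minus_add M.a_ac)
    also have "\<dots> = W \<odot>\<^bsub>M\<^esub> (der_bracket R P Q Z \<odot>\<^bsub>M\<^esub> T m)"
      using c Wc Bc Z
      by (simp add: M.minus_eq M.r_neg der_bracket_def R.minus_eq smult_l_distr smult_l_minus
          smult_r_distr smult_r_minus smult_assoc1)
    finally have eq: "W \<odot>\<^bsub>M\<^esub> (W \<odot>\<^bsub>M\<^esub> (D P (D Q m) \<ominus>\<^bsub>M\<^esub> D Q (D P m)))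
      = W \<odot>\<^bsub>M\<^esub> (der_bracket R P Q Z \<odot>\<^bsub>M\<^esub> T m)" .
    show "W \<odot>\<^bsub>M\<^esub> (D P (D Q m) \<ominus>\<^bsub>M\<^esub> D Q (D P m)) = der_bracket R P Q Z \<odot>\<^bsub>M\<^esub> T m"
      by (rule W_cancel[OF _ _ eq]) (use c Wc Z in \<open>simp_all add: der_bracket_def\<close>)
  qed (use that D_closed in auto)
  have graded: "D P m \<in> gM (w + l)"
    if P: "homogeneous_derivation \<iota> R gA l P" and m: "m \<in> gM w" for P l w m
  proof (rule W_graded)
    have PD: "P \<in> Der \<iota> R" and "P Z \<in> gA (wZ + l)"
      using P Z_weight by (auto simp: homogeneous_derivation_def)
    moreover have mc: "m \<in> carrier M" using m gM(1) by blast
    ultimately have "W \<odot>\<^bsub>M\<^esub> D P m \<in> gM (wZ + l + w)"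
      using gM(2)[of "P Z" "wZ + l" "T m" w] T_graded[OF m] by (simp only: D)
    then show "W \<odot>\<^bsub>M\<^esub> D P m \<in> gM (wZ + (w + l))" by (simp only: ac_simps)
    show "D P m \<in> carrier M" by (rule D_closed[OF PD mc])
  qed
  from conn bracket graded show ?thesis
    unfolding integrable_connection_def graded_connection_def by (intro exI[of _ D]) auto
qed

section \<open>The coordinate ring as a quotient\<close>

context
  fixes f :: "'k::field_char_0 poly poly"
begin

abbreviation (input) "SR \<equiv> ring_of_type_algebra :: 'k poly poly ring"

lemma SR_simps:
  "carrier SR = UNIV" "x \<otimes>\<^bsub>SR\<^esub> y = x * y" "x \<oplus>\<^bsub>SR\<^esub> y = x + y" "\<one>\<^bsub>SR\<^esub> = 1" "\<zero>\<^bsub>SR\<^esub> = 0"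
  by (simp_all add: ring_of_type_algebra_def)

lemma SR_cring: "cring SR"
  by (rule cring_from_type_algebra)

lemma SR_minus: "x \<ominus>\<^bsub>SR\<^esub> y = x - y"
proof -
  interpret cring SR by (rule SR_cring)
  have "\<ominus>\<^bsub>SR\<^esub> y = - y" by (rule minus_equality) (simp_all add: SR_simps)
  then show ?thesis by (simp add: minus_eq SR_simps)
qed

lemma curve_ideal: "ideal (PIdl\<^bsub>SR\<^esub> f) SR"
  using cring.cgenideal_ideal[OF SR_cring] by (simp add: SR_simps)

lemma curve_ring_cring: "cring (curve_ring f)"
  unfolding curve_ring_def by (rule ideal.quotient_is_cring[OF curve_ideal SR_cring])

lemma curve_class_eq_iff: "curve_class f p = curve_class f q \<longleftrightarrow> f dvd p - q"
proof -
  interpret cring SR by (rule SR_cring)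
  have "curve_class f p = curve_class f q \<longleftrightarrow> p \<ominus>\<^bsub>SR\<^esub> q \<in> PIdl\<^bsub>SR\<^esub> f"
    unfolding curve_class_def by (rule quotient_eq_iff_same_a_r_cos[OF curve_ideal, symmetric]) (simp_all add: SR_simps)
  also have "\<dots> \<longleftrightarrow> f dvd p - q"
    by (auto simp: SR_minus cgenideal_def SR_simps dvd_def mult.commute)
  finally show ?thesis .
qed

lemma curve_ring_carrier: "carrier (curve_ring f) = range (curve_class f)"
  by (auto simp: curve_ring_def FactRing_def A_RCOSETS_def' SR_simps curve_class_def)

lemma curve_class_closed [simp]: "curve_class f p \<in> carrier (curve_ring f)"
  by (simp add: curve_ring_carrier)

lemma curve_class_hom:
  shows curve_class_add: "curve_class f (p + q) = curve_class f p \<oplus>\<^bsub>curve_ring f\<^esub> curve_class f q"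
    and curve_class_mult: "curve_class f (p * q) = curve_class f p \<otimes>\<^bsub>curve_ring f\<^esub> curve_class f q"
    and curve_class_one: "curve_class f 1 = \<one>\<^bsub>curve_ring f\<^esub>"
  using ideal.rcos_ring_hom[OF curve_ideal]
  by (simp_all add: ring_hom_def SR_simps curve_class_def curve_ring_def)

lemma curve_class_zero: "curve_class f 0 = \<zero>\<^bsub>curve_ring f\<^esub>"
proof -
  interpret A: cring "curve_ring f" by (rule curve_ring_cring)
  have "curve_class f 0 \<oplus>\<^bsub>curve_ring f\<^esub> curve_class f 0 = curve_class f 0 \<oplus>\<^bsub>curve_ring f\<^esub> \<zero>\<^bsub>curve_ring f\<^esub>"
    by (simp flip: curve_class_add)
  then show ?thesis by (simp only: A.add.l_cancel curve_class_closed A.zero_closed)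
qed

lemma curve_class_eq_zero_iff: "curve_class f p = \<zero>\<^bsub>curve_ring f\<^esub> \<longleftrightarrow> f dvd p"
  using curve_class_eq_iff[of p 0] by (simp add: curve_class_zero)

lemma reduced_curve_ring:
  assumes "reduced_ring (curve_ring f)" "f dvd p ^ 2"
  shows "f dvd p"
proof -
  interpret A: cring "curve_ring f" by (rule curve_ring_cring)
  have "curve_class f p [^]\<^bsub>curve_ring f\<^esub> (2::nat) = curve_class f (p ^ 2)"
    by (simp add: numeral_2_eq_2 curve_class_mult)
  also have "\<dots> = \<zero>\<^bsub>curve_ring f\<^esub>" using assms(2) by (simp add: curve_class_eq_zero_iff)
  finally show ?thesis
    using assms(1) curve_class_closed unfolding reduced_ring_def by (metis curve_class_eq_zero_iff)
qed

subsection \<open>Derivations of the coordinate ring\<close>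

text \<open>
  A derivation of \<open>A\<close> kills constants, so it is determined by its values on \<open>x\<close> and \<open>y\<close>.
\<close>

lemma derivation_lift:
  assumes P: "P \<in> Der (curve_scalar f) (curve_ring f)"
    and px: "P (curve_class f var_x) = curve_class f px" and py: "P (curve_class f var_y) = curve_class f py"
  shows "P (curve_class f p) = curve_class f (px * deriv_x p + py * deriv_y p)"
proof -
  interpret A: cring "curve_ring f" by (rule curve_ring_cring)
  have P_add: "P (curve_class f (p + q)) = P (curve_class f p) \<oplus>\<^bsub>curve_ring f\<^esub> P (curve_class f q)"
    and P_mult: "P (curve_class f (p * q)) = curve_class f p \<otimes>\<^bsub>curve_ring f\<^esub> P (curve_class f q)
      \<oplus>\<^bsub>curve_ring f\<^esub> P (curve_class f p) \<otimes>\<^bsub>curve_ring f\<^esub> curve_class f q"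
    and P_scalar: "P (curve_scalar f c \<otimes>\<^bsub>curve_ring f\<^esub> curve_class f p) =
      curve_scalar f c \<otimes>\<^bsub>curve_ring f\<^esub> P (curve_class f p)" for p q c
    using P by (simp_all add: Der_def curve_class_add curve_class_mult)
  show ?thesis
  proof (induction p rule: bivariate_induct)
    case (const c)
    have "\<exists>q. P (curve_class f 1) = curve_class f q"
      using P curve_class_closed[of 1] unfolding Der_def curve_ring_carrier by blast
    then obtain q where q: "P (curve_class f 1) = curve_class f q" by blast
    have "curve_class f q = curve_class f (1 * q + q * 1)"
      unfolding curve_class_add curve_class_mult using P_mult[of 1 1] by (simp add: q)
    then have "f dvd q" by (simp add: curve_class_eq_iff)
    then have "P (curve_class f 1) = \<zero>\<^bsub>curve_ring f\<^esub>" by (simp add: q curve_class_eq_zero_iff)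
    then have "P (curve_class f (const2 c)) = \<zero>\<^bsub>curve_ring f\<^esub>"
      using P_scalar[of c 1] by (simp add: curve_scalar_def curve_class_one)
    then show ?case by (simp add: curve_class_zero)
  next
    case (add p q)
    then show ?case
      by (simp add: P_add deriv_x_add pderiv_add distrib_left flip: curve_class_add) (simp add: algebra_simps)
  next
    case (mult p q)
    then show ?case
      by (simp add: P_mult deriv_x_mult pderiv_mult flip: curve_class_add curve_class_mult) (simp add: algebra_simps)
  qed (simp_all add: px py)
qed

text \<open>
  Euler's identity turns the condition \<open>P f = 0\<close> into \<open>u f\<^sub>x = u f\<^sub>y = 0\<close> in \<open>A\<close>, where \<open>u\<close> is the
  determinant of \<open>P\<close> and the Euler derivation; reducedness gives \<open>u = 0\<close>.
\<close>

lemma derivation_parallel_euler: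
  assumes P: "P \<in> Der (curve_scalar f) (curve_ring f)"
    and px: "P (curve_class f var_x) = curve_class f px" and py: "P (curve_class f var_y) = curve_class f py"
    and f: "f \<noteq> 0" "weighted_homogeneous wx wy d f" "reduced_ring (curve_ring f)"
  shows "f dvd of_nat wx * var_x * py - of_nat wy * var_y * px"
proof (rule jacobian_torsion_free)
  show "f dvd p ^ 2 \<Longrightarrow> f dvd p" for p by (rule reduced_curve_ring[OF f(3)])
  interpret A: cring "curve_ring f" by (rule curve_ring_cring)
  let ?X = "of_nat wx * var_x" and ?Y = "of_nat wy * var_y"
  have "P (\<zero>\<^bsub>curve_ring f\<^esub>) = \<zero>\<^bsub>curve_ring f\<^esub>"
    using derivation_lift[OF P px py, of 0] by (simp add: curve_class_zero deriv_x_def)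
  then have "f dvd px * deriv_x f + py * deriv_y f"
    using derivation_lift[OF P px py, of f] by (metis curve_class_eq_zero_iff dvd_refl)
  then obtain h where h: "px * deriv_x f + py * deriv_y f = f * h" by blast
  have E: "?X * deriv_x f + ?Y * deriv_y f = of_int d * f"
    using euler_homogeneous[OF f(2)] by (simp add: euler_def mult.assoc)
  have "(?X * py - ?Y * px) * deriv_x f
      = py * (?X * deriv_x f + ?Y * deriv_y f) - ?Y * (px * deriv_x f + py * deriv_y f)"
    by (simp add: algebra_simps)
  also have "\<dots> = f * (py * of_int d - ?Y * h)" unfolding h E by (simp add: algebra_simps)
  finally show "f dvd (?X * py - ?Y * px) * deriv_x f" by simp
  have "(?X * py - ?Y * px) * deriv_y f
      = ?X * (px * deriv_x f + py * deriv_y f) - px * (?X * deriv_x f + ?Y * deriv_y f)"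
    by (simp add: algebra_simps)
  also have "\<dots> = f * (?X * h - px * of_int d)" unfolding h E by (simp add: algebra_simps)
  finally show "f dvd (?X * py - ?Y * px) * deriv_y f" by simp
qed (rule f(1))

end

section \<open>Torsion free modules\<close>

text \<open>
  In \<open>M \<otimes> Q\<close> one has \<open>m \<otimes> 1 = m \<otimes> s (1/s) = s m \<otimes> 1/s = 0\<close>.
\<close>

lemma torsion_free_injective:
  assumes M: "module A M" and tf: "torsion_free_module A gA M"
    and s: "s \<in> homogeneous_nonzerodivisors A gA" and one: "\<one>\<^bsub>A\<^esub> \<in> homogeneous_nonzerodivisors A gA"
    and m: "m \<in> carrier M" "s \<odot>\<^bsub>M\<^esub> m = \<zero>\<^bsub>M\<^esub>"
  shows "m = \<zero>\<^bsub>M\<^esub>"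
proof -
  interpret module A M by (rule M)
  define S where "S = homogeneous_nonzerodivisors A gA"
  define Q where "Q = localization A S"
  have S_carrier: "t \<in> carrier A" if "t \<in> S" for t
    using that by (simp add: S_def homogeneous_nonzerodivisors_def)
  have S_cancel: "a = b" if "t \<in> S" "a \<in> carrier A" "b \<in> carrier A" "t \<otimes>\<^bsub>A\<^esub> a = t \<otimes>\<^bsub>A\<^esub> b" for t a b
  proof -
    have "t \<otimes>\<^bsub>A\<^esub> (a \<ominus>\<^bsub>A\<^esub> b) = \<zero>\<^bsub>A\<^esub>"
      using that S_carrier[OF that(1)] by (simp add: R.minus_eq R.r_distr R.r_minus R.r_neg)
    then have "a \<ominus>\<^bsub>A\<^esub> b = \<zero>\<^bsub>A\<^esub>"
      using that by (auto simp: S_def homogeneous_nonzerodivisors_def)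
    then show ?thesis using that by simp
  qed
  have rel: "((a, t), (b, u)) \<in> fraction_rel A S \<longleftrightarrow> u \<otimes>\<^bsub>A\<^esub> a = t \<otimes>\<^bsub>A\<^esub> b"
    if "a \<in> carrier A" "t \<in> S" "b \<in> carrier A" "u \<in> S" for a t b u
  proof
    assume "((a, t), (b, u)) \<in> fraction_rel A S"
    then obtain v where v: "v \<in> S" "v \<otimes>\<^bsub>A\<^esub> (u \<otimes>\<^bsub>A\<^esub> a) = v \<otimes>\<^bsub>A\<^esub> (t \<otimes>\<^bsub>A\<^esub> b)"
      by (auto simp: fraction_rel_def)
    show "u \<otimes>\<^bsub>A\<^esub> a = t \<otimes>\<^bsub>A\<^esub> b" by (rule S_cancel[OF v(1) _ _ v(2)]) (use that S_carrier in auto)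
  next
    assume "u \<otimes>\<^bsub>A\<^esub> a = t \<otimes>\<^bsub>A\<^esub> b"
    then show "((a, t), (b, u)) \<in> fraction_rel A S" using that by (auto simp: fraction_rel_def)
  qed
  have rel_S: "a \<in> carrier A \<and> t \<in> S \<and> b \<in> carrier A \<and> u \<in> S" if "((a, t), (b, u)) \<in> fraction_rel A S" for a t b u
    using that by (simp add: fraction_rel_def)
  have s1: "s \<in> S" "\<one>\<^bsub>A\<^esub> \<in> S" using s one by (simp_all add: S_def)
  \<comment> \<open>Denominators cancel, so the fraction 1 consists of the pairs on the diagonal.\<close>
  have unit_class: "fraction_rel A S `` {(t, t)} = {(b, b) | b. b \<in> S}" if t: "t \<in> S" for t
  proof (rule equalityI; rule subsetI)
    fix x assume "x \<in> fraction_rel A S `` {(t, t)}"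
    then obtain b u where x: "x = (b, u)" "((t, t), (b, u)) \<in> fraction_rel A S" by (cases x) auto
    with rel_S[OF x(2)] have "u \<otimes>\<^bsub>A\<^esub> t = t \<otimes>\<^bsub>A\<^esub> b" using rel by blast
    then have eq: "t \<otimes>\<^bsub>A\<^esub> u = t \<otimes>\<^bsub>A\<^esub> b"
      using rel_S[OF x(2)] S_carrier by (simp add: R.m_comm)
    have "u = b" by (rule S_cancel[OF t _ _ eq]) (use rel_S[OF x(2)] S_carrier in auto)
    then show "x \<in> {(b, b) | b. b \<in> S}" using x rel_S[OF x(2)] by auto
  next
    fix x assume "x \<in> {(b, b) | b. b \<in> S}"
    then obtain b where b: "x = (b, b)" "b \<in> S" by blast
    then have "((t, t), (b, b)) \<in> fraction_rel A S"
      using t S_carrier rel[of t t b b] R.m_comm[of b t] by blast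
    then show "x \<in> fraction_rel A S `` {(t, t)}" using b by blast
  qed
  define q where "q = fraction_rel A S `` {(\<one>\<^bsub>A\<^esub>, s)}"
  have Q_one: "\<one>\<^bsub>Q\<^esub> = {(b, b) | b. b \<in> S}"
    using unit_class[OF s1(2)] by (simp add: Q_def localization_def)
  have q: "q \<in> carrier Q"
    using s1 by (auto simp: Q_def localization_def q_def intro!: quotientI)
  have Q1: "\<one>\<^bsub>Q\<^esub> \<in> carrier Q"
    using s1 by (auto simp: Q_def localization_def intro!: quotientI)
  \<comment> \<open>\<open>q\<close> is the fraction \<open>1/s\<close>.\<close>
  have sq: "s \<odot>\<^bsub>Q\<^esub> q = \<one>\<^bsub>Q\<^esub>"
  proof -
    have mem: "fraction_rel A S `` {(s \<otimes>\<^bsub>A\<^esub> a, t)} = {(b, b) | b. b \<in> S}" if "(a, t) \<in> q" for a t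
    proof -
      have r: "((\<one>\<^bsub>A\<^esub>, s), (a, t)) \<in> fraction_rel A S" using that by (simp add: q_def)
      from rel_S[OF r] have "t \<otimes>\<^bsub>A\<^esub> \<one>\<^bsub>A\<^esub> = s \<otimes>\<^bsub>A\<^esub> a" using rel r by blast
      then have "s \<otimes>\<^bsub>A\<^esub> a = t" using rel_S[OF r] S_carrier by simp
      then show ?thesis using unit_class rel_S[OF r] by simp
    qed
    have "(\<one>\<^bsub>A\<^esub>, s) \<in> q" using s1 S_carrier by (simp add: q_def rel)
    then have "(\<Union>(a, t)\<in>q. fraction_rel A S `` {(s \<otimes>\<^bsub>A\<^esub> a, t)}) = {(b, b) | b. b \<in> S}"
      by (rule UN_constant_eq) (use mem in \<open>clarsimp split: prod.splits\<close>)
    then show ?thesis by (simp add: Q_one) (simp add: Q_def localization_def)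
  qed
  define F where "F = free_Abelian_group (carrier M \<times> carrier Q)"
  define K where "K = tensor_kernel A M Q"
  have sc: "s \<in> carrier A" using S_carrier s1 by simp
  have K_add: "x + y \<in> K" if "x \<in> K" "y \<in> K" for x y
    using generate.eng[OF that[unfolded K_def tensor_kernel_def]] by (simp add: K_def tensor_kernel_def)
  have K_rel: "frag_of (s \<odot>\<^bsub>M\<^esub> n, q) - frag_of (n, \<one>\<^bsub>Q\<^esub>) \<in> K"
    "frag_of (n, \<one>\<^bsub>Q\<^esub>) - frag_of (s \<odot>\<^bsub>M\<^esub> n, q) \<in> K" if n: "n \<in> carrier M" for n
  proof -
    let ?r = "frag_of (s \<odot>\<^bsub>M\<^esub> n, q) - frag_of (n, \<one>\<^bsub>Q\<^esub>)"
    have r: "?r \<in> tensor_relations A M Q"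
      unfolding tensor_relations_def sq[symmetric] using n q sc by blast
    have "?r \<in> carrier (free_Abelian_group (carrier M \<times> carrier Q))"
      using n q Q1 sc keys_diff[of "frag_of (s \<odot>\<^bsub>M\<^esub> n, q)" "frag_of (n, \<one>\<^bsub>Q\<^esub>)"] by auto
    then have "inv\<^bsub>free_Abelian_group (carrier M \<times> carrier Q)\<^esub> ?r = - ?r"
      by (intro inv_free_Abelian_group) simp
    then show "?r \<in> K" "frag_of (n, \<one>\<^bsub>Q\<^esub>) - frag_of (s \<odot>\<^bsub>M\<^esub> n, q) \<in> K"
      using generate.incl[OF r] generate.inv[OF r, of "free_Abelian_group (carrier M \<times> carrier Q)"] by (simp_all add: K_def tensor_kernel_def)
  qed
  have "frag_of (m, \<one>\<^bsub>Q\<^esub>) - frag_of (\<zero>\<^bsub>M\<^esub>, q) \<in> K" "frag_of (\<zero>\<^bsub>M\<^esub>, q) - frag_of (m, \<one>\<^bsub>Q\<^esub>) \<in> K"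
    "frag_of (\<zero>\<^bsub>M\<^esub>, \<one>\<^bsub>Q\<^esub>) - frag_of (\<zero>\<^bsub>M\<^esub>, q) \<in> K" "frag_of (\<zero>\<^bsub>M\<^esub>, q) - frag_of (\<zero>\<^bsub>M\<^esub>, \<one>\<^bsub>Q\<^esub>) \<in> K"
    using K_rel[OF m(1)] K_rel[OF M.zero_closed] sc by (simp_all add: m(2))
  from K_add[OF this(1,4)] K_add[OF this(3,2)]
  have diff: "frag_of (m, \<one>\<^bsub>Q\<^esub>) - frag_of (\<zero>\<^bsub>M\<^esub>, \<one>\<^bsub>Q\<^esub>) \<in> K" "frag_of (\<zero>\<^bsub>M\<^esub>, \<one>\<^bsub>Q\<^esub>) - frag_of (m, \<one>\<^bsub>Q\<^esub>) \<in> K"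
    by simp_all
  have coset: "K #>\<^bsub>F\<^esub> x \<subseteq> K #>\<^bsub>F\<^esub> y" if "x - y \<in> K" for x y
  proof
    fix z assume "z \<in> K #>\<^bsub>F\<^esub> x"
    then obtain k where k: "k \<in> K" "z = k + x" by (auto simp: r_coset_def F_def)
    then have "k + (x - y) \<in> K" "z = (k + (x - y)) + y" using K_add that by simp_all
    then show "z \<in> K #>\<^bsub>F\<^esub> y" unfolding r_coset_def F_def by fastforce
  qed
  have "pure_tensor A M Q m \<one>\<^bsub>Q\<^esub> = pure_tensor A M Q \<zero>\<^bsub>M\<^esub> \<one>\<^bsub>Q\<^esub>"
    unfolding pure_tensor_def K_def[symmetric] F_def[symmetric]
    by (rule equalityI) (rule coset[OF diff(1)], rule coset[OF diff(2)])
  then show ?thesis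
    using tf m(1) inj_onD[of "\<lambda>m. pure_tensor A M Q m \<one>\<^bsub>Q\<^esub>" "carrier M" m "\<zero>\<^bsub>M\<^esub>"]
    unfolding torsion_free_module_def Let_def Q_def S_def by simp
qed


section \<open>Existence of connections\<close>

lemma coeff2_monomial:
  "coeff2 (var_x ^ a * var_y ^ b :: 'k::comm_ring_1 poly poly) i j = (if i = a \<and> j = b then 1 else 0)"
  using coeff2_var_y_power_mult[where p = "1 :: 'k poly poly" and n = b and i = "i - a" and j = j]
  by (auto simp: coeff2_var_x_power_mult one_pCons coeff_pCons split: nat.split)

text \<open>
  If \<open>f\<close> contains no pure power of \<open>y\<close>, then \<open>x\<close> divides \<open>f\<close>; an irreducible \<open>f\<close> is then a multiple of
  \<open>x\<close>. Among the simple singularities the equation of \<open>E\<^sub>7\<close> is the one without a pure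
  power of \<open>y\<close>; it contains \<open>x^3\<close>.
\<close>

lemma exists_pure_power:
  fixes f :: "'k::field_char_0 poly poly"
  assumes "Factorial_Ring.irreducible f \<or> simple_curve_singularity f"
  shows "\<exists>n. coeff2 f 0 n \<noteq> 0 \<or> coeff2 f n 0 \<noteq> 0"
  using assms
proof
  assume irr: "Factorial_Ring.irreducible f"
  show ?thesis
  proof (cases "at_x0 f = 0")
    case True
    then obtain g where g: "f = var_x * g" using at_x0_eq_0_imp_dvd by blast
    have "\<not> (var_x :: 'k poly poly) dvd 1"
    proof
      assume "(var_x :: 'k poly poly) dvd 1"
      then obtain h :: "'k poly poly" where "1 = var_x * h" by blast
      then have "coeff2 (1 :: 'k poly poly) 0 0 = coeff2 (var_x * h) 0 0" by simp
      then show False by (simp add: coeff2_var_x_mult)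
    qed
    then have "g dvd 1" using irreducibleD[OF irr g] by blast
    then obtain c where "g = const2 c" by (auto simp: is_unit_poly_iff)
    moreover from this g irr have "c \<noteq> 0" by auto
    ultimately have "coeff2 f 1 0 \<noteq> 0" by (simp add: g coeff2_var_x)
    then show ?thesis by blast
  next
    case False
    then obtain n where "poly.coeff (at_x0 f) n \<noteq> 0" using poly_eqI by (metis coeff_0)
    then show ?thesis by auto
  qed
next
  have mono: "coeff2 (var_y ^ b :: 'k poly poly) i j = (if i = 0 \<and> j = b then 1 else 0)"
    "coeff2 (var_x ^ a :: 'k poly poly) i j = (if i = a \<and> j = 0 then 1 else 0)"
    "coeff2 (var_x * var_y ^ b :: 'k poly poly) i j = (if i = 1 \<and> j = b then 1 else 0)"
    "coeff2 (var_x ^ a * var_y :: 'k poly poly) i j = (if i = a \<and> j = 1 then 1 else 0)" for a b i j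
    using coeff2_monomial[where a = 0 and b = b and i = i and j = j and 'k='k]
      coeff2_monomial[where a = a and b = 0 and i = i and j = j and 'k='k]
      coeff2_monomial[where a = 1 and b = b and i = i and j = j and 'k='k]
      coeff2_monomial[where a = a and b = 1 and i = i and j = j and 'k='k] by simp_all
  assume "simple_curve_singularity f"
  then consider n where "n \<ge> 1" "f = var_x ^ 2 + var_y ^ (n + 1)"
    | n where "n \<ge> 4" "f = var_x ^ 2 * var_y + var_y ^ (n - 1)"
    | "f = var_x ^ 3 + var_y ^ 4" | "f = var_x ^ 3 + var_x * var_y ^ 3" | "f = var_x ^ 3 + var_y ^ 5"
    unfolding simple_curve_singularity_def by blast
  then show ?thesis
  proof cases
    case (1 n)
    have "coeff2 f 0 (n + 1) \<noteq> 0" unfolding 1(2) coeff_add mono by simp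
    then show ?thesis by blast
  next
    case (2 n)
    have "coeff2 f 0 (n - 1) \<noteq> 0" unfolding 2(2) coeff_add mono using 2(1) by simp
    then show ?thesis by blast
  next
    case 3
    have "coeff2 f 0 4 \<noteq> 0" unfolding 3 coeff_add mono by simp
    then show ?thesis by blast
  next
    case 4
    have "coeff2 f 3 0 \<noteq> 0" unfolding 4 coeff_add mono by simp
    then show ?thesis by blast
  next
    case 5
    have "coeff2 f 0 5 \<noteq> 0" unfolding 5 coeff_add mono by simp
    then show ?thesis by blast
  qed
qed

text \<open>
  If \<open>x p = f q\<close>, then \<open>f q\<close> vanishes on the line \<open>x = 0\<close>, and \<open>f\<close> does not.
\<close>

lemma var_x_nonzerodivisor:
  fixes f :: "'k::field poly poly"
  assumes "coeff2 f 0 n \<noteq> 0" "f dvd var_x * p"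
  shows "f dvd p"
proof -
  obtain q where q: "var_x * p = f * q" using assms(2) by blast
  then have "at_x0 f * at_x0 q = at_x0 (var_x * p)" by (simp only: at_x0_mult)
  also have "\<dots> = 0" by simp
  finally have "at_x0 f * at_x0 q = 0" .
  moreover have "at_x0 f \<noteq> 0" using assms(1) by (metis coeff_at_x0 coeff_0)
  ultimately obtain q' where "q = var_x * q'" using at_x0_eq_0_imp_dvd by auto
  then have "var_x * p = var_x * (f * q')" using q by (simp add: mult.left_commute)
  then have "p = f * q'" by (simp only: mult_cancel_left var_x_nonzero) simp
  then show ?thesis by simp
qed

lemma var_y_nonzerodivisor:
  fixes f :: "'k::field poly poly"
  assumes "coeff2 f n 0 \<noteq> 0" "f dvd var_y * p"
  shows "f dvd p"
proof -
  have "swap_vars f dvd var_x * swap_vars p"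
    using swap_vars_dvd[OF assms(2)] by (simp add: swap_vars_mult)
  moreover have "coeff2 (swap_vars f) 0 n \<noteq> 0" using assms(1) by simp
  ultimately have "swap_vars f dvd swap_vars p" using var_x_nonzerodivisor by blast
  from swap_vars_dvd[OF this] show ?thesis by simp
qed

lemma homogeneous_nonzerodivisorI:
  fixes f :: "'k::field_char_0 poly poly"
  assumes "weighted_homogeneous wx wy w p" "\<And>q. f dvd p * q \<Longrightarrow> f dvd q"
  shows "curve_class f p \<in> homogeneous_nonzerodivisors (curve_ring f) (curve_grading wx wy f)"
  unfolding homogeneous_nonzerodivisors_def mem_Collect_eq
proof (intro conjI ballI impI)
  show "\<exists>w. curve_class f p \<in> curve_grading wx wy f w"
    using assms(1) by (auto simp: curve_grading_def)
next
  fix a assume "a \<in> carrier (curve_ring f)" and z: "curve_class f p \<otimes>\<^bsub>curve_ring f\<^esub> a = \<zero>\<^bsub>curve_ring f\<^esub>"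
  then obtain q where q: "a = curve_class f q" by (auto simp: curve_ring_carrier)
  with z have "curve_class f (p * q) = \<zero>\<^bsub>curve_ring f\<^esub>" by (simp add: curve_class_mult)
  then have "f dvd p * q" by (simp only: curve_class_eq_zero_iff)
  then show "a = \<zero>\<^bsub>curve_ring f\<^esub>" unfolding q curve_class_eq_zero_iff by (rule assms(2))
qed simp

lemma torsion_free_regular_element:
  fixes f :: "'k::field_char_0 poly poly"
  assumes M: "module (curve_ring f) M" and tf: "torsion_free_module (curve_ring f) (curve_grading wx wy f) M"
    and p: "weighted_homogeneous wx wy w p" "\<And>q. f dvd p * q \<Longrightarrow> f dvd q"
    and m: "m \<in> carrier M" "curve_class f p \<odot>\<^bsub>M\<^esub> m = \<zero>\<^bsub>M\<^esub>"
  shows "m = \<zero>\<^bsub>M\<^esub>"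
proof (rule torsion_free_injective[OF M tf _ _ m])
  show "curve_class f p \<in> homogeneous_nonzerodivisors (curve_ring f) (curve_grading wx wy f)"
    by (rule homogeneous_nonzerodivisorI[OF p])
  have "weighted_homogeneous wx wy 0 (1 :: 'k poly poly)"
    using weighted_homogeneous_const[of wx wy 1] by (simp add: one_pCons)
  then show "\<one>\<^bsub>curve_ring f\<^esub> \<in> homogeneous_nonzerodivisors (curve_ring f) (curve_grading wx wy f)"
    unfolding curve_class_one[symmetric] by (rule homogeneous_nonzerodivisorI) simp
qed

lemma inverse_of_nat_mult:
  "v > 0 \<Longrightarrow> const2 (inverse (of_nat v)) * (of_nat v * p) = (p :: 'k::field_char_0 poly poly)"
  unfolding of_nat_poly2 by (simp flip: one_pCons)

lemma graded_poly_module_of_curve: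
  fixes f :: "'k::field_char_0 poly poly"
  assumes gr: "graded_module (curve_ring f) (curve_grading wx wy f) M gM" and "wx > 0" "wy > 0"
  shows "graded_poly_module M (\<lambda>p m. curve_class f p \<odot>\<^bsub>M\<^esub> m) wx wy gM"
proof -
  interpret module "curve_ring f" M using gr by (simp add: graded_module_def)
  show ?thesis
  proof (rule graded_poly_module.intro[OF M.abelian_group_axioms graded_poly_module_axioms.intro])
    show "curve_class f p \<odot>\<^bsub>M\<^esub> m \<in> gM (v + w)"
      if "weighted_homogeneous wx wy v p" "m \<in> gM w" for v w p m
      using gr that by (auto simp: graded_module_def curve_grading_def)
    show "\<exists>!c. (\<forall>w. c w \<in> gM w) \<and> finite {w. c w \<noteq> \<zero>\<^bsub>M\<^esub>} \<and>
        m = (\<Oplus>\<^bsub>M\<^esub>w\<in>{w. c w \<noteq> \<zero>\<^bsub>M\<^esub>}. c w)" if "m \<in> carrier M" for m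
      using gr that unfolding graded_module_def by blast
  qed (use gr assms(2,3) in \<open>simp_all add: smult_r_distr curve_class_add smult_l_distr curve_class_mult
      smult_assoc1 curve_class_one graded_module_def\<close>)
qed

text \<open>
  Every derivation \<open>P\<close> of the curve is the multiple \<open>P Z / (wZ Z)\<close> of the Euler derivation, where \<open>Z\<close> is
  the coordinate, \<open>x\<close> or \<open>y\<close>, that is regular on \<open>A\<close>.
\<close>

lemma connection_of_weight_op:
  fixes f :: "'k::field_char_0 poly poly" and M :: "('k poly poly set, 'm) module"
  assumes curve: "quasi_homogeneous_curve wx wy d f"
    and gr: "graded_module (curve_ring f) (curve_grading wx wy f) M gM"
    and tf: "torsion_free_module (curve_ring f) (curve_grading wx wy f) M"
    and Z: "Z = var_x \<and> wZ = wx \<or> Z = var_y \<and> wZ = wy" and Z_reg: "\<And>q. f dvd Z * q \<Longrightarrow> f dvd q"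
    and T: "graded_poly_module.euler_operator M (\<lambda>p m. curve_class f p \<odot>\<^bsub>M\<^esub> m) wx wy gM T"
    and T_div: "\<And>px py m. f dvd of_nat wx * var_x * py - of_nat wy * var_y * px \<Longrightarrow> m \<in> carrier M \<Longrightarrow>
      \<exists>n\<in>carrier M. curve_class f (px * deriv_x Z + py * deriv_y Z) \<odot>\<^bsub>M\<^esub> T m = curve_class f Z \<odot>\<^bsub>M\<^esub> n"
  shows "\<exists>D. integrable_connection (curve_scalar f) (curve_ring f) M D \<and>
    graded_connection (curve_scalar f) (curve_ring f) (curve_grading wx wy f) M gM D"
proof -
  have f: "f \<noteq> 0" "weighted_homogeneous wx wy d f" "reduced_ring (curve_ring f)" and w: "wx > 0" "wy > 0"
    using curve by (simp_all add: quasi_homogeneous_curve_def)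
  have M: "module (curve_ring f) M" using gr by (simp add: graded_module_def)
  interpret module "curve_ring f" M by (rule M)
  interpret G: graded_poly_module M "\<lambda>p m. curve_class f p \<odot>\<^bsub>M\<^esub> m" wx wy gM
    by (rule graded_poly_module_of_curve[OF gr w])
  let ?A = "curve_ring f" and ?cc = "curve_class f"
  have wZ: "wZ > 0" using Z w by auto
  have Z_hom: "weighted_homogeneous wx wy (int wZ) Z" using Z by auto
  have Z_inj: "m = \<zero>\<^bsub>M\<^esub>" if "m \<in> carrier M" "?cc Z \<odot>\<^bsub>M\<^esub> m = \<zero>\<^bsub>M\<^esub>" for m
    by (rule torsion_free_regular_element[OF M tf Z_hom Z_reg that])
  define W where "W = of_nat wZ * Z"
  have W_hom: "weighted_homogeneous wx wy (int wZ) W"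
    using weighted_homogeneous_mult[OF weighted_homogeneous_const Z_hom]
    unfolding W_def of_nat_poly2 by (simp only: add_0)
  have euler_Z: "euler wx wy Z = W" using Z by (auto simp: W_def)
  have W_inj: "m = \<zero>\<^bsub>M\<^esub>" if m: "m \<in> carrier M" "?cc W \<odot>\<^bsub>M\<^esub> m = \<zero>\<^bsub>M\<^esub>" for m
  proof (rule Z_inj[OF m(1)])
    have "?cc Z \<odot>\<^bsub>M\<^esub> m = ?cc (const2 (inverse (of_nat wZ)) * W) \<odot>\<^bsub>M\<^esub> m"
      by (simp only: W_def inverse_of_nat_mult[OF wZ])
    also have "\<dots> = \<zero>\<^bsub>M\<^esub>" using m by (simp only: G.act_mult G.act_zero)
    finally show "?cc Z \<odot>\<^bsub>M\<^esub> m = \<zero>\<^bsub>M\<^esub>" .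
  qed
  \<comment> \<open>The Euler derivation descends to \<open>A\<close>, because it maps \<open>f\<close> to \<open>d f\<close>.\<close>
  define e where "e a = ?cc (euler wx wy (SOME p. a = ?cc p))" for a
  have e: "e (?cc p) = ?cc (euler wx wy p)" for p
  proof -
    define q where "q = (SOME q. ?cc p = ?cc q)"
    have "?cc p = ?cc q" unfolding q_def by (rule someI[of _ p]) simp
    then obtain g where g: "q = p + f * g"
      by (metis curve_class_eq_iff dvdE add_diff_cancel_left' diff_add_cancel add.commute)
    have "euler wx wy q - euler wx wy p = f * (euler wx wy g + of_int d * g)"
      unfolding g by (simp add: euler_add euler_mult euler_homogeneous[OF f(2)] algebra_simps)
    then have "?cc (euler wx wy q) = ?cc (euler wx wy p)" by (simp add: curve_class_eq_iff)
    then show ?thesis by (simp add: e_def q_def)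
  qed
  have lift: "\<exists>px py. (\<forall>p. P (?cc p) = ?cc (px * deriv_x p + py * deriv_y p)) \<and>
      f dvd of_nat wx * var_x * py - of_nat wy * var_y * px"
    if P: "P \<in> Der (curve_scalar f) ?A" for P
  proof -
    have "P (?cc var_x) \<in> carrier ?A" "P (?cc var_y) \<in> carrier ?A" using P by (auto simp: Der_def)
    then obtain px py where "P (?cc var_x) = ?cc px" "P (?cc var_y) = ?cc py"
      by (auto simp: curve_ring_carrier)
    with derivation_lift[OF P] derivation_parallel_euler[OF P _ _ f] show ?thesis by blast
  qed
  show ?thesis
  proof (rule integrable_graded_connection_of_operator[where Z = "?cc Z" and W = "?cc W" and e = e and T = T
        and ?c0.0 = "of_nat wZ" and wZ = "int wZ"])
    show "module ?A M" by (rule M)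
    show "curve_scalar f c \<in> carrier ?A" for c by (simp add: curve_scalar_def)
    show "?cc Z \<in> carrier ?A" by simp
    show "?cc W = curve_scalar f (of_nat wZ) \<otimes>\<^bsub>?A\<^esub> ?cc Z"
      unfolding W_def curve_scalar_def of_nat_poly2 by (rule curve_class_mult)
    show "e (?cc Z) = ?cc W" by (simp add: e euler_Z)
    show "m = \<zero>\<^bsub>M\<^esub>" if "m \<in> carrier M" "?cc W \<odot>\<^bsub>M\<^esub> m = \<zero>\<^bsub>M\<^esub>" for m
      using that by (rule W_inj)
    show "e a \<in> carrier ?A" if "a \<in> carrier ?A" for a by (simp add: e_def)
    show "e (curve_scalar f c) = \<zero>\<^bsub>?A\<^esub>" for c
      by (simp add: curve_scalar_def e curve_class_zero)
    show "T (a \<odot>\<^bsub>M\<^esub> m) = a \<odot>\<^bsub>M\<^esub> T m \<oplus>\<^bsub>M\<^esub> e a \<odot>\<^bsub>M\<^esub> m" if a: "a \<in> carrier ?A" and m: "m \<in> carrier M" for a m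
    proof -
      obtain p where "a = ?cc p" using a by (auto simp: curve_ring_carrier)
      then show ?thesis by (simp add: G.euler_operatorD(3)[OF T m] e)
    qed
  next
    fix P a assume P: "P \<in> Der (curve_scalar f) ?A" and "a \<in> carrier ?A"
    then obtain p where a: "a = ?cc p" by (auto simp: curve_ring_carrier)
    obtain px py where P_eq: "\<And>p. P (?cc p) = ?cc (px * deriv_x p + py * deriv_y p)"
      and par: "f dvd of_nat wx * var_x * py - of_nat wy * var_y * px" using lift[OF P] by blast
    have "f dvd W * (px * deriv_x p + py * deriv_y p) - (px * deriv_x Z + py * deriv_y Z) * euler wx wy p"
      using Z
    proof
      assume "Z = var_x \<and> wZ = wx"
      then have "W * (px * deriv_x p + py * deriv_y p) - (px * deriv_x Z + py * deriv_y Z) * euler wx wy p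
          = deriv_y p * (of_nat wx * var_x * py - of_nat wy * var_y * px)"
        by (simp add: W_def euler_def algebra_simps)
      then show ?thesis using par by simp
    next
      assume "Z = var_y \<and> wZ = wy"
      then have "W * (px * deriv_x p + py * deriv_y p) - (px * deriv_x Z + py * deriv_y Z) * euler wx wy p
          = - deriv_x p * (of_nat wx * var_x * py - of_nat wy * var_y * px)"
        by (simp add: W_def euler_def algebra_simps)
      then show ?thesis using par by simp
    qed
    then show "?cc W \<otimes>\<^bsub>?A\<^esub> P a = P (?cc Z) \<otimes>\<^bsub>?A\<^esub> e a"
      unfolding a e P_eq by (simp only: curve_class_eq_iff flip: curve_class_mult)
  next
    fix P m assume P: "P \<in> Der (curve_scalar f) ?A" and m: "m \<in> carrier M"
    obtain px py where P_eq: "\<And>p. P (?cc p) = ?cc (px * deriv_x p + py * deriv_y p)"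
      and par: "f dvd of_nat wx * var_x * py - of_nat wy * var_y * px" using lift[OF P] by blast
    obtain n where n: "n \<in> carrier M" "P (?cc Z) \<odot>\<^bsub>M\<^esub> T m = ?cc Z \<odot>\<^bsub>M\<^esub> n"
      using T_div[OF par m] unfolding P_eq by blast
    let ?n = "?cc (const2 (inverse (of_nat wZ))) \<odot>\<^bsub>M\<^esub> n"
    have "?cc W \<odot>\<^bsub>M\<^esub> ?n = ?cc (W * const2 (inverse (of_nat wZ))) \<odot>\<^bsub>M\<^esub> n"
      using n(1) by (simp only: G.act_mult)
    also have "W * const2 (inverse (of_nat wZ)) = Z"
      unfolding W_def mult.commute[of _ "const2 (inverse (of_nat wZ))"] by (rule inverse_of_nat_mult[OF wZ])
    finally show "\<exists>n\<in>carrier M. ?cc W \<odot>\<^bsub>M\<^esub> n = P (?cc Z) \<odot>\<^bsub>M\<^esub> T m"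
      using n by (intro bexI[of _ ?n]) simp_all
  next
    show "gM w \<subseteq> carrier M" for w using G.gM_closed by blast
    show "a \<odot>\<^bsub>M\<^esub> m \<in> gM (v + w)" if "a \<in> curve_grading wx wy f v" "m \<in> gM w" for v w a m
      using gr that by (auto simp: graded_module_def)
    show "?cc Z \<in> curve_grading wx wy f (int wZ)" using Z_hom by (simp add: curve_grading_def)
    show "m \<in> gM w" if m: "m \<in> carrier M" and "?cc W \<odot>\<^bsub>M\<^esub> m \<in> gM (int wZ + w)" for w m
      unfolding G.gM_iff[OF m]
    proof (intro allI impI)
      fix v assume "v \<noteq> w"
      then have "\<zero>\<^bsub>M\<^esub> = G.comp (int wZ + v) (?cc W \<odot>\<^bsub>M\<^esub> m)"
        by (simp add: G.comp_homogeneous[OF that(2)])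
      also have "\<dots> = ?cc W \<odot>\<^bsub>M\<^esub> G.comp v m" by (rule G.comp_act[OF m W_hom])
      finally have "?cc W \<odot>\<^bsub>M\<^esub> G.comp v m = \<zero>\<^bsub>M\<^esub>" ..
      with m show "G.comp v m = \<zero>\<^bsub>M\<^esub>" by (rule W_inj[OF G.comp_closed])
    qed
  qed (use G.euler_operatorD[OF T] in auto)
qed

text \<open>
  With a pure power of \<open>y\<close>, the coordinate \<open>x\<close> is regular on \<open>A\<close>, and the relation
  \<open>wx x P(y) = wy y P(x)\<close> puts \<open>y P(x)\<close> into \<open>x A\<close>; this is the condition under which \<open>P(x) T\<close> is divisible
  by \<open>x\<close>. With a pure power of \<open>x\<close> the variables trade roles.
\<close>

theorem connection_of_pure_power:
  fixes f :: "'k::field_char_0 poly poly"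
    and M :: "('k poly poly set, 'm) module"
  assumes curve: "quasi_homogeneous_curve wx wy d f"
    and gr: "graded_module (curve_ring f) (curve_grading wx wy f) M gM"
    and fg: "finitely_generated_module (curve_ring f) M"
    and tf: "torsion_free_module (curve_ring f) (curve_grading wx wy f) M"
    and power: "coeff2 f 0 n \<noteq> 0 \<or> coeff2 f n 0 \<noteq> 0"
  shows "\<exists>D. integrable_connection (curve_scalar f) (curve_ring f) M D \<and>
    graded_connection (curve_scalar f) (curve_ring f) (curve_grading wx wy f) M gM D"
proof -
  have f: "f \<noteq> 0" "weighted_homogeneous wx wy d f" and w: "wx > 0" "wy > 0" and d: "d > 0"
    using curve by (simp_all add: quasi_homogeneous_curve_def)
  have "coeff2 f 0 0 = 0"
    using f(2) d unfolding weighted_homogeneous_def by fastforce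
  with power obtain N where n: "n = Suc N" by (cases n) auto
  have M: "module (curve_ring f) M" using gr by (simp add: graded_module_def)
  interpret module "curve_ring f" M by (rule M)
  interpret G: graded_poly_module M "\<lambda>p m. curve_class f p \<odot>\<^bsub>M\<^esub> m" wx wy gM
    by (rule graded_poly_module_of_curve[OF gr w])
  let ?cc = "curve_class f"
  have f_act: "?cc f \<odot>\<^bsub>M\<^esub> m = \<zero>\<^bsub>M\<^esub>" if "m \<in> carrier M" for m
    using that curve_class_eq_zero_iff[of f f] by simp
  obtain S where S: "finite S" "S \<subseteq> carrier M" and
    gen: "\<And>m. m \<in> carrier M \<Longrightarrow> \<exists>c\<in>S \<rightarrow> carrier (curve_ring f). m = (\<Oplus>\<^bsub>M\<^esub>s\<in>S. c s \<odot>\<^bsub>M\<^esub> s)"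
    using fg unfolding finitely_generated_module_def by blast
  have gen': "\<exists>c. m = (\<Oplus>\<^bsub>M\<^esub>s\<in>S. ?cc (c s) \<odot>\<^bsub>M\<^esub> s)" if m: "m \<in> carrier M" for m
  proof -
    obtain c where c: "c \<in> S \<rightarrow> carrier (curve_ring f)" "m = (\<Oplus>\<^bsub>M\<^esub>s\<in>S. c s \<odot>\<^bsub>M\<^esub> s)" using gen[OF m] by blast
    then have "\<forall>s\<in>S. \<exists>p. c s = ?cc p" by (auto simp: curve_ring_carrier Pi_iff)
    then obtain p where p: "\<And>s. s \<in> S \<Longrightarrow> c s = ?cc (p s)" by metis
    have "m = (\<Oplus>\<^bsub>M\<^esub>s\<in>S. ?cc (p s) \<odot>\<^bsub>M\<^esub> s)"
      unfolding c(2) using S by (intro M.add.finprod_cong') (auto simp: p)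
    then show ?thesis by blast
  qed
  show ?thesis
    using power
  proof
    assume lead: "coeff2 f 0 n \<noteq> 0"
    have reg: "f dvd q" if "f dvd var_x * q" for q using var_x_nonzerodivisor[OF lead that] .
    interpret C: graded_curve_module M "\<lambda>p m. ?cc p \<odot>\<^bsub>M\<^esub> m" wx wy gM f d N S
  proof (rule graded_curve_module.intro[OF G.graded_poly_module_axioms graded_curve_module_axioms.intro])
      show "weighted_homogeneous wx wy d f" by (rule f(2))
      show "coeff2 f 0 (Suc N) \<noteq> 0" using lead n by simp
      show "m = \<zero>\<^bsub>M\<^esub>" if "m \<in> carrier M" "?cc var_x \<odot>\<^bsub>M\<^esub> m = \<zero>\<^bsub>M\<^esub>" for m
        by (rule torsion_free_regular_element[OF M tf weighted_homogeneous_var_x reg that])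
    qed (fact f_act S gen')+
    obtain T where T: "G.euler_operator T" and
      div: "\<And>q a b m. var_y * q = var_x * a + f * b \<Longrightarrow> m \<in> carrier M \<Longrightarrow>
        \<exists>n\<in>carrier M. ?cc q \<odot>\<^bsub>M\<^esub> T m = ?cc var_x \<odot>\<^bsub>M\<^esub> n"
      using C.exists_divisible_euler_operator by blast
    show ?thesis
    proof (rule connection_of_weight_op[OF curve gr tf, of var_x wx T])
      fix px py m assume "f dvd of_nat wx * var_x * py - of_nat wy * var_y * px" and m: "m \<in> carrier M"
      then obtain h where "of_nat wx * var_x * py - of_nat wy * var_y * px = f * h" by blast
      then have h: "of_nat wy * (var_y * px) = var_x * (of_nat wx * py) - f * h" by (simp add: algebra_simps)
      have "var_y * px = const2 (inverse (of_nat wy)) * (of_nat wy * (var_y * px))"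
        by (rule inverse_of_nat_mult[OF w(2), symmetric])
      also have "\<dots> = var_x * (const2 (inverse (of_nat wy)) * (of_nat wx * py)) + f * - (const2 (inverse (of_nat wy)) * h)"
        unfolding h by (simp only: distrib_left mult.left_commute diff_conv_add_uminus mult_minus_right)
      finally have "var_y * px = var_x * (const2 (inverse (of_nat wy)) * (of_nat wx * py))
        + f * - (const2 (inverse (of_nat wy)) * h)" .
      from div[OF this m]
      show "\<exists>n\<in>carrier M. ?cc (px * deriv_x var_x + py * deriv_y var_x) \<odot>\<^bsub>M\<^esub> T m = ?cc var_x \<odot>\<^bsub>M\<^esub> n"
        by simp
    qed (fact T | erule reg | simp)+
  next
    assume lead: "coeff2 f n 0 \<noteq> 0"
    have reg: "f dvd q" if "f dvd var_y * q" for q using var_y_nonzerodivisor[OF lead that] .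
    interpret Sw: graded_poly_module M "\<lambda>p m. ?cc (swap_vars p) \<odot>\<^bsub>M\<^esub> m" wy wx gM
      by (rule G.swapped)
    have gen_swap: "\<exists>c. m = (\<Oplus>\<^bsub>M\<^esub>s\<in>S. ?cc (swap_vars (c s)) \<odot>\<^bsub>M\<^esub> s)" if m: "m \<in> carrier M" for m
    proof -
      obtain c where "m = (\<Oplus>\<^bsub>M\<^esub>s\<in>S. ?cc (c s) \<odot>\<^bsub>M\<^esub> s)" using gen'[OF m] by blast
      then show ?thesis by (intro exI[of _ "\<lambda>s. swap_vars (c s)"]) simp
    qed
    interpret C: graded_curve_module M "\<lambda>p m. ?cc (swap_vars p) \<odot>\<^bsub>M\<^esub> m" wy wx gM "swap_vars f" d N S
  proof (rule graded_curve_module.intro[OF Sw.graded_poly_module_axioms graded_curve_module_axioms.intro])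
      show "weighted_homogeneous wy wx d (swap_vars f)" using f(2) by simp
      show "coeff2 (swap_vars f) 0 (Suc N) \<noteq> 0" using lead n by simp
      show "?cc (swap_vars (swap_vars f)) \<odot>\<^bsub>M\<^esub> m = \<zero>\<^bsub>M\<^esub>" if "m \<in> carrier M" for m
        using f_act[OF that] by (simp only: swap_vars_swap_vars)
      show "m = \<zero>\<^bsub>M\<^esub>" if "m \<in> carrier M" "?cc (swap_vars var_x) \<odot>\<^bsub>M\<^esub> m = \<zero>\<^bsub>M\<^esub>" for m
        by (rule torsion_free_regular_element[OF M tf weighted_homogeneous_var_y reg that[unfolded swap_vars_var_x]])
    qed (fact S gen_swap)+
    obtain T where T: "Sw.euler_operator T" and
      div: "\<And>q a b m. var_y * q = var_x * a + swap_vars f * b \<Longrightarrow> m \<in> carrier M \<Longrightarrow>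
        \<exists>n\<in>carrier M. ?cc (swap_vars q) \<odot>\<^bsub>M\<^esub> T m = ?cc (swap_vars var_x) \<odot>\<^bsub>M\<^esub> n"
      using C.exists_divisible_euler_operator by blast
    have T': "G.euler_operator T"
      unfolding G.euler_operator_def
    proof (intro conjI ballI allI)
      fix p m assume "m \<in> carrier M"
      then show "T (?cc p \<odot>\<^bsub>M\<^esub> m) = ?cc p \<odot>\<^bsub>M\<^esub> T m \<oplus>\<^bsub>M\<^esub> ?cc (euler wx wy p) \<odot>\<^bsub>M\<^esub> m"
        using Sw.euler_operatorD(3)[OF T, of m "swap_vars p"] by (simp add: euler_swap)
    qed (use Sw.euler_operatorD[OF T] in auto)
    show ?thesis
    proof (rule connection_of_weight_op[OF curve gr tf, of var_y wy T])
      fix px py m assume "f dvd of_nat wx * var_x * py - of_nat wy * var_y * px" and m: "m \<in> carrier M"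
      then obtain h where "of_nat wx * var_x * py - of_nat wy * var_y * px = f * h" by blast
      then have h: "of_nat wx * (var_x * py) = var_y * (of_nat wy * px) + f * h" by (simp add: algebra_simps)
      have "var_x * py = const2 (inverse (of_nat wx)) * (of_nat wx * (var_x * py))"
        by (rule inverse_of_nat_mult[OF w(1), symmetric])
      also have "\<dots> = var_y * (const2 (inverse (of_nat wx)) * (of_nat wy * px)) + f * (const2 (inverse (of_nat wx)) * h)"
        unfolding h by (simp only: distrib_left mult.left_commute)
      finally have "var_y * swap_vars py = var_x * swap_vars (const2 (inverse (of_nat wx)) * (of_nat wy * px))
          + swap_vars f * swap_vars (const2 (inverse (of_nat wx)) * h)"
        by (metis swap_vars_mult swap_vars_add swap_vars_var_x swap_vars_var_y)
      from div[OF this m] have "\<exists>n\<in>carrier M. ?cc (swap_vars (swap_vars py)) \<odot>\<^bsub>M\<^esub> T m = ?cc (swap_vars var_x) \<odot>\<^bsub>M\<^esub> n" .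
      then show "\<exists>n\<in>carrier M. ?cc (px * deriv_x var_y + py * deriv_y var_y) \<odot>\<^bsub>M\<^esub> T m = ?cc var_y \<odot>\<^bsub>M\<^esub> n"
        by simp
    qed (fact T' | erule reg | simp)+
  qed
qed

theorem theorem1:
  fixes f :: "'k::{alg_closed_field, field_char_0} poly poly"
    and wx wy :: nat and d :: int
    and M :: "('k poly poly set, 'm) module"
    and gM :: "int \<Rightarrow> 'm set"
  assumes "quasi_homogeneous_curve wx wy d f"
    and "graded_module (curve_ring f) (curve_grading wx wy f) M gM"
    and "finitely_generated_module (curve_ring f) M"
    and "torsion_free_module (curve_ring f) (curve_grading wx wy f) M"
    and "Factorial_Ring.irreducible f \<or> simple_curve_singularity f"
  shows "\<exists>D. integrable_connection (curve_scalar f) (curve_ring f) M D \<and>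
             graded_connection (curve_scalar f) (curve_ring f) (curve_grading wx wy f) M gM D"
proof -
  obtain n where "poly.coeff (poly.coeff f n) 0 \<noteq> 0 \<or> poly.coeff (poly.coeff f 0) n \<noteq> 0"
    using exists_pure_power[OF assms(5)] by blast
  with assms(1-4) show ?thesis by (rule connection_of_pure_power)
qed

end
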